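(* Let $\Phi:\mathbb{N}\to(1,\infty)$ be any function with $\lim_{n\to\infty}\Phi(n)=\infty$. Define $B$ and $b$ by $$\log B=\liminf_{n\to\infty}\frac{\log\Phi(n)}{n},\qquad \log b=\liminf_{n\to\infty}\frac{\log\log\Phi(n)}{n}.$$ Let $$\mathcal{F}(\Phi)=\left\{x\in[0,1):\ a_{n+1}(x)\,a_n(x)\ge\Phi(n)\ \text{for infinitely many } n\in\mathbb{N},\ \text{and}\ a_{n+1}(x)<\Phi(n)\ \text{for all sufficiently large } n\in\mathbb{N}\right\},$$ where $a_n(x)$ denotes the $n$th partial quotient of the continued fraction expansion of $x$. Then $$\dim_{\mathrm H}\mathcal{F}(\Phi)=\begin{cases} t_B=\inf\left\{s\ge 0:\ \mathsf{P}\left(T,\,-s^2\log B-s\log|T'|\right)\le 0\right\} & \text{if } 1<B<\infty,\\[1ex] \dfrac{1}{1+b} & \text{if } B=\infty,\end{cases}$$ where $\dim_{\mathrm H}$ is Hausdorff dimension, $T$ is the Gauss map, $T'$ is its derivative, and $\mathsf{P}$ is the pressure function of the Gauss map.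
   Context: Continued fractions. The Gauss map $T:[0,1)\to[0,1)$ is given by $T(0)=0$ and $T(x)=\frac1x \pmod 1$ (the fractional part of $1/x$) for $x\in(0,1)$. For irrational $x\in[0,1)$ the partial quotients are $a_1(x)=\lfloor 1/x\rfloor$ and $a_n(x)=a_1(T^{n-1}(x))$ for $n\ge2$, so that $x=[a_1(x),a_2(x),\ldots]$ is the simple continued fraction expansion $$x=\cfrac{1}{a_1(x)+\cfrac{1}{a_2(x)+\cdots}}.$$ For positive integers $a_1,\dots,a_n$ and $x\in[0,1)$, $[a_1,\dots,a_n+x]$ denotes the finite continued fraction whose last entry is $a_n+x$. The derivative of the Gauss map satisfies $|T'(x)|=x^{-2}$ at irrational $x$. Here $\mathbb{N}=\{1,2,3,\dots\}$. Pressure function. For a finite or infinite subset $\mathcal{A}\subseteq\mathbb{N}$ put $Y_{\mathcal A}=\{x\in[0,1): a_n(x)\in\mathcal{A}\text{ for all } n\ge1\}$. For a real function $\varphi:[0,1)\to\mathbb{R}$, let $S_n\varphi(x)=\varphi(x)+\varphi(Tx)+\cdots+\varphi(T^{n-1}x)$ and $$\mathsf{P}_{\mathcal A}(T,\varphi)=\lim_{n\to\infty}\frac1n\log\sum_{a_1,\dots,a_n\in\mathcal{A}}\ \sup_{x\in Y_{\mathcal A}} e^{S_n\varphi([a_1,\dots,a_n+x])}.$$ One writes $\mathsf{P}(T,\varphi)=\mathsf{P}_{\mathbb{N}}(T,\varphi)$; its value may be $+\infty$. In the claim the potential is the function $x\mapsto -s^2\log B-s\log|T'(x)|$. Conventions.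 $B=\infty$ (respectively $b=\infty$) means that the corresponding liminf equals $+\infty$, and $\frac{1}{1+b}=0$ when $b=\infty$. *)

theory Defs
  imports "HOL-Analysis.Analysis"
begin

section \<open>Hausdorff dimension\<close>

text \<open>
  The weight \<open>|U|\<^sup>s\<close> of a covering set, with the usual conventions that empty sets weigh nothing
  and that \<open>|U|\<^sup>0 = 1\<close> for every nonempty \<open>U\<close> (whereas \<open>0 powr 0 = 0\<close>).
\<close>

definition diam_weight :: "real \<Rightarrow> 'a::metric_space set \<Rightarrow> ennreal" where
  "diam_weight s U =
     (if U = {} then 0 else if s = 0 then 1 else ennreal (diameter U powr s))"

text \<open>Boundedness is required because \<^const>\<open>diameter\<close> is meaningful only for bounded sets.\<close>

definition hausdorff_premeasure :: "real \<Rightarrow> real \<Rightarrow> 'a::metric_space set \<Rightarrow> ennreal" where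
  "hausdorff_premeasure s \<delta> A =
     Inf {(\<Sum>i. diam_weight s (U i)) | U :: nat \<Rightarrow> 'a set.
            A \<subseteq> (\<Union>i. U i) \<and> (\<forall>i. bounded (U i) \<and> diameter (U i) \<le> \<delta>)}"

definition hausdorff_measure :: "real \<Rightarrow> 'a::metric_space set \<Rightarrow> ennreal" where
  "hausdorff_measure s A = (SUP \<delta>\<in>{0<..}. hausdorff_premeasure s \<delta> A)"

definition hausdorff_dim :: "'a::metric_space set \<Rightarrow> ennreal" where
  "hausdorff_dim A = Inf {ennreal s | s. 0 \<le> s \<and> hausdorff_measure s A = 0}"


section \<open>Continued fractions\<close>

definition gauss_map :: "real \<Rightarrow> real" where
  "gauss_map x = (if x = 0 then 0 else frac (1 / x))"

text \<open>
  Indexing starts at 1. For rational \<open>x \<in> [0,1)\<close> the orbit of \<open>x\<close> reaches \<open>0\<close>, where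
  \<open>1 / 0 = 0\<close>, so all but finitely many of the numbers below are \<open>0\<close>. Hence no rational number
  belongs to \<open>cf_digits_in A\<close> for \<open>0 \<notin> A\<close>, nor to the set \<open>exceptional_set \<Phi>\<close> below when \<open>\<Phi> > 1\<close>.
\<close>

definition partial_quotient :: "nat \<Rightarrow> real \<Rightarrow> nat" where
  "partial_quotient n x = nat \<lfloor>1 / (gauss_map ^^ (n - 1)) x\<rfloor>"

text \<open>\<open>cf_append [a\<^sub>1, \<dots>, a\<^sub>n] x\<close> is the finite continued fraction \<open>[a\<^sub>1, \<dots>, a\<^sub>n + x]\<close>.\<close>

fun cf_append :: "nat list \<Rightarrow> real \<Rightarrow> real" where
  "cf_append [] x = x"
| "cf_append (a # as) x = 1 / (real a + cf_append as x)"

definition cf_digits_in :: "nat set \<Rightarrow> real set" where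
  "cf_digits_in A = {x \<in> {0..<1}. \<forall>n\<ge>1. partial_quotient n x \<in> A}"


section \<open>The pressure function\<close>

definition ln_ennreal :: "ennreal \<Rightarrow> ereal" where
  "ln_ennreal x = (if x = 0 then -\<infinity> else if x = \<infinity> then \<infinity> else ereal (ln (enn2real x)))"

definition birkhoff_sum :: "('a \<Rightarrow> 'a) \<Rightarrow> ('a \<Rightarrow> real) \<Rightarrow> nat \<Rightarrow> 'a \<Rightarrow> real" where
  "birkhoff_sum T \<phi> n x = (\<Sum>k<n. \<phi> ((T ^^ k) x))"

text \<open>
  The sum over \<open>a\<^sub>1, \<dots>, a\<^sub>n \<in> A\<close> is taken in \<open>[0, \<infinity>]\<close>, so that the pressure may be infinite.
\<close>

definition pressure_sum :: "nat set \<Rightarrow> (real \<Rightarrow> real) \<Rightarrow> nat \<Rightarrow> ennreal" where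
  "pressure_sum A \<phi> n =
     (\<Sum>\<^sub>\<infinity>as\<in>{as. length as = n \<and> set as \<subseteq> A}.
        SUP x\<in>cf_digits_in A. ennreal (exp (birkhoff_sum gauss_map \<phi> n (cf_append as x))))"

definition pressure_on :: "nat set \<Rightarrow> (real \<Rightarrow> real) \<Rightarrow> ereal" where
  "pressure_on A \<phi> = lim (\<lambda>n. ln_ennreal (pressure_sum A \<phi> n) / ereal (real n))"

abbreviation pressure :: "(real \<Rightarrow> real) \<Rightarrow> ereal" where
  "pressure \<equiv> pressure_on {1..}"


section \<open>The exceptional set and its dimensional number\<close>

definition exceptional_set :: "(nat \<Rightarrow> real) \<Rightarrow> real set" where
  "exceptional_set \<Phi> =
     {x \<in> {0..<1}.
        (\<exists>\<^sub>\<infinity>n. real (partial_quotient (n + 1) x) * real (partial_quotient n x) \<ge> \<Phi> n) \<and>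
        (\<forall>\<^sub>\<infinity>n. real (partial_quotient (n + 1) x) < \<Phi> n)}"

text \<open>
  The pressure evaluates the potential only at irrational points of \<open>(0,1)\<close>, where
  \<^const>\<open>gauss_map\<close> is differentiable with derivative \<open>-1 / x\<^sup>2\<close>.
\<close>

definition dimensional_number :: "real \<Rightarrow> ennreal" where
  "dimensional_number B =
     Inf {ennreal s | s. 0 \<le> s \<and>
            pressure (\<lambda>x. - (s\<^sup>2) * ln B - s * ln \<bar>deriv gauss_map x\<bar>) \<le> 0}"

end

theory Submission
  imports Defs "HOL-Probability.Infinite_Product_Measure"
begin

text \<open>
Write \<open>q(w)\<close> for the denominator of the convergent with digits \<open>w = [a\<^sub>1, \<dots>, a\<^sub>n]\<close>. The points whose
expansion begins with \<open>w\<close> fill an interval of length about \<open>q(w)\<^sup>-\<^sup>2\<close>, and prescribing in addition that the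
next digit is at least \<open>t\<close> shrinks it by the factor \<open>1 / t\<close>. Everything below is a comparison
of sums of powers of such lengths. The sums \<open>Z\<^sub>n(s) = \<Sum>q(w)\<^sup>-\<^sup>2\<^sup>s\<close> over all words of length \<open>n\<close> (\<open>cf_zeta\<close>) are
multiplicative in \<open>n\<close> up to a constant factor, because \<open>q(u) q(v) \<le> q(uv) \<le> 2 q(u) q(v)\<close>. So \<open>ln Z\<^sub>n(s) / n\<close>
converges with error \<open>O(1/n)\<close>, and the pressure at \<open>s\<close> is \<open>P(s) = lim ln Z\<^sub>n(s) / n - s\<^sup>2 ln B\<close>
(\<open>pressure_finite\<close>, \<open>pressure_eq_infinity\<close>). The sign of \<open>P(s)\<close> therefore compares \<open>Z\<^sub>n(s)\<close> with \<open>B\<close> to the power \<open>s\<^sup>2 n\<close>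
for every single \<open>n\<close>.

Finite \<open>B\<close>, upper bound (\<open>exceptional_dim_le_pressure\<close>). Fix the first \<open>n - 1\<close> digits and suppose that
\<open>a\<^sub>n a\<^sub>n\<^sub>+\<^sub>1 \<ge> B\<^sup>n\<close>. Either \<open>a\<^sub>n\<close> is at least \<open>A\<close>, the \<open>s n\<close>-th power of \<open>B\<close>, which costs \<open>A\<^sup>-\<^sup>s\<close>, or \<open>a\<^sub>n = a < A\<close> and
\<open>a\<^sub>n\<^sub>+\<^sub>1 \<ge> B\<^sup>n / a\<close>, which costs \<open>\<Sum>(a B\<^sup>n)\<^sup>-\<^sup>s\<close> over \<open>a < A\<close>. With this \<open>A\<close> both costs are \<open>B\<close> to the power \<open>- s\<^sup>2 n\<close>,
up to constants: this is where the exponent \<open>s\<^sup>2\<close> comes from. A Borel-Cantelli argument for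
Hausdorff measure (\<open>hausdorff_measure_limsup\<close>) finishes the proof.

Finite \<open>B\<close>, lower bound (\<open>exceptional_dim_ge_pressure\<close>). If \<open>P(s) > 0\<close>, then already a finite set of words of some
length \<open>p\<close> has a sum that beats the \<open>s\<^sup>2 p\<close>-th power of a number slightly larger than \<open>B\<close>. Concatenate such words
freely, and at a sparse sequence of positions \<open>n\<close> with \<open>\<Phi>(n)\<close> close to \<open>B\<^sup>n\<close> insert a pair of digits of sizes
\<open>B\<close> to the powers \<open>s n\<close> and \<open>(1 - s) n\<close>. The product is as large as required, while both exponents are smaller than \<open>n\<close>, so
that the single digits stay below \<open>\<Phi>\<close>. A product measure that weighs the words by \<open>q\<^sup>-\<^sup>2\<^sup>s\<close> and
the large digits uniformly satisfies the hypothesis of the mass distribution principle (\<open>mass_distribution_principle\<close>).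
The infimum in \<open>dimensional_number\<close> is at most 1, since the invariance of the Gauss density bounds
\<open>Z\<^sub>n(1)\<close> by 2 (\<open>cf_zeta_1_le\<close>); hence only \<open>s < 1\<close> has to be considered.

Infinite \<open>B\<close>. If \<open>1 \<le> c < b\<close>, then points of the exceptional set must have infinitely many digits with
\<open>ln a\<^sub>n\<^sub>+\<^sub>1 \<ge> (c - 1) ln (a\<^sub>1 \<cdots> a\<^sub>n) + n ln K\<close> for every \<open>K\<close>, since otherwise the logarithm of \<open>a\<^sub>n a\<^sub>n\<^sub>+\<^sub>1\<close> would grow too slowly.
The corresponding cover has a sum that factorises over the digits, and it converges for \<open>s > 1 / (1 + c)\<close>
(\<open>exceptional_dim_le_growth\<close>). For the lower bound take digits \<open>a\<^sub>n\<^sub>+\<^sub>1\<close> freely between \<open>N\<^sub>n\<close> and \<open>2 N\<^sub>n\<close>, where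
\<open>ln N\<^sub>n\<close>, up to a bounded error, grows at most by the factor \<open>\<beta> > b\<close> in each step and reaches \<open>ln \<Phi>(n)\<close> infinitely often without ever
overtaking it (\<open>exceptional_dim_ge_growth\<close>). Such a Cantor set has dimension at least \<open>1 / (1 + \<beta>)\<close>.
\<close>


section \<open>Hausdorff measure: covers and mass distributions\<close>

lemma hausdorff_measure_eq_0I:
  fixes E :: "'a::metric_space set"
  assumes "\<And>\<delta> \<epsilon>. 0 < \<delta> \<Longrightarrow> 0 < \<epsilon> \<Longrightarrow> hausdorff_premeasure s \<delta> E \<le> ennreal \<epsilon>"
  shows "hausdorff_measure s E = 0"
proof -
  have "hausdorff_premeasure s \<delta> E \<le> 0" if "0 < \<delta>" for \<delta>
    by (rule ennreal_le_epsilon) (use assms that in auto)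
  then show ?thesis
    by (simp add: hausdorff_measure_def SUP_eq_iff bot_ennreal)
qed

text \<open>
The tails of the sequence \<open>U\<close> are covers of \<open>E\<close>, and their total weight tends to 0. A small total weight also
makes every single diameter small, so such a tail is admissible for each \<open>\<delta>\<close>.
\<close>
lemma hausdorff_measure_limsup_nat:
  fixes E :: "'a::metric_space set" and U :: "nat \<Rightarrow> 'a set"
  assumes s: "0 < s" and bdd: "\<And>i. bounded (U i)"
    and sum: "summable (\<lambda>i. diameter (U i) powr s)"
    and io: "\<And>x. x \<in> E \<Longrightarrow> \<exists>\<^sub>\<infinity>i. x \<in> U i"
  shows "hausdorff_measure s E = 0"
proof (rule hausdorff_measure_eq_0I)
  fix \<delta> \<epsilon> :: real assume "0 < \<delta>" "0 < \<epsilon>"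
  define w where "w i = diameter (U i) powr s" for i
  have "0 < min \<epsilon> (\<delta> powr s)" using \<open>0 < \<delta>\<close> \<open>0 < \<epsilon>\<close> by simp
  from suminf_exist_split[OF this sum] obtain N where
    N: "norm (\<Sum>i. w (i + N)) < min \<epsilon> (\<delta> powr s)" unfolding w_def by blast
  define V where "V i = U (i + N)" for i
  have sumN: "summable (\<lambda>i. w (i + N))" using sum unfolding w_def by (rule summable_ignore_initial_segment)
  have w0: "0 \<le> w i" for i by (simp add: w_def)
  have "w (i + N) \<le> (\<Sum>i. w (i + N))" for i
  proof -
    have "w (i + N) \<le> sum (\<lambda>j. w (j + N)) {..i}" by (rule member_le_sum) (auto simp: w_def)
    also have "\<dots> \<le> (\<Sum>i. w (i + N))" by (rule sum_le_suminf[OF sumN finite_atMost w0])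
    finally show ?thesis .
  qed
  moreover have tail: "(\<Sum>i. w (i + N)) < min \<epsilon> (\<delta> powr s)"
    using N unfolding real_norm_def by (rule le_less_trans[OF abs_ge_self])
  ultimately have small: "w (i + N) < \<delta> powr s" for i
    by (rule le_less_trans[OF _ less_le_trans[OF _ min.cobounded2]])
  have "diameter (V i) \<le> \<delta>" for i
  proof (rule ccontr)
    assume "\<not> diameter (V i) \<le> \<delta>"
    then have "\<delta> powr s \<le> diameter (V i) powr s"
      using \<open>0 < \<delta>\<close> s by (intro powr_mono2) auto
    then show False using small[of i] by (simp add: w_def V_def)
  qed
  moreover have "E \<subseteq> (\<Union>i. V i)"
  proof
    fix x assume "x \<in> E"
    from io[OF this] obtain i where "i \<ge> N" "x \<in> U i" unfolding INFM_nat_le by blast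
    then show "x \<in> (\<Union>i. V i)" unfolding V_def
      by (auto intro!: exI[of _ "i - N"])
  qed
  ultimately have "hausdorff_premeasure s \<delta> E \<le> (\<Sum>i. diam_weight s (V i))"
    unfolding hausdorff_premeasure_def using bdd by (intro Inf_lower) (auto simp: V_def)
  also have "\<dots> \<le> (\<Sum>i. ennreal (w (i + N)))"
    using s by (intro suminf_le) (auto simp: diam_weight_def V_def w_def)
  also have "\<dots> = ennreal (\<Sum>i. w (i + N))" using w0 sumN by (rule suminf_ennreal2)
  also have "\<dots> \<le> ennreal \<epsilon>" using tail by (intro ennreal_leI) auto
  finally show "hausdorff_premeasure s \<delta> E \<le> ennreal \<epsilon>" .
qed

text \<open>
The Borel-Cantelli lemma for Hausdorff measure. Covers by cylinders are indexed by words, hence the general index set.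
\<close>
lemma hausdorff_measure_limsup:
  fixes E :: "'a::metric_space set" and J :: "'i \<Rightarrow> 'a set"
  assumes I: "countable I" and s: "0 < s" and bdd: "\<And>i. i \<in> I \<Longrightarrow> bounded (J i)"
    and diam: "\<And>i. i \<in> I \<Longrightarrow> diameter (J i) powr s \<le> w i"
    and sum: "(\<integral>\<^sup>+ i. ennreal (w i) \<partial>count_space I) < \<infinity>"
    and io: "\<And>x. x \<in> E \<Longrightarrow> infinite {i \<in> I. x \<in> J i}"
  shows "hausdorff_measure s E = 0"
proof (rule hausdorff_measure_limsup_nat[OF s])
  define K where "K = to_nat_on I ` I"
  have inj: "inj_on (to_nat_on I) I" using I by (rule inj_on_to_nat_on)
  define g where "g = inv_into I (to_nat_on I)"
  have g: "g (to_nat_on I i) = i" if "i \<in> I" for i using inj that by (simp add: g_def)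
  define U where "U n = (if n \<in> K then J (g n) else {})" for n
  have gK: "g n \<in> I" if "n \<in> K" for n using that g by (auto simp: K_def)
  show "bounded (U n)" for n using bdd gK by (auto simp: U_def)
  show "summable (\<lambda>i. diameter (U i) powr s)"
  proof (rule summable_suminf_not_top)
    have "(\<Sum>i. ennreal (diameter (U i) powr s))
        = (\<integral>\<^sup>+ n. ennreal (diameter (U n) powr s) \<partial>count_space UNIV)"
      by (simp add: nn_integral_count_space_nat)
    also have "\<dots> \<le> (\<integral>\<^sup>+ n. ennreal (w (g n)) * indicator K n \<partial>count_space UNIV)"
      using s diam gK by (intro nn_integral_mono) (auto simp: U_def split: split_indicator intro!: ennreal_leI)
    also have "\<dots> = (\<integral>\<^sup>+ n. ennreal (w (g n)) \<partial>count_space K)"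
      by (simp add: nn_integral_count_space_indicator)
    also have "\<dots> = (\<integral>\<^sup>+ i. ennreal (w (g (to_nat_on I i))) \<partial>count_space I)"
      by (rule nn_integral_bij_count_space[symmetric]) (simp add: K_def bij_betw_def inj)
    also have "\<dots> = (\<integral>\<^sup>+ i. ennreal (w i) \<partial>count_space I)"
      by (intro nn_integral_cong) (simp add: g)
    finally show "(\<Sum>i. ennreal (diameter (U i) powr s)) \<noteq> top" using sum by (auto simp: top_unique)
  qed simp
  show "\<exists>\<^sub>\<infinity>n. x \<in> U n" if "x \<in> E" for x
  proof -
    have "infinite (to_nat_on I ` {i \<in> I. x \<in> J i})"
      using io[OF that] inj by (metis (no_types, lifting) finite_imageD inj_on_subset mem_Collect_eq subsetI)
    moreover have "to_nat_on I ` {i \<in> I. x \<in> J i} \<subseteq> {n. x \<in> U n}"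
    proof clarsimp
      fix i assume "i \<in> I" "x \<in> J i"
      then show "x \<in> U (to_nat_on I i)" by (simp add: U_def K_def g)
    qed
    ultimately show ?thesis unfolding INFM_iff_infinite using finite_subset by blast
  qed
qed

text \<open>
The upper limit \<open>u\<close> allows proofs that use \<open>s < 1\<close>.
\<close>
lemma hausdorff_dim_leI:
  assumes "0 \<le> t" "t < u" "\<And>s. t < s \<Longrightarrow> s < u \<Longrightarrow> hausdorff_measure s E = 0"
  shows "hausdorff_dim E \<le> ennreal t"
proof (rule ennreal_le_epsilon)
  fix e :: real assume "0 < e"
  define d where "d = min e ((u - t) / 2)"
  have d: "0 < d" "d \<le> e" "t + d < u" using assms(2) \<open>0 < e\<close> by (auto simp: d_def min_def field_simps)
  have "hausdorff_dim E \<le> ennreal (t + d)"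
    unfolding hausdorff_dim_def using assms d
    by (intro Inf_lower CollectI exI[of _ "t + d"]) auto
  also have "\<dots> \<le> ennreal (t + e)" using d by (intro ennreal_leI) auto
  finally show "hausdorff_dim E \<le> ennreal t + ennreal e" using assms \<open>0 < e\<close> by simp
qed

lemma hausdorff_measure_mono: "E \<subseteq> F \<Longrightarrow> hausdorff_measure s E \<le> hausdorff_measure s F"
  unfolding hausdorff_measure_def hausdorff_premeasure_def
  by (intro SUP_mono' Inf_superset_mono) blast

lemma hausdorff_dim_mono: "E \<subseteq> F \<Longrightarrow> hausdorff_dim E \<le> hausdorff_dim F"
  unfolding hausdorff_dim_def
proof (intro Inf_superset_mono subsetI)
  fix x assume "E \<subseteq> F" and "x \<in> {ennreal s |s. 0 \<le> s \<and> hausdorff_measure s F = 0}"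
  then obtain s where "x = ennreal s" "0 \<le> s" "hausdorff_measure s F = 0" by blast
  moreover have "hausdorff_measure s E = 0"
    using hausdorff_measure_mono[OF \<open>E \<subseteq> F\<close>, of s] calculation(3) by simp
  ultimately show "x \<in> {ennreal s |s. 0 \<le> s \<and> hausdorff_measure s E = 0}" by blast
qed

lemma nn_integral_count_space_Sigma:
  fixes f :: "'a \<Rightarrow> 'b \<Rightarrow> ennreal"
  shows "(\<integral>\<^sup>+ p. f (fst p) (snd p) \<partial>count_space (Sigma A B))
       = (\<integral>\<^sup>+ a. \<integral>\<^sup>+ b. f a b \<partial>count_space (B a) \<partial>count_space A)"
proof -
  have "(\<integral>\<^sup>+ p. f (fst p) (snd p) \<partial>count_space (Sigma A B))
      = (\<integral>\<^sup>+ p. f (fst p) (snd p) * indicator (Sigma A B) p \<partial>count_space UNIV)"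
    by (rule nn_integral_count_space_indicator) simp
  also have "\<dots> = (\<integral>\<^sup>+ a. \<integral>\<^sup>+ b. f a b * indicator (Sigma A B) (a, b) \<partial>count_space UNIV \<partial>count_space UNIV)"
    by (subst nn_integral_fst_count_space[symmetric]) simp
  also have "\<dots> = (\<integral>\<^sup>+ a. (\<integral>\<^sup>+ b. f a b * indicator (B a) b \<partial>count_space UNIV) * indicator A a \<partial>count_space UNIV)"
    by (intro nn_integral_cong) (auto simp: nn_integral_0_iff_AE AE_count_space split: split_indicator intro!: nn_integral_cong)
  also have "\<dots> = (\<integral>\<^sup>+ a. \<integral>\<^sup>+ b. f a b \<partial>count_space (B a) \<partial>count_space A)"
    by (simp add: nn_integral_count_space_indicator)
  finally show ?thesis .
qed

text \<open>
The dyadic intervals of level \<open>n\<close> contribute \<open>2\<^sup>n\<close> terms of size \<open>2\<^sup>-\<^sup>n\<^sup>s\<close>.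
\<close>
lemma hausdorff_measure_unit_interval:
  assumes s: "1 < s"
  shows "hausdorff_measure s {0..<1::real} = 0"
proof -
  define I where "I = (SIGMA n:(UNIV::nat set). {..<(2::nat)^n})"
  define J :: "nat \<times> nat \<Rightarrow> real set" where "J = (\<lambda>(n,k). {real k / 2^n .. (real k + 1) / 2^n})"
  show ?thesis
  proof (rule hausdorff_measure_limsup[where I = I and J = J and w = "\<lambda>(n,k). (1/2^n) powr s"])
    show "countable I" by simp
    show "0 < s" using s by simp
    show "bounded (J i)" for i by (auto simp: J_def split: prod.splits)
    show "diameter (J i) powr s \<le> (case i of (n, k) \<Rightarrow> (1/2^n) powr s)" if "i \<in> I" for i
    proof (cases i)
      case (Pair n k)
      have "real k / 2^n \<le> (real k + 1) / 2^n" by (simp add: divide_right_mono)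
      then show ?thesis by (simp add: Pair J_def diff_divide_distrib[symmetric])
    qed
    show "infinite {i \<in> I. x \<in> J i}" if x: "x \<in> {0..<1}" for x
    proof -
      define f where "f n = (n, nat \<lfloor>x * 2^n\<rfloor>)" for n :: nat
      have "f n \<in> {i \<in> I. x \<in> J i}" for n
      proof -
        have "0 \<le> x * 2^n" "x * 2^n < 2^n" using x by auto
        then have 1: "\<lfloor>x * 2^n\<rfloor> < 2^n" by (simp add: floor_less_iff)
        have 2: "real (nat \<lfloor>x * 2^n\<rfloor>) \<le> x * 2^n" "x * 2^n \<le> real (nat \<lfloor>x * 2^n\<rfloor>) + 1"
          using \<open>0 \<le> x * 2^n\<close> by linarith+
        have "nat \<lfloor>x * 2^n\<rfloor> < 2^n" using 1 by (simp add: nat_less_iff)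
        then show ?thesis using 2 by (simp add: f_def I_def J_def field_simps)
      qed
      then have "range f \<subseteq> {i \<in> I. x \<in> J i}" by auto
      moreover have "inj f" by (auto simp: f_def inj_def)
      ultimately show ?thesis using infinite_iff_countable_subset by blast
    qed
    have "(\<integral>\<^sup>+ i. ennreal (case i of (n, k) \<Rightarrow> (1/2^n) powr s) \<partial>count_space I)
        = (\<integral>\<^sup>+ n. \<integral>\<^sup>+ k. ennreal ((1/2^n) powr s) \<partial>count_space {..<(2::nat)^n} \<partial>count_space UNIV)"
      unfolding I_def by (subst nn_integral_count_space_Sigma[symmetric]) (simp add: case_prod_unfold)
    also have "\<dots> = (\<Sum>n. ennreal (2^n * (1/2^n) powr s))"
      by (subst nn_integral_count_space_nat) (simp add: nn_integral_count_space_finite ennreal_mult mult.commute flip: ennreal_power)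
    also have "\<dots> = (\<Sum>n. ennreal ((2 powr (1 - s))^n))"
    proof (intro suminf_cong)
      fix n :: nat
      show "ennreal (2^n * (1/2^n) powr s) = ennreal ((2 powr (1 - s))^n)"
        by (simp add: powr_diff powr_divide power_divide powr_powr powr_realpow[symmetric] mult.commute)
    qed
    also have "\<dots> < \<infinity>"
    proof -
      have "summable (\<lambda>n. (2 powr (1 - s))^n :: real)"
        using s by (intro summable_geometric) (auto simp: powr_less_one)
      then show ?thesis by (subst suminf_ennreal2) (auto simp: less_top)
    qed
    finally show "(\<integral>\<^sup>+ i. ennreal (case i of (n, k) \<Rightarrow> (1/2^n) powr s) \<partial>count_space I) < \<infinity>" .
  qed
qed

text \<open>
A lower bound for the dimension of a Cantor set that is parametrised by independent choices \<open>\<omega> k \<in> A k\<close>. The measure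
is the product of the weights \<open>f k\<close>. Consider a covering set of diameter \<open>d\<close>, and let \<open>k\<close> be the first index at which
two of its points differ. All its points share their first \<open>k\<close> choices, so its mass is at most the mass of that common
prefix times the weight of the set \<open>V\<close> of all choices that occur at index \<open>k\<close>; hypothesis \<open>est\<close> bounds this product by
\<open>C d\<^sup>s\<close>. Sets that contain only one point are handled by \<open>null\<close>. Since the total mass is 1, no cover can have a small
\<open>s\<close>-dimensional sum.
\<close>
lemma mass_distribution_principle:
  fixes A :: "nat \<Rightarrow> 'a set" and f :: "nat \<Rightarrow> 'a \<Rightarrow> real" and \<pi> :: "(nat \<Rightarrow> 'a) \<Rightarrow> 'b::metric_space"
  assumes fin: "\<And>k. finite (A k)" and f0: "\<And>k v. v \<in> A k \<Longrightarrow> 0 \<le> f k v"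
    and f1: "\<And>k. sum (f k) (A k) = 1"
    and s: "0 < s" and C: "0 < C"
    and null: "\<And>\<omega> e. \<omega> \<in> Pi UNIV A \<Longrightarrow> 0 < e \<Longrightarrow> \<exists>k. (\<Prod>i<k. f i (\<omega> i)) < e"
    and est: "\<And>\<omega> k V d v1 v2. \<omega> \<in> Pi UNIV A \<Longrightarrow> V \<subseteq> A k \<Longrightarrow> v1 \<in> V \<Longrightarrow> v2 \<in> V \<Longrightarrow> v1 \<noteq> v2 \<Longrightarrow>
       (\<And>v v'. v \<in> V \<Longrightarrow> v' \<in> V \<Longrightarrow> \<exists>\<eta>\<in>Pi UNIV A. \<exists>\<eta>'\<in>Pi UNIV A.
          (\<forall>i<k. \<eta> i = \<omega> i) \<and> (\<forall>i<k. \<eta>' i = \<omega> i) \<and> \<eta> k = v \<and> \<eta>' k = v' \<and> dist (\<pi> \<eta>) (\<pi> \<eta>') \<le> d) \<Longrightarrow>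
       (\<Prod>i<k. f i (\<omega> i)) * sum (f k) V \<le> C * d powr s"
  shows "ennreal s \<le> hausdorff_dim (\<pi> ` Pi UNIV A)"
proof -
  let ?E = "\<pi> ` Pi UNIV A"
  define M where "M k = point_measure (A k) (\<lambda>v. ennreal (f k v))" for k
  interpret M: prob_space "M k" for k
    unfolding M_def by (rule prob_space_point_measure) (use fin f0 f1 in auto)
  interpret P: product_prob_space M UNIV by unfold_locales
  let ?P = "Pi\<^sub>M UNIV M"
  have spM: "space (M k) = A k" and setsM: "sets (M k) = Pow (A k)" for k
    by (simp_all add: M_def space_point_measure sets_point_measure)
  have spP: "space ?P = Pi UNIV A" by (simp add: space_PiM spM PiE_UNIV_domain Pi_def)
  have emM: "emeasure (M k) X = ennreal (sum (f k) X)" if "X \<subseteq> A k" for k X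
    unfolding M_def using that fin f0 by (subst emeasure_point_measure_finite) (auto intro!: sum_ennreal)
  define cyl where "cyl \<omega> k V = {\<eta> \<in> space ?P. \<forall>i\<in>{..k}. \<eta> i \<in> (if i = k then V else {\<omega> i})}" for \<omega> k V
  have cyl_em: "emeasure ?P (cyl \<omega> k V) = ennreal ((\<Prod>i<k. f i (\<omega> i)) * sum (f k) V)"
    and cyl_sets: "cyl \<omega> k V \<in> sets ?P"
    if \<omega>: "\<omega> \<in> Pi UNIV A" and V: "V \<subseteq> A k" for \<omega> k V
  proof -
    have X: "(if i = k then V else {\<omega> i}) \<in> sets (M i)" for i
      using \<omega> V by (auto simp: setsM)
    show "cyl \<omega> k V \<in> sets ?P" unfolding cyl_def
      by (intro sets.sets_Collect_finite_All sets_Collect_single') (use X in \<open>auto simp: spM setsM\<close>)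
    have "emeasure ?P (cyl \<omega> k V) = (\<Prod>i\<in>{..k}. emeasure (M i) (if i = k then V else {\<omega> i}))"
      unfolding cyl_def by (rule P.emeasure_PiM_Collect) (use X in auto)
    also have "\<dots> = (\<Prod>i\<in>{..k}. ennreal (if i = k then sum (f k) V else f i (\<omega> i)))"
      using \<omega> V by (intro prod.cong refl) (auto simp: emM Pi_iff)
    also have "\<dots> = ennreal (\<Prod>i\<in>{..k}. if i = k then sum (f k) V else f i (\<omega> i))"
      using \<omega> V f0 by (intro prod_ennreal) (auto intro!: sum_nonneg simp: Pi_iff subset_iff)
    also have "{..k} = insert k {..<k}" by auto
    also have "(\<Prod>i\<in>insert k {..<k}. if i = k then sum (f k) V else f i (\<omega> i))
             = sum (f k) V * (\<Prod>i\<in>{..<k}. if i = k then sum (f k) V else f i (\<omega> i))"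
      by (subst prod.insert) auto
    also have "(\<Prod>i\<in>{..<k}. if i = k then sum (f k) V else f i (\<omega> i)) = (\<Prod>i<k. f i (\<omega> i))"
      by (intro prod.cong) auto
    finally show "emeasure ?P (cyl \<omega> k V) = ennreal ((\<Prod>i<k. f i (\<omega> i)) * sum (f k) V)"
      by (simp add: mult.commute)
  qed
  have small: "\<exists>S\<in>sets ?P. {\<omega> \<in> Pi UNIV A. \<pi> \<omega> \<in> U} \<subseteq> S \<and> emeasure ?P S \<le> ennreal (C * diameter U powr s + e)"
    if U: "bounded U" and e: "0 < e" for U e
  proof -
    let ?O = "{\<omega> \<in> Pi UNIV A. \<pi> \<omega> \<in> U}"
    consider "?O = {}" | \<omega> where "?O = {\<omega>}" | \<omega> \<eta> where "\<omega> \<in> ?O" "\<eta> \<in> ?O" "\<omega> \<noteq> \<eta>" by blast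
    then show ?thesis
    proof cases
      case 1 show ?thesis by (rule bexI[of _ "{}"]) (use 1 in auto)
    next
      case (2 \<omega>)
      then have \<omega>: "\<omega> \<in> Pi UNIV A" by auto
      from null[OF this e] obtain k where k: "(\<Prod>i<k. f i (\<omega> i)) < e" by blast
      have "?O \<subseteq> cyl \<omega> k (A k)" unfolding 2 using \<omega> by (auto simp: cyl_def spP)
      moreover have "emeasure ?P (cyl \<omega> k (A k)) \<le> ennreal (C * diameter U powr s + e)"
        unfolding cyl_em[OF \<omega> subset_refl] using k C f1 by (intro ennreal_leI) (simp add: add_increasing)
      ultimately show ?thesis using cyl_sets[OF \<omega> subset_refl] by blast
    next
      case (3 \<omega>0 \<eta>0)
      \<comment> \<open>the first index at which two points of the set differ\<close>
      define Q where "Q k \<longleftrightarrow> (\<exists>\<omega>\<in>?O. \<exists>\<eta>\<in>?O. \<omega> k \<noteq> \<eta> k)" for k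
      have "\<exists>k. Q k" using 3 unfolding Q_def by blast
      define k where "k = (LEAST k. Q k)"
      have Qk: "Q k" unfolding k_def using \<open>\<exists>k. Q k\<close> by (rule LeastI_ex)
      have least: "\<not> Q i" if "i < k" for i using that unfolding k_def by (rule not_less_Least)
      obtain \<omega> \<eta> where \<omega>: "\<omega> \<in> ?O" and \<eta>: "\<eta> \<in> ?O" and ne: "\<omega> k \<noteq> \<eta> k" using Qk unfolding Q_def by blast
      define V where "V = (\<lambda>\<xi>. \<xi> k) ` ?O"
      have \<omega>A: "\<omega> \<in> Pi UNIV A" using \<omega> by simp
      have VA: "V \<subseteq> A k" by (auto simp: V_def)
      have pre: "\<xi> i = \<omega> i" if "\<xi> \<in> ?O" "i < k" for \<xi> i
        using least[OF that(2)] that(1) \<omega> unfolding Q_def by blast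
      have "(\<Prod>i<k. f i (\<omega> i)) * sum (f k) V \<le> C * diameter U powr s"
      proof (rule est[OF \<omega>A VA])
        show "\<omega> k \<in> V" "\<eta> k \<in> V" using \<omega> \<eta> by (auto simp: V_def)
        show "\<omega> k \<noteq> \<eta> k" by (rule ne)
        fix v v' assume "v \<in> V" "v' \<in> V"
        then obtain \<xi> \<xi>' where x: "\<xi> \<in> ?O" "\<xi>' \<in> ?O" "v = \<xi> k" "v' = \<xi>' k" by (auto simp: V_def)
        then have "dist (\<pi> \<xi>) (\<pi> \<xi>') \<le> diameter U" using U by (intro diameter_bounded_bound) auto
        with x pre show "\<exists>\<eta>\<in>Pi UNIV A. \<exists>\<eta>'\<in>Pi UNIV A. (\<forall>i<k. \<eta> i = \<omega> i) \<and> (\<forall>i<k. \<eta>' i = \<omega> i) \<and>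
           \<eta> k = v \<and> \<eta>' k = v' \<and> dist (\<pi> \<eta>) (\<pi> \<eta>') \<le> diameter U" by blast
      qed
      then have "emeasure ?P (cyl \<omega> k V) \<le> ennreal (C * diameter U powr s + e)"
        unfolding cyl_em[OF \<omega>A VA] using e by (intro ennreal_leI) simp
      moreover have "?O \<subseteq> cyl \<omega> k V"
      proof
        fix \<xi> assume x: "\<xi> \<in> ?O"
        then show "\<xi> \<in> cyl \<omega> k V" using pre[OF x] by (auto simp: cyl_def spP V_def)
      qed
      ultimately show ?thesis using cyl_sets[OF \<omega>A VA] by blast
    qed
  qed
  have "s \<le> t" if t: "0 \<le> t" "hausdorff_measure t ?E = 0" for t
  proof (rule ccontr)
    assume "\<not> s \<le> t"
    have "hausdorff_premeasure t 1 ?E \<le> hausdorff_measure t ?E"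
      unfolding hausdorff_measure_def by (rule SUP_upper) simp
    then have "hausdorff_premeasure t 1 ?E < ennreal (1 / (2 * C))" using t C by simp
    then obtain U where U: "?E \<subseteq> (\<Union>i. U i)" "\<And>i. bounded (U i)" "\<And>i. diameter (U i) \<le> 1"
      and sm: "(\<Sum>i. diam_weight t (U i)) < ennreal (1 / (2 * C))"
      unfolding hausdorff_premeasure_def Inf_less_iff by blast
    have w: "ennreal (diameter (U i) powr s) \<le> diam_weight t (U i)" for i :: nat
    proof (cases "U i = {}")
      case False
      have d: "0 \<le> diameter (U i)" by (rule diameter_ge_0[OF U(2)])
      have "diameter (U i) powr s \<le> diameter (U i) powr t"
        using \<open>\<not> s \<le> t\<close> d U(3)[of i] by (intro powr_mono') auto
      moreover have "diameter (U i) powr s \<le> 1" using d U(3)[of i] s by (intro powr_le1) auto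
      ultimately show ?thesis using False by (auto simp: diam_weight_def intro!: ennreal_leI)
    qed (simp add: diam_weight_def)
    \<comment> \<open>the slack for the one-point sets has the sum 1/2\<close>
    have "\<forall>i. \<exists>S. S \<in> sets ?P \<and> {\<omega> \<in> Pi UNIV A. \<pi> \<omega> \<in> U i} \<subseteq> S \<and>
        emeasure ?P S \<le> ennreal (C * diameter (U i) powr s + (1/4) * (1/2) ^ i)"
    proof
      fix i show "\<exists>S. S \<in> sets ?P \<and> {\<omega> \<in> Pi UNIV A. \<pi> \<omega> \<in> U i} \<subseteq> S \<and>
        emeasure ?P S \<le> ennreal (C * diameter (U i) powr s + (1/4) * (1/2) ^ i)"
        using small[OF U(2), of "(1/4) * (1/2) ^ i" i] by auto
    qed
    from choice[OF this] obtain S where "\<forall>i. S i \<in> sets ?P \<and> {\<omega> \<in> Pi UNIV A. \<pi> \<omega> \<in> U i} \<subseteq> S i \<and>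
        emeasure ?P (S i) \<le> ennreal (C * diameter (U i) powr s + (1/4) * (1/2) ^ i)" ..
    then have S: "\<And>i. S i \<in> sets ?P" "\<And>i. {\<omega> \<in> Pi UNIV A. \<pi> \<omega> \<in> U i} \<subseteq> S i"
      "\<And>i. emeasure ?P (S i) \<le> ennreal (C * diameter (U i) powr s + (1/4) * (1/2) ^ i)" by blast+
    have "space ?P \<subseteq> (\<Union>i. S i)" unfolding spP using U(1) S(2) by blast
    then have "1 \<le> emeasure ?P (\<Union>i. S i)"
      using P.P.emeasure_space_1 emeasure_mono[of "space ?P" "\<Union>i. S i" ?P] S(1) by auto
    also have "\<dots> \<le> (\<Sum>i. emeasure ?P (S i))"
      by (rule emeasure_subadditive_countably) (use S(1) in auto)
    also have "\<dots> \<le> (\<Sum>i. ennreal C * ennreal (diameter (U i) powr s) + ennreal ((1/4) * (1/2) ^ i))"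
      using order_trans[OF S(3)] C by (intro suminf_le) (auto simp: ennreal_mult)
    also have "\<dots> = (\<Sum>i. ennreal C * ennreal (diameter (U i) powr s)) + (\<Sum>i. ennreal ((1/4) * (1/2) ^ i))"
      by (rule suminf_add[symmetric]) auto
    also have "(\<Sum>i. ennreal ((1/4) * (1/2) ^ i)) = ennreal (1/2)"
    proof -
      have "(\<lambda>i. (1/4) * (1/2) ^ i :: real) sums ((1/4) * (1 / (1 - 1/2)))"
        by (intro sums_mult geometric_sums) auto
      then have "(\<lambda>i. (1/4) * (1/2) ^ i :: real) sums (1/2)" by simp
      then have "summable (\<lambda>i. (1/4) * (1/2) ^ i :: real)" "(\<Sum>i. (1/4) * (1/2) ^ i :: real) = 1/2"
        by (simp_all only: sums_iff)
      moreover from this(1) have "(\<Sum>i. ennreal ((1/4) * (1/2) ^ i)) = ennreal (\<Sum>i. (1/4) * (1/2) ^ i)"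
        by (intro suminf_ennreal2) auto
      ultimately show ?thesis by (simp only:)
    qed
    also have "(\<Sum>i. ennreal C * ennreal (diameter (U i) powr s)) = ennreal C * (\<Sum>i. ennreal (diameter (U i) powr s))"
      by (rule ennreal_suminf_cmult)
    finally have 1: "1 \<le> ennreal C * (\<Sum>i. ennreal (diameter (U i) powr s)) + ennreal (1/2)" .
    define X where "X = (\<Sum>i. ennreal (diameter (U i) powr s))"
    have "(\<Sum>i. ennreal (diameter (U i) powr s)) \<le> (\<Sum>i. diam_weight t (U i))"
      by (intro suminf_le w) auto
    with sm have "(\<Sum>i. ennreal (diameter (U i) powr s)) < ennreal (1 / (2 * C))" by simp
    then have lt: "X < ennreal (1 / (2 * C))" by (simp only: X_def)
    define r where "r = enn2real X"
    have r1: "X = ennreal r" unfolding r_def using lt by (metis ennreal_enn2real less_trans ennreal_less_top)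
    have r2: "0 \<le> r" by (simp add: r_def)
    have r3: "r < 1 / (2 * C)" using lt r2 unfolding r1 by (simp add: ennreal_less_iff)
    from 1 have "1 \<le> ennreal C * ennreal r + ennreal (1/2)" unfolding r1[symmetric] X_def .
    also have "\<dots> = ennreal (C * r + 1/2)" using C r2 by (simp add: ennreal_mult)
    finally have "1 \<le> C * r + 1/2" by simp
    moreover have "C * r < 1/2" using r3 C by (simp add: field_simps)
    ultimately show False by simp
  qed
  then show ?thesis unfolding hausdorff_dim_def by (intro Inf_greatest) (auto intro!: ennreal_leI)
qed


section \<open>Denominators of convergents and cylinders\<close>

text \<open>
If \<open>p\<^sub>n / q\<^sub>n\<close> are the convergents of \<open>as = [a\<^sub>1, \<dots>, a\<^sub>n]\<close>, then \<open>cf_den as x = q\<^sub>n + x q\<^sub>n\<^sub>-\<^sub>1\<close>; at \<open>x = 0\<close> this is the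
continuant. The product form is chosen because it is the reciprocal of \<open>\<Prod>T\<^sup>k(y)\<close> over \<open>k < n\<close> for the point \<open>y = [a\<^sub>1, \<dots>, a\<^sub>n + x]\<close>,
which is what both the derivative of \<open>T\<^sup>n\<close> and the length of a cylinder depend on.
\<close>
fun cf_den :: "nat list \<Rightarrow> real \<Rightarrow> real" where
  "cf_den [] x = 1"
| "cf_den (a # as) x = (real a + cf_append as x) * cf_den as x"

lemma cf_append_append: "cf_append (as @ bs) x = cf_append as (cf_append bs x)"
  by (induction as) auto

lemma cf_den_append: "cf_den (as @ bs) x = cf_den as (cf_append bs x) * cf_den bs x"
  by (induction as) (auto simp: cf_append_append)

lemma cf_append_nonneg: "0 \<le> x \<Longrightarrow> 0 \<le> cf_append as x"
  by (induction as) auto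

lemma cf_append_le_1: "set as \<subseteq> {1..} \<Longrightarrow> 0 \<le> x \<Longrightarrow> x \<le> 1 \<Longrightarrow> cf_append as x \<le> 1"
proof (cases as)
  case (Cons a bs)
  assume "set as \<subseteq> {1..}" "0 \<le> x"
  then have "1 \<le> real a" "0 \<le> cf_append bs x" using Cons cf_append_nonneg by auto
  then show ?thesis using Cons by simp
qed simp

lemma cf_append_pos: "set as \<subseteq> {1..} \<Longrightarrow> 0 < x \<Longrightarrow> 0 < cf_append as x"
  by (induction as) (auto simp: add_pos_pos)

lemma cf_append_pos': "set as \<subseteq> {1..} \<Longrightarrow> as \<noteq> [] \<Longrightarrow> 0 \<le> x \<Longrightarrow> 0 < cf_append as x"
  by (cases as) (auto simp: add_pos_nonneg cf_append_nonneg)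

lemma cf_append_less_1: "set as \<subseteq> {1..} \<Longrightarrow> 0 < x \<Longrightarrow> x < 1 \<Longrightarrow> cf_append as x < 1"
proof (cases as)
  case (Cons a bs)
  assume "set as \<subseteq> {1..}" "0 < x"
  then have "1 \<le> real a" "0 < cf_append bs x" using Cons cf_append_pos by auto
  then show ?thesis using Cons by simp
qed simp

lemma cf_den_ge_1: "set as \<subseteq> {1..} \<Longrightarrow> 0 \<le> x \<Longrightarrow> 1 \<le> cf_den as x"
proof (induction as)
  case (Cons a as)
  then have "1 \<le> real a + cf_append as x" "1 \<le> cf_den as x"
    using cf_append_nonneg[of x as] by auto
  then show ?case using mult_mono[of 1 "real a + cf_append as x" 1 "cf_den as x"] by simp
qed simp

lemma cf_den_pos: "set as \<subseteq> {1..} \<Longrightarrow> 0 \<le> x \<Longrightarrow> 0 < cf_den as x"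
  using cf_den_ge_1 by (meson less_le_trans zero_less_one)

text \<open>
The exact distortion of an inverse branch of \<open>T\<^sup>n\<close>, with no error term: each step
\<open>x \<mapsto> 1 / (a + x)\<close> is a Moebius map of determinant \<open>-1\<close>.
\<close>
lemma cf_append_diff:
  assumes "set as \<subseteq> {1..}" "0 \<le> x" "0 \<le> y"
  shows "\<bar>cf_append as x - cf_append as y\<bar> = \<bar>x - y\<bar> / (cf_den as x * cf_den as y)"
  using assms(1)
proof (induction as)
  case (Cons a as)
  define X Y where "X = cf_append as x" and "Y = cf_append as y"
  have XY: "0 \<le> X" "0 \<le> Y" "1 \<le> real a" using assms Cons.prems by (auto simp: X_def Y_def cf_append_nonneg)
  then have "0 < real a + X" "0 < real a + Y" by auto
  then have "1 / (real a + X) - 1 / (real a + Y) = - (X - Y) / ((real a + X) * (real a + Y))"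
    by (simp add: field_simps)
  then have "\<bar>1 / (real a + X) - 1 / (real a + Y)\<bar> = \<bar>X - Y\<bar> / ((real a + X) * (real a + Y))"
    using \<open>0 < real a + X\<close> \<open>0 < real a + Y\<close> by (simp add: abs_mult abs_divide abs_minus_commute)
  also have "\<bar>X - Y\<bar> = \<bar>x - y\<bar> / (cf_den as x * cf_den as y)"
    using Cons by (simp add: X_def Y_def)
  finally show ?case by (simp add: X_def[symmetric] Y_def[symmetric] mult_ac)
qed simp

text \<open>
The recurrence of the continuants, read from the left end of the word.
\<close>
lemma cf_den_Cons_Cons:
  assumes "set (b # as) \<subseteq> {1..}" "0 \<le> x"
  shows "cf_den (a # b # as) x = real a * cf_den (b # as) x + cf_den as x"
proof -
  have "0 < real b + cf_append as x" using assms cf_append_nonneg[of x as] by (auto simp: add_pos_nonneg)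
  then show ?thesis by (simp add: field_simps)
qed

lemma cf_den_ge_at_0:
  assumes "set as \<subseteq> {1..}" "0 \<le> x"
  shows "cf_den as 0 \<le> cf_den as x"
  using assms(1)
proof (induction as rule: induct_list012)
  case (2 a) then show ?case using assms(2) by simp
next
  case (3 a b as)
  have e: "cf_den (a # b # as) y = real a * cf_den (b # as) y + cf_den as y" if "0 \<le> y" for y
    using 3(3) that by (intro cf_den_Cons_Cons) auto
  have "real a * cf_den (b # as) 0 \<le> real a * cf_den (b # as) x"
    using 3 by (intro mult_left_mono) auto
  moreover have "cf_den as 0 \<le> cf_den as x" using 3 by simp
  ultimately show ?case unfolding e[OF order_refl] e[OF assms(2)] by linarith
qed simp

text \<open>
Bounded distortion: replacing the tail \<open>x\<close> by 0 changes \<open>cf_den\<close> by at most the factor 2. This makes \<open>cf_den\<close>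
multiplicative up to a constant under concatenation.
\<close>
lemma cf_den_le_twice:
  assumes "set as \<subseteq> {1..}" "0 \<le> x" "x \<le> 1"
  shows "cf_den as x \<le> 2 * cf_den as 0"
  using assms(1)
proof (induction as rule: induct_list012)
  case (2 a) then show ?case using assms by auto
next
  case (3 a b as)
  have e: "cf_den (a # b # as) y = real a * cf_den (b # as) y + cf_den as y" if "0 \<le> y" for y
    using 3(3) that by (intro cf_den_Cons_Cons) auto
  have "real a * cf_den (b # as) x \<le> real a * (2 * cf_den (b # as) 0)"
    using 3 by (intro mult_left_mono) auto
  moreover have "cf_den as x \<le> 2 * cf_den as 0" using 3 by simp
  ultimately show ?case unfolding e[OF order_refl] e[OF assms(2)] by (simp add: distrib_left mult.left_commute del: cf_den.simps)
qed simp

lemmas cf_den_bounds = cf_den_ge_at_0 cf_den_le_twice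

lemma cf_den_append_le:
  assumes "set as \<subseteq> {1..}" "set bs \<subseteq> {1..}"
  shows "cf_den (as @ bs) 0 \<le> 2 * cf_den as 0 * cf_den bs 0"
proof -
  have "cf_den as (cf_append bs 0) \<le> 2 * cf_den as 0"
    using cf_den_bounds[OF assms(1)] cf_append_nonneg[of 0 bs] cf_append_le_1[OF assms(2)] by auto
  then show ?thesis unfolding cf_den_append
    using cf_den_pos[OF assms(2), of 0] by (intro mult_right_mono) auto
qed

lemma cf_den_append_ge:
  assumes "set as \<subseteq> {1..}" "set bs \<subseteq> {1..}"
  shows "cf_den as 0 * cf_den bs 0 \<le> cf_den (as @ bs) 0"
proof -
  have "cf_den as 0 \<le> cf_den as (cf_append bs 0)"
    using cf_den_bounds[OF assms(1)] cf_append_nonneg[of 0 bs] cf_append_le_1[OF assms(2)] by auto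
  then show ?thesis unfolding cf_den_append
    using cf_den_pos[OF assms(2), of 0] by (intro mult_right_mono) auto
qed

text \<open>
By the recurrence, two further digits at least double the continuant.
\<close>
lemma cf_den_ge_power:
  assumes "set as \<subseteq> {1..}"
  shows "2 ^ (length as div 2) \<le> cf_den as 0"
  using assms
proof (induction as rule: induct_list012)
  case (3 a b as)
  have ab: "1 \<le> real a" "1 \<le> real b" using 3(3) by auto
  have c: "0 \<le> cf_append as 0" "1 \<le> cf_den as 0" using 3(3) by (auto intro!: cf_append_nonneg cf_den_ge_1)
  have "cf_den as 0 \<le> cf_den (b # as) 0" using ab c by simp
  also have "\<dots> \<le> real a * cf_den (b # as) 0" using ab cf_den_pos[of "b # as" 0] 3(3) mult_right_mono[of 1 "real a" "cf_den (b # as) 0"]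
    by (simp del: cf_den.simps)
  finally have "2 * cf_den as 0 \<le> cf_den (a # b # as) 0" using cf_den_Cons_Cons[of b as 0 a] 3(3) by simp
  then show ?case using 3 by simp
qed auto

lemma cf_den_le_prod:
  assumes "set as \<subseteq> {1..}"
  shows "cf_den as 0 \<le> (\<Prod>a\<leftarrow>as. real a + 1)"
  using assms
proof (induction as)
  case (Cons a as)
  have "(real a + cf_append as 0) * cf_den as 0 \<le> (real a + 1) * (\<Prod>a\<leftarrow>as. real a + 1)"
    using Cons cf_append_le_1[of as 0] cf_append_nonneg[of 0 as] cf_den_pos[of as 0]
    by (intro mult_mono) auto
  then show ?case by simp
qed simp

lemma cf_den_ge_prod:
  assumes "set as \<subseteq> {1..}"
  shows "(\<Prod>a\<leftarrow>as. real a) \<le> cf_den as 0"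
  using assms
proof (induction as)
  case (Cons a as)
  have "real a * (\<Prod>a\<leftarrow>as. real a) \<le> (real a + cf_append as 0) * cf_den as 0"
    using Cons cf_append_nonneg[of 0 as] cf_den_pos[of as 0]
    by (intro mult_mono) (auto intro!: prod_list_nonneg)
  then show ?case by simp
qed simp

text \<open>
Points that agree on \<open>c\<close> and continue with different digits \<open>a\<close>, \<open>a'\<close> are as far apart as their
cylinders, provided that the tails stay away from 1. Then \<open>a + u\<close> and \<open>a' + u'\<close> differ by at least the
fraction \<open>\<kappa>\<close> of \<open>a - a'\<close>, even for adjacent digits, so neighbouring cylinders are separated by a gap.
\<close>
lemma cf_append_separation:
  assumes c: "set c \<subseteq> {1..}" and a: "1 \<le> a" "1 \<le> a'" and ne: "a \<noteq> a'"
    and u: "0 \<le> u" "u \<le> 1 - \<kappa>" and u': "0 \<le> u'" "u' \<le> 1 - \<kappa>" and \<kappa>: "0 \<le> \<kappa>" "\<kappa> \<le> 1"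
  shows "\<kappa> * \<bar>real a - real a'\<bar> / ((real a + 1) * (real a' + 1)) / (4 * (cf_den c 0)\<^sup>2)
     \<le> \<bar>cf_append (c @ [a]) u - cf_append (c @ [a']) u'\<bar>"
proof -
  define X Y where "X = 1 / (real a + u)" and "Y = 1 / (real a' + u')"
  have ra: "1 \<le> real a" "1 \<le> real a'" using a by auto
  have pos: "0 < real a + u" "0 < real a' + u'" using ra u u' by auto
  have XY: "0 \<le> X" "X \<le> 1" "0 \<le> Y" "Y \<le> 1" using ra u u' by (auto simp: X_def Y_def)
  define q where "q = cf_den c 0"
  have q: "1 \<le> q" unfolding q_def using c by (intro cf_den_ge_1) auto
  have d: "cf_den c X \<le> 2 * q" "cf_den c Y \<le> 2 * q" "0 < cf_den c X" "0 < cf_den c Y"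
    using cf_den_bounds[OF c] XY cf_den_pos[OF c] by (auto simp: q_def)
  have dq: "cf_den c X * cf_den c Y \<le> 4 * q\<^sup>2"
    using mult_mono[OF d(1,2)] d q by (simp add: power2_eq_square)
  have "1 \<le> \<bar>real a - real a'\<bar>"
  proof -
    have "1 \<le> \<bar>int a - int a'\<bar>" using ne by auto
    then have "1 \<le> real_of_int \<bar>int a - int a'\<bar>" by linarith
    then show ?thesis by simp
  qed
  moreover have "\<bar>u - u'\<bar> \<le> 1 - \<kappa>" using u u' by auto
  moreover have "\<bar>(real a' + u') - (real a + u)\<bar> \<ge> \<bar>real a - real a'\<bar> - \<bar>u - u'\<bar>" by linarith
  moreover have "(1 - \<kappa>) * 1 \<le> (1 - \<kappa>) * \<bar>real a - real a'\<bar>"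
    using calculation(1) \<kappa> by (intro mult_left_mono) auto
  ultimately have num: "\<kappa> * \<bar>real a - real a'\<bar> \<le> \<bar>(real a' + u') - (real a + u)\<bar>"
    by (simp add: algebra_simps)
  have "X - Y = ((real a' + u') - (real a + u)) / ((real a + u) * (real a' + u'))"
    using pos unfolding X_def Y_def by (simp add: field_simps)
  then have "\<bar>X - Y\<bar> = \<bar>(real a' + u') - (real a + u)\<bar> / ((real a + u) * (real a' + u'))"
    using pos by (simp add: abs_mult)
  also have "\<dots> \<ge> \<kappa> * \<bar>real a - real a'\<bar> / ((real a + 1) * (real a' + 1))"
    using num pos u u' \<kappa> by (intro frac_le mult_mono) auto
  finally have XYd: "\<kappa> * \<bar>real a - real a'\<bar> / ((real a + 1) * (real a' + 1)) \<le> \<bar>X - Y\<bar>" .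
  have "\<bar>cf_append (c @ [a]) u - cf_append (c @ [a']) u'\<bar> = \<bar>cf_append c X - cf_append c Y\<bar>"
    by (simp add: cf_append_append X_def Y_def)
  also have "\<dots> = \<bar>X - Y\<bar> / (cf_den c X * cf_den c Y)" using c XY by (intro cf_append_diff) auto
  also have "\<dots> \<ge> (\<kappa> * \<bar>real a - real a'\<bar> / ((real a + 1) * (real a' + 1))) / (4 * q\<^sup>2)"
    using XYd dq d \<kappa> by (intro frac_le) auto
  finally show ?thesis by (simp only: q_def)
qed

lemma gauss_map_cf_append:
  assumes "set (a # as) \<subseteq> {1..}" "0 < x" "x < 1"
  shows "gauss_map (cf_append (a # as) x) = cf_append as x"
    and "\<lfloor>1 / cf_append (a # as) x\<rfloor> = int a"
proof -
  have u: "0 < cf_append as x" "cf_append as x < 1"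
    using assms by (auto intro!: cf_append_pos cf_append_less_1)
  have e: "1 / cf_append (a # as) x = real a + cf_append as x" by simp
  have "cf_append (a # as) x \<noteq> 0" using cf_append_pos[OF assms(1,2)] by simp
  then show "gauss_map (cf_append (a # as) x) = cf_append as x"
    unfolding gauss_map_def e using u by (simp add: frac_unique_iff)
  show "\<lfloor>1 / cf_append (a # as) x\<rfloor> = int a" unfolding e using u by (simp add: floor_eq_iff)
qed

lemma gauss_map_funpow_cf_append:
  assumes "set as \<subseteq> {1..}" "0 < x" "x < 1" "n \<le> length as"
  shows "(gauss_map ^^ n) (cf_append as x) = cf_append (drop n as) x"
  using assms
proof (induction n arbitrary: as)
  case (Suc n)
  then obtain a bs where as: "as = a # bs" by (cases as) auto
  have "(gauss_map ^^ Suc n) (cf_append as x) = (gauss_map ^^ n) (gauss_map (cf_append as x))"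
    by (simp only: funpow_Suc_right o_apply)
  also have "gauss_map (cf_append as x) = cf_append bs x"
    unfolding as using Suc.prems as by (intro gauss_map_cf_append) auto
  also have "(gauss_map ^^ n) (cf_append bs x) = cf_append (drop n bs) x"
    using Suc as by (intro Suc.IH) auto
  finally show ?case by (simp add: as)
qed simp

lemma partial_quotient_cf_append:
  assumes "set as \<subseteq> {1..}" "0 < x" "x < 1" "n < length as"
  shows "partial_quotient (Suc n) (cf_append as x) = as ! n"
proof -
  have d: "drop n as = as ! n # drop (Suc n) as" using assms(4) by (simp add: Cons_nth_drop_Suc)
  have "set (drop n as) \<subseteq> {1..}" using assms(1) set_drop_subset by fast
  then show ?thesis unfolding partial_quotient_def
    using gauss_map_cf_append(2)[of "as ! n" "drop (Suc n) as" x] gauss_map_funpow_cf_append[of as x n] assms d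
    by (simp del: cf_append.simps)
qed

lemma gauss_map_range: "0 \<le> gauss_map x" "gauss_map x < 1"
  by (auto simp: gauss_map_def frac_lt_1)

lemma gauss_map_inverse:
  assumes "0 < y" "y < 1"
  shows "y = 1 / (real (nat \<lfloor>1 / y\<rfloor>) + gauss_map y)" "1 \<le> nat \<lfloor>1 / y\<rfloor>"
proof -
  have "1 < 1 / y" using assms by simp
  then have f: "1 \<le> \<lfloor>1 / y\<rfloor>" by linarith
  then have "real (nat \<lfloor>1 / y\<rfloor>) + gauss_map y = 1 / y" using assms by (simp add: gauss_map_def frac_def)
  then show "y = 1 / (real (nat \<lfloor>1 / y\<rfloor>) + gauss_map y)" by simp
  show "1 \<le> nat \<lfloor>1 / y\<rfloor>" using f by linarith
qed

definition digits :: "nat \<Rightarrow> real \<Rightarrow> nat list" where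
  "digits n x = map (\<lambda>i. partial_quotient (Suc i) x) [0..<n]"

lemma length_digits [simp]: "length (digits n x) = n" by (simp add: digits_def)

lemma digits_Suc: "digits (Suc n) x = digits n x @ [partial_quotient (Suc n) x]"
  by (simp add: digits_def)

lemma cf_expansion:
  assumes "\<And>k. 0 < (gauss_map ^^ k) x" "x < 1"
  shows "set (digits n x) \<subseteq> {1..}" "cf_append (digits n x) ((gauss_map ^^ n) x) = x"
    "(gauss_map ^^ n) x < 1"
proof -
  have lt: "(gauss_map ^^ k) x < 1" for k
    using assms(2) gauss_map_range(2) by (cases k) auto
  show "(gauss_map ^^ n) x < 1" by (rule lt)
  show "set (digits n x) \<subseteq> {1..}"
    using gauss_map_inverse(2)[OF assms(1) lt] by (auto simp: digits_def partial_quotient_def)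
  show "cf_append (digits n x) ((gauss_map ^^ n) x) = x"
  proof (induction n)
    case 0 then show ?case by (simp add: digits_def)
  next
    case (Suc n)
    have "cf_append [partial_quotient (Suc n) x] ((gauss_map ^^ Suc n) x) = (gauss_map ^^ n) x"
      using gauss_map_inverse(1)[OF assms(1) lt, of n] by (simp add: partial_quotient_def)
    then show ?case using Suc by (simp only: digits_Suc cf_append_append)
  qed
qed

lemma gauss_map_funpow_0: "(gauss_map ^^ k) 0 = 0"
  by (induction k) (auto simp: gauss_map_def)

text \<open>
Once the orbit has reached 0, all later digits are 0.
\<close>
lemma gauss_orbit_pos:
  assumes "0 \<le> x" "\<exists>\<^sub>\<infinity>n. 0 < partial_quotient n x"
  shows "0 < (gauss_map ^^ k) x"
proof (rule ccontr)
  assume "\<not> 0 < (gauss_map ^^ k) x"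
  moreover have "0 \<le> (gauss_map ^^ k) x" using assms(1) gauss_map_range(1) by (cases k) auto
  ultimately have z: "(gauss_map ^^ k) x = 0" by simp
  obtain n where n: "n \<ge> Suc k" "0 < partial_quotient n x" using assms(2) unfolding INFM_nat_le by blast
  have "n - 1 = (n - 1 - k) + k" using n by simp
  then have "(gauss_map ^^ (n - 1)) x = (gauss_map ^^ (n - 1 - k)) ((gauss_map ^^ k) x)"
    by (metis funpow_add o_apply)
  then show False using n z by (simp add: partial_quotient_def gauss_map_funpow_0)
qed


section \<open>Sums over words and the Gauss density\<close>

definition words :: "nat \<Rightarrow> nat list set" where
  "words n = {as. length as = n \<and> set as \<subseteq> {1..}}"

definition cf_zeta :: "real \<Rightarrow> nat \<Rightarrow> ennreal" where
  "cf_zeta s n = (\<integral>\<^sup>+ as. ennreal (cf_den as 0 powr (- 2 * s)) \<partial>count_space (words n))"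

lemma countable_words [simp]: "countable (words n)" by simp

lemma words_0 [simp]: "words 0 = {[]}" by (auto simp: words_def)

lemma words_mem: "as \<in> words n \<Longrightarrow> set as \<subseteq> {1..}" "as \<in> words n \<Longrightarrow> length as = n"
  by (auto simp: words_def)

text \<open>
Sums over words are written as integrals for counting measure, so that Fubini and monotone convergence are
available with values in \<open>[0, \<infinity>]\<close>.
\<close>
lemma nn_integral_words_add:
  fixes F :: "nat list \<Rightarrow> ennreal"
  shows "(\<integral>\<^sup>+ w. F w \<partial>count_space (words (m + n)))
       = (\<integral>\<^sup>+ u. \<integral>\<^sup>+ v. F (u @ v) \<partial>count_space (words n) \<partial>count_space (words m))"
proof -
  have "bij_betw (\<lambda>p. fst p @ snd p) (words m \<times> words n) (words (m + n))"
    unfolding bij_betw_def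
  proof
    show "inj_on (\<lambda>p. fst p @ snd p) (words m \<times> words n)"
      by (auto simp: inj_on_def words_def)
    have "w \<in> (\<lambda>p. fst p @ snd p) ` (words m \<times> words n)" if "w \<in> words (m + n)" for w
    proof (rule image_eqI)
      show "w = fst (take m w, drop m w) @ snd (take m w, drop m w)" by simp
      show "(take m w, drop m w) \<in> words m \<times> words n"
        using that by (auto simp: words_def dest: in_set_takeD in_set_dropD)
    qed
    then show "(\<lambda>p. fst p @ snd p) ` (words m \<times> words n) = words (m + n)"
      by (auto simp: words_def)
  qed
  from nn_integral_bij_count_space[OF this, of F]
  have "(\<integral>\<^sup>+ w. F w \<partial>count_space (words (m + n)))
      = (\<integral>\<^sup>+ p. F (fst p @ snd p) \<partial>count_space (words m \<times> words n))" by simp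
  then show ?thesis by (simp add: nn_integral_count_space_Sigma[where f = "\<lambda>u v. F (u @ v)"])
qed

lemma nn_integral_words_1:
  fixes F :: "nat list \<Rightarrow> ennreal"
  shows "(\<integral>\<^sup>+ w. F w \<partial>count_space (words (Suc 0))) = (\<integral>\<^sup>+ a. F [a] \<partial>count_space {1..})"
proof -
  have "bij_betw (\<lambda>a. [a]) {1..} (words (Suc 0))"
    by (auto simp: bij_betw_def inj_on_def words_def length_Suc_conv image_iff)
  from nn_integral_bij_count_space[OF this, of F] show ?thesis by simp
qed

lemma nn_integral_words_Suc:
  fixes F :: "nat list \<Rightarrow> ennreal"
  shows "(\<integral>\<^sup>+ w. F w \<partial>count_space (words (Suc n)))
       = (\<integral>\<^sup>+ u. \<integral>\<^sup>+ a. F (u @ [a]) \<partial>count_space {1..} \<partial>count_space (words n))"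
  using nn_integral_words_add[of n 1 F] by (simp add: nn_integral_words_1)

lemma cf_zeta_0 [simp]: "cf_zeta s 0 = 1"
  by (simp add: cf_zeta_def nn_integral_count_space_finite)

lemma cf_zeta_add_le:
  assumes "0 \<le> s"
  shows "cf_zeta s (m + n) \<le> cf_zeta s m * cf_zeta s n"
proof -
  have "cf_zeta s (m + n) \<le> (\<integral>\<^sup>+ u. \<integral>\<^sup>+ v. ennreal (cf_den u 0 powr (- 2 * s)) *
      ennreal (cf_den v 0 powr (- 2 * s)) \<partial>count_space (words n) \<partial>count_space (words m))"
    unfolding cf_zeta_def nn_integral_words_add
  proof (intro nn_integral_mono)
    fix u v assume "u \<in> space (count_space (words m))" "v \<in> space (count_space (words n))"
    then have uv: "set u \<subseteq> {1..}" "set v \<subseteq> {1..}" using words_mem by (simp_all add: space_count_space) 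
    have "0 < cf_den u 0 * cf_den v 0" using uv by (simp add: cf_den_pos)
    then have "cf_den (u @ v) 0 powr (- 2 * s) \<le> (cf_den u 0 * cf_den v 0) powr (- 2 * s)"
      using cf_den_append_ge[OF uv] assms by (intro powr_mono2') auto
    also have "\<dots> = cf_den u 0 powr (- 2 * s) * cf_den v 0 powr (- 2 * s)"
      by (rule powr_mult)
    finally show "ennreal (cf_den (u @ v) 0 powr (- 2 * s))
        \<le> ennreal (cf_den u 0 powr (- 2 * s)) * ennreal (cf_den v 0 powr (- 2 * s))"
      by (simp add: ennreal_mult[symmetric])
  qed
  also have "\<dots> = cf_zeta s m * cf_zeta s n"
    by (simp add: cf_zeta_def nn_integral_cmult nn_integral_multc)
  finally show ?thesis .
qed

lemma cf_zeta_add_ge: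
  assumes "0 \<le> s"
  shows "ennreal (2 powr (- 2 * s)) * (cf_zeta s m * cf_zeta s n) \<le> cf_zeta s (m + n)"
proof -
  have "ennreal (2 powr (- 2 * s)) * (cf_zeta s m * cf_zeta s n) =
     (\<integral>\<^sup>+ u. \<integral>\<^sup>+ v. ennreal (2 powr (- 2 * s)) * (ennreal (cf_den u 0 powr (- 2 * s)) *
      ennreal (cf_den v 0 powr (- 2 * s))) \<partial>count_space (words n) \<partial>count_space (words m))"
    by (simp add: cf_zeta_def nn_integral_cmult nn_integral_multc)
  also have "\<dots> \<le> cf_zeta s (m + n)"
    unfolding cf_zeta_def nn_integral_words_add
  proof (intro nn_integral_mono)
    fix u v assume "u \<in> space (count_space (words m))" "v \<in> space (count_space (words n))"
    then have uv: "set u \<subseteq> {1..}" "set v \<subseteq> {1..}" using words_mem by (simp_all add: space_count_space) 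
    then have p: "0 < cf_den u 0" "0 < cf_den v 0" by (auto intro!: cf_den_pos)
    have "2 powr (- 2 * s) * (cf_den u 0 powr (- 2 * s) * cf_den v 0 powr (- 2 * s))
       = (2 * cf_den u 0 * cf_den v 0) powr (- 2 * s)"
      using p by (simp add: powr_mult)
    also have "\<dots> \<le> cf_den (u @ v) 0 powr (- 2 * s)"
      using cf_den_append_le[OF uv] assms cf_den_pos[of "u @ v" 0] uv by (intro powr_mono2') auto
    finally show "ennreal (2 powr (- 2 * s)) * (ennreal (cf_den u 0 powr (- 2 * s)) *
        ennreal (cf_den v 0 powr (- 2 * s))) \<le> ennreal (cf_den (u @ v) 0 powr (- 2 * s))"
      by (simp add: ennreal_mult[symmetric] ennreal_leI)
  qed
  finally show ?thesis .
qed

lemma cf_zeta_antimono: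
  assumes "s \<le> t"
  shows "cf_zeta t n \<le> cf_zeta s n"
  unfolding cf_zeta_def
proof (intro nn_integral_mono ennreal_leI)
  fix w assume "w \<in> space (count_space (words n))"
  then have "1 \<le> cf_den w 0" by (intro cf_den_ge_1) (auto simp: words_def)
  then show "cf_den w 0 powr (- 2 * t) \<le> cf_den w 0 powr (- 2 * s)"
    using assms by (intro powr_mono) auto
qed

lemma cf_zeta_pos: "0 < cf_zeta s n"
proof -
  have w: "replicate n 1 \<in> words n" by (auto simp: words_def)
  have "0 < ennreal (cf_den (replicate n 1) 0 powr (- 2 * s))"
    using cf_den_pos[of "replicate n 1" 0] words_mem(1)[OF w] by simp
  also have "\<dots> = (\<integral>\<^sup>+ as. ennreal (cf_den as 0 powr (- 2 * s)) * indicator {replicate n 1} as \<partial>count_space (words n))"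
    using w by (subst nn_integral_indicator_finite) auto
  also have "\<dots> \<le> cf_zeta s n" unfolding cf_zeta_def
    by (intro nn_integral_mono) (auto split: split_indicator)
  finally show ?thesis .
qed

text \<open>
With \<open>h(x) = 1 / (1 + x)\<close> the terms are \<open>(a + x)\<^sup>-\<^sup>2 h(1 / (a + x))\<close>, and they telescope.
\<close>
lemma gauss_density_sum:
  assumes "0 \<le> x"
  shows "(\<integral>\<^sup>+ a. ennreal (1 / ((real a + x) * (real a + 1 + x))) \<partial>count_space {1..}) = ennreal (1 / (1 + x))"
proof -
  have bij: "bij_betw Suc UNIV {1..}" by (auto simp: bij_betw_def image_iff) (metis Suc_pred less_eq_Suc_le)
  have s: "(\<lambda>n. 1 / (real (Suc n) + x) - 1 / (real (Suc (Suc n)) + x)) sums (1 / (real (Suc 0) + x) - 0)"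
  proof (rule telescope_sums')
    show "(\<lambda>n. 1 / (real (Suc n) + x)) \<longlonglongrightarrow> 0" by real_asymp
  qed
  have e: "1 / (real (Suc n) + x) - 1 / (real (Suc (Suc n)) + x) = 1 / ((real (Suc n) + x) * (real (Suc n) + 1 + x))" for n
  proof -
    have "0 < real (Suc n) + x" "0 < real (Suc (Suc n)) + x" using assms by auto
    then show ?thesis by (simp add: field_simps)
  qed
  have "(\<integral>\<^sup>+ a. ennreal (1 / ((real a + x) * (real a + 1 + x))) \<partial>count_space {1..})
     = (\<integral>\<^sup>+ n. ennreal (1 / ((real (Suc n) + x) * (real (Suc n) + 1 + x))) \<partial>count_space UNIV)"
    by (rule nn_integral_bij_count_space[OF bij, symmetric])
  also have "\<dots> = (\<Sum>n. ennreal (1 / ((real (Suc n) + x) * (real (Suc n) + 1 + x))))"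
    by (rule nn_integral_count_space_nat)
  also have "\<dots> = ennreal (\<Sum>n. 1 / ((real (Suc n) + x) * (real (Suc n) + 1 + x)))"
    using s assms unfolding e by (intro suminf_ennreal2) (auto simp: sums_iff)
  also have "(\<Sum>n. 1 / ((real (Suc n) + x) * (real (Suc n) + 1 + x))) = 1 / (1 + x)"
    using s unfolding e by (simp add: sums_iff)
  finally show ?thesis .
qed

text \<open>
The density \<open>1 / (1 + x)\<close> is fixed by the transfer operator of the Gauss map, hence by its \<open>n\<close>-th iterate. The induction peels off
the last digit, because this turns the tail \<open>x\<close> into \<open>1 / (a + x)\<close> and leaves the word in front of it intact.
\<close>
lemma gauss_density_invariant:
  assumes "0 \<le> x"
  shows "(\<integral>\<^sup>+ w. ennreal (1 / ((cf_den w x)\<^sup>2 * (1 + cf_append w x))) \<partial>count_space (words n)) = ennreal (1 / (1 + x))"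
  using assms
proof (induction n arbitrary: x)
  case 0 then show ?case by (simp add: nn_integral_count_space_finite)
next
  case (Suc n)
  have inner: "1 / ((cf_den (u @ [a]) x)\<^sup>2 * (1 + cf_append (u @ [a]) x))
     = 1 / (real a + x)\<^sup>2 * (1 / ((cf_den u (1 / (real a + x)))\<^sup>2 * (1 + cf_append u (1 / (real a + x)))))"
    for u a by (simp add: cf_den_append cf_append_append power_mult_distrib mult_ac)
  have "(\<integral>\<^sup>+ w. ennreal (1 / ((cf_den w x)\<^sup>2 * (1 + cf_append w x))) \<partial>count_space (words (Suc n)))
    = (\<integral>\<^sup>+ u. \<integral>\<^sup>+ a. ennreal (1 / (real a + x)\<^sup>2) * ennreal (1 / ((cf_den u (1 / (real a + x)))\<^sup>2
        * (1 + cf_append u (1 / (real a + x))))) \<partial>count_space {1..} \<partial>count_space (words n))"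
    unfolding nn_integral_words_Suc inner by (simp only: ennreal_mult' zero_le_divide_1_iff zero_le_power2)
  also have "\<dots> = (\<integral>\<^sup>+ a. \<integral>\<^sup>+ u. ennreal (1 / (real a + x)\<^sup>2) * ennreal (1 / ((cf_den u (1 / (real a + x)))\<^sup>2
        * (1 + cf_append u (1 / (real a + x))))) \<partial>count_space (words n) \<partial>count_space {1..})"
    by (rule nn_integral_count_space_nn_integral) auto
  also have "\<dots> = (\<integral>\<^sup>+ a. ennreal (1 / (real a + x)\<^sup>2) * (\<integral>\<^sup>+ u. ennreal (1 / ((cf_den u (1 / (real a + x)))\<^sup>2
        * (1 + cf_append u (1 / (real a + x))))) \<partial>count_space (words n)) \<partial>count_space {1..})"
    by (simp add: nn_integral_cmult)
  also have "\<dots> = (\<integral>\<^sup>+ a. ennreal (1 / (real a + x)\<^sup>2) * ennreal (1 / (1 + 1 / (real a + x))) \<partial>count_space {1..})"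
    using Suc.prems by (intro nn_integral_cong) (simp add: Suc.IH)
  also have "\<dots> = (\<integral>\<^sup>+ a. ennreal (1 / ((real a + x) * (real a + 1 + x))) \<partial>count_space {1..})"
  proof (intro nn_integral_cong)
    fix a :: nat assume "a \<in> space (count_space {1..})"
    then have "0 < real a + x" "0 < real a + 1 + x" using Suc.prems by auto
    then have "1 / (real a + x)\<^sup>2 * (1 / (1 + 1 / (real a + x))) = 1 / ((real a + x) * (real a + 1 + x))"
      by (simp add: power2_eq_square divide_simps)
    then show "ennreal (1 / (real a + x)\<^sup>2) * ennreal (1 / (1 + 1 / (real a + x)))
       = ennreal (1 / ((real a + x) * (real a + 1 + x)))"
      using \<open>0 < real a + x\<close> by (simp add: ennreal_mult[symmetric])
  qed
  also have "\<dots> = ennreal (1 / (1 + x))" by (rule gauss_density_sum[OF Suc.prems])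
  finally show ?case .
qed

text \<open>
Evaluate the invariance of the Gauss density at \<open>x = 0\<close>; the density lies between 1/2 and 1. This bound expresses that the cylinders
of level \<open>n\<close> have total length 1.
\<close>
lemma cf_zeta_1_le: "cf_zeta 1 n \<le> 2"
proof -
  have "cf_zeta 1 n \<le> (\<integral>\<^sup>+ w. ennreal 2 * ennreal (1 / ((cf_den w 0)\<^sup>2 * (1 + cf_append w 0))) \<partial>count_space (words n))"
    unfolding cf_zeta_def
  proof (intro nn_integral_mono)
    fix w assume "w \<in> space (count_space (words n))"
    then have w: "set w \<subseteq> {1..}" using words_mem by (simp_all add: space_count_space) 
    have p: "0 < cf_den w 0" by (rule cf_den_pos[OF w]) simp
    have c: "0 \<le> cf_append w 0" "cf_append w 0 \<le> 1"
      using cf_append_le_1[OF w, of 0] by (auto intro: cf_append_nonneg)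
    have "cf_den w 0 powr (- 2 * 1) = 1 / (cf_den w 0)\<^sup>2"
      using p by (simp add: powr_minus_divide powr_numeral)
    also have "\<dots> \<le> 2 * (1 / ((cf_den w 0)\<^sup>2 * (1 + cf_append w 0)))"
    proof -
      have "(cf_den w 0)\<^sup>2 * (1 + cf_append w 0) \<le> (cf_den w 0)\<^sup>2 * 2"
        using c by (intro mult_left_mono) auto
      then show ?thesis using p c by (simp add: divide_simps add_pos_nonneg)
    qed
    finally show "ennreal (cf_den w 0 powr (- 2 * 1)) \<le> ennreal 2 * ennreal (1 / ((cf_den w 0)\<^sup>2 * (1 + cf_append w 0)))"
      using c by (subst ennreal_mult[symmetric]) (auto intro!: ennreal_leI)
  qed
  also have "\<dots> = 2 * ennreal (1 / (1 + 0))" by (subst nn_integral_cmult) (simp_all add: gauss_density_invariant)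
  finally show ?thesis by simp
qed


section \<open>The pressure as an exponential growth rate\<close>

text \<open>
A sequence that is additive up to a bounded error is linear up to the same error. Comparing \<open>a (m * n)\<close> with both
\<open>m * a n\<close> and \<open>n * a m\<close> shows that \<open>a n / n\<close> is a Cauchy sequence, with a rate that survives in the limit.
\<close>
lemma quasi_additive:
  fixes a :: "nat \<Rightarrow> real"
  assumes qa: "\<And>m n. \<bar>a (m + n) - a m - a n\<bar> \<le> K"
  obtains L where "\<And>n. \<bar>a n - real n * L\<bar> \<le> K" "(\<lambda>n. a n / real n) \<longlonglongrightarrow> L"
proof -
  have K: "0 \<le> K" using qa[of 0 0] by linarith
  have mult: "\<bar>a (m * n) - real m * a n\<bar> \<le> real (m + 1) * K" for m n
  proof (induction m)
    case 0 show ?case using qa[of 0 0] by simp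
  next
    case (Suc m)
    have "a (Suc m * n) = a (n + m * n)" by simp
    then show ?case using Suc qa[of n "m * n"] by (simp add: algebra_simps)
  qed
  have bnd: "\<bar>a n / real n - a m / real m\<bar> \<le> K / real n + K / real m + 2 * K / (real m * real n)"
    if "0 < m" "0 < n" for m n
  proof -
    have "\<bar>real m * a n - real n * a m\<bar> \<le> real (m + 1) * K + real (n + 1) * K"
      using mult[of m n] mult[of n m] by (simp add: mult.commute)
    moreover have "a n / real n - a m / real m = (real m * a n - real n * a m) / (real m * real n)"
      using that by (simp add: field_simps)
    ultimately have "\<bar>a n / real n - a m / real m\<bar> \<le> (real (m + 1) * K + real (n + 1) * K) / (real m * real n)"
      using that by (simp add: divide_right_mono)
    also have "\<dots> = K / real n + K / real m + 2 * K / (real m * real n)"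
      using that by (simp add: field_simps)
    finally show ?thesis .
  qed
  have "Cauchy (\<lambda>n. a n / real n)"
  proof (rule metric_CauchyI)
    fix e :: real assume e: "0 < e"
    obtain N where N: "real N > 4 * K / e" using reals_Archimedean2 by blast
    define M where "M = Suc N"
    have M: "4 * K / e < real M" "0 < M" "1 \<le> real M" using N by (auto simp: M_def)
    show "\<exists>M. \<forall>m\<ge>M. \<forall>n\<ge>M. dist (a m / real m) (a n / real n) < e"
    proof (intro exI[of _ M] allI impI)
      fix m n assume mn: "M \<le> m" "M \<le> n"
      have "K / real m \<le> K / real M" "K / real n \<le> K / real M"
        using mn M K by (auto intro!: divide_left_mono)
      moreover have "2 * K / (real n * real m) \<le> 2 * K / (real M * 1)"
        using mn M K by (intro divide_left_mono mult_mono) auto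
      moreover have "dist (a m / real m) (a n / real n) \<le> K / real m + K / real n + 2 * K / (real n * real m)"
        using bnd[of n m] mn M by (simp add: dist_real_def)
      ultimately have "dist (a m / real m) (a n / real n) \<le> K / real M + K / real M + 2 * K / (real M * 1)" by linarith
      also have "\<dots> = 4 * K / real M" by (simp add: field_simps)
      finally have "dist (a m / real m) (a n / real n) \<le> 4 * K / real M" .
      also have "\<dots> < e" using M e by (simp add: field_simps)
      finally show "dist (a m / real m) (a n / real n) < e" .
    qed
  qed
  then obtain L where L: "(\<lambda>n. a n / real n) \<longlonglongrightarrow> L" unfolding Cauchy_convergent_iff convergent_def by blast
  have "\<bar>a n - real n * L\<bar> \<le> K" for n
  proof (cases "n = 0")
    case True then show ?thesis using qa[of 0 0] by simp
  next
    case False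
    have "\<bar>a n / real n - L\<bar> \<le> K / real n + 0 + 0"
    proof (rule tendsto_le)
      show "(\<lambda>m. \<bar>a n / real n - a m / real m\<bar>) \<longlonglongrightarrow> \<bar>a n / real n - L\<bar>"
        by (intro tendsto_intros L)
      show "(\<lambda>m. K / real n + K / real m + 2 * K / (real m * real n)) \<longlonglongrightarrow> K / real n + 0 + 0"
      proof -
        have "(\<lambda>m. K / real m) \<longlonglongrightarrow> 0" by (rule lim_const_over_n)
        moreover have "(\<lambda>m. (2 * K / real n) / real m) \<longlonglongrightarrow> 0" by (rule lim_const_over_n)
        then have "(\<lambda>m. 2 * K / (real m * real n)) \<longlonglongrightarrow> 0" by (simp add: mult.commute)
        ultimately show ?thesis by (intro tendsto_add tendsto_const)
      qed
      show "\<forall>\<^sub>F m in sequentially. \<bar>a n / real n - a m / real m\<bar> \<le> K / real n + K / real m + 2 * K / (real m * real n)"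
        using eventually_gt_at_top[of 0] by eventually_elim (use bnd False in auto)
    qed simp
    then show ?thesis using False by (simp add: field_simps abs_le_iff)
  qed
  with L that show ?thesis by blast
qed

lemma infsum_eq_nn_integral_count_space:
  fixes f :: "'a \<Rightarrow> ennreal"
  assumes A: "countable A"
  shows "infsum f A = (\<integral>\<^sup>+ x. f x \<partial>count_space A)"
proof (rule antisym)
  show "infsum f A \<le> (\<integral>\<^sup>+ x. f x \<partial>count_space A)"
    unfolding nonneg_infsum_complete[OF zero_le]
  proof (rule SUP_least)
    fix F assume "F \<in> {F. finite F \<and> F \<subseteq> A}"
    then have F: "finite F" "F \<subseteq> A" by auto
    have "sum f F = (\<integral>\<^sup>+ x. f x * indicator F x \<partial>count_space A)"
      using F by (subst nn_integral_indicator_finite) (auto intro!: sum.cong)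
    also have "\<dots> \<le> (\<integral>\<^sup>+ x. f x \<partial>count_space A)"
      by (intro nn_integral_mono) (auto split: split_indicator)
    finally show "sum f F \<le> (\<integral>\<^sup>+ x. f x \<partial>count_space A)" .
  qed
next
  show "(\<integral>\<^sup>+ x. f x \<partial>count_space A) \<le> infsum f A"
  proof (cases "finite A")
    case True then show ?thesis by (simp add: nn_integral_count_space_finite)
  next
    case False
    note bij = bij_betw_from_nat_into[OF A False]
    have "(\<integral>\<^sup>+ x. f x \<partial>count_space A) = (\<Sum>n. f (from_nat_into A n))"
      by (simp add: nn_integral_bij_count_space[symmetric, OF bij] nn_integral_count_space_nat)
    also have "\<dots> = (SUP n. \<Sum>i<n. f (from_nat_into A i))" by (rule suminf_eq_SUP)
    also have "\<dots> \<le> infsum f A"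
    proof (rule SUP_least)
      fix n
      have inj: "inj_on (from_nat_into A) {..<n}" using bij by (auto simp: bij_betw_def inj_on_def)
      have "(\<Sum>i<n. f (from_nat_into A i)) = sum f (from_nat_into A ` {..<n})"
        using inj by (simp add: sum.reindex)
      also have "\<dots> \<le> infsum f A" unfolding nonneg_infsum_complete[OF zero_le]
        using bij by (intro SUP_upper) (auto simp: bij_betw_def)
      finally show "(\<Sum>i<n. f (from_nat_into A i)) \<le> infsum f A" .
    qed
    finally show ?thesis .
  qed
qed

text \<open>
The point \<open>1 / (a + z)\<close> lies in the interior of an interval on which the Gauss map is \<open>x \<mapsto> 1 / x - a\<close>.
\<close>
lemma deriv_gauss_map:
  assumes a: "1 \<le> a" and z: "0 < z" "z < 1"
  shows "deriv gauss_map (1 / (real a + z)) = - ((real a + z)\<^sup>2)"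
proof -
  define y where "y = 1 / (real a + z)"
  have pos: "0 < real a + z" using z by simp
  have y: "y \<noteq> 0" "1 / (real a + 1) < y" "y < 1 / real a"
    using z a by (auto simp: y_def intro!: divide_strict_left_mono)
  have "((\<lambda>x. 1 / x - real a) has_field_derivative (- ((real a + z)\<^sup>2))) (at y)"
  proof -
    have "((\<lambda>x. 1 / x - real a) has_field_derivative (- (1 / (y * y)))) (at y)"
      using y(1) by (auto intro!: derivative_eq_intros)
    moreover have "1 / (y * y) = (real a + z)\<^sup>2" by (simp add: y_def power2_eq_square)
    ultimately show ?thesis by simp
  qed
  moreover have "\<forall>\<^sub>F x in nhds y. 1 / x - real a = gauss_map x"
  proof (rule eventually_nhds_in_open[of "{1 / (real a + 1) <..< 1 / real a}", THEN eventually_mono])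
    fix x assume "x \<in> {1 / (real a + 1) <..< 1 / real a}"
    then have x: "1 / (real a + 1) < x" "x < 1 / real a" by auto
    moreover have "0 < 1 / (real a + 1)" by simp
    ultimately have "0 < x" by linarith
    then have "real a < 1 / x" "1 / x < real a + 1" using x a by (simp_all add: field_simps)
    then show "1 / x - real a = gauss_map x" using \<open>0 < x\<close> unfolding gauss_map_def
      by (simp add: frac_def) (metis floor_unique less_eq_real_def of_int_of_nat_eq)
  qed (use y in auto)
  ultimately have "(gauss_map has_field_derivative (- ((real a + z)\<^sup>2))) (at y)"
    by (subst (asm) DERIV_cong_ev[OF refl _ refl]) auto
  then show ?thesis unfolding y_def by (rule DERIV_imp_deriv)
qed

lemma sum_ln_cf_append:
  assumes "set as \<subseteq> {1..}" "0 < x"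
  shows "(\<Sum>k<length as. ln (cf_append (drop k as) x)) = - ln (cf_den as x)"
  using assms(1)
proof (induction as)
  case (Cons a as)
  have p: "0 < real a + cf_append as x" "0 < cf_den as x"
    using Cons.prems assms(2) by (auto intro!: add_nonneg_pos cf_append_pos cf_den_pos)
  have "(\<Sum>k<length (a # as). ln (cf_append (drop k (a # as)) x))
     = ln (cf_append (a # as) x) + (\<Sum>k<length as. ln (cf_append (drop k as) x))"
    by (simp only: length_Cons sum.lessThan_Suc_shift drop_0 drop_Suc_Cons)
  also have "\<dots> = - ln (cf_den (a # as) x)" using Cons p by (simp add: ln_div ln_mult)
  finally show ?case .
qed simp

lemma cf_digits_in_pos:
  assumes "x \<in> cf_digits_in {1..}"
  shows "0 < x" "x < 1"
proof -
  have "x \<noteq> 0" using assms by (auto simp: cf_digits_in_def partial_quotient_def dest!: spec[of _ 1])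
  then show "0 < x" "x < 1" using assms by (auto simp: cf_digits_in_def)
qed

text \<open>
The golden ratio conjugate is fixed by the Gauss map and all its digits are 1.
\<close>
lemma cf_digits_in_nonempty: "cf_digits_in {1..} \<noteq> {}"
proof -
  define g :: real where "g = (sqrt 5 - 1) / 2"
  have s: "2 < sqrt 5" "sqrt 5 < 3" by (auto simp: real_less_rsqrt real_less_lsqrt)
  then have g: "0 < g" "g < 1" by (auto simp: g_def)
  have "g * (1 + g) = 1" by (simp add: g_def field_simps flip: power2_eq_square)
  then have i: "1 / g = 1 + g" using g by (simp add: field_simps)
  have fix_g: "gauss_map g = g" using g i by (simp add: gauss_map_def frac_unique_iff)
  then have "(gauss_map ^^ n) g = g" for n by (induction n) auto
  moreover have "\<lfloor>1 / g\<rfloor> = 1" unfolding i using g by linarith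
  ultimately have "g \<in> cf_digits_in {1..}" using g by (auto simp: cf_digits_in_def partial_quotient_def)
  then show ?thesis by blast
qed

context
  fixes s l :: real and \<phi> :: "real \<Rightarrow> real"
  assumes s: "0 \<le> s"
  defines "\<phi> \<equiv> (\<lambda>x. - (s\<^sup>2) * l - s * ln \<bar>deriv gauss_map x\<bar>)"
begin

lemma exp_birkhoff:
  assumes "as \<in> words n" "x \<in> cf_digits_in {1..}"
  shows "exp (birkhoff_sum gauss_map \<phi> n (cf_append as x)) = exp (- (s\<^sup>2 * l * real n)) * cf_den as x powr (- 2 * s)"
proof -
  have as: "set as \<subseteq> {1..}" "length as = n" using assms(1) by (auto simp: words_def)
  note x = cf_digits_in_pos[OF assms(2)]
  have "birkhoff_sum gauss_map \<phi> n (cf_append as x) = (\<Sum>k<n. - (s\<^sup>2) * l + 2 * s * ln (cf_append (drop k as) x))"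
    unfolding birkhoff_sum_def
  proof (intro sum.cong refl)
    fix k assume "k \<in> {..<n}"
    then have k: "k < length as" using as by simp
    have d: "drop k as = as ! k # drop (Suc k) as" using k by (simp add: Cons_nth_drop_Suc)
    have sd: "set (drop (Suc k) as) \<subseteq> {1..}" using as(1) set_drop_subset by fast
    define z where "z = cf_append (drop (Suc k) as) x"
    have z: "0 < z" "z < 1" using sd x by (auto simp: z_def intro!: cf_append_pos cf_append_less_1)
    have ak: "1 \<le> as ! k" using as(1) k nth_mem by force
    have e: "cf_append (drop k as) x = 1 / (real (as ! k) + z)" by (simp add: d z_def)
    have "(gauss_map ^^ k) (cf_append as x) = 1 / (real (as ! k) + z)"
      using as x k e by (subst gauss_map_funpow_cf_append) auto
    moreover have "ln \<bar>deriv gauss_map (1 / (real (as ! k) + z))\<bar> = - 2 * ln (1 / (real (as ! k) + z))"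
    proof -
      have "0 < real (as ! k) + z" using z by simp
      then show ?thesis using deriv_gauss_map[OF ak z] by (simp add: ln_div ln_realpow)
    qed
    ultimately show "\<phi> ((gauss_map ^^ k) (cf_append as x)) = - (s\<^sup>2) * l + 2 * s * ln (cf_append (drop k as) x)"
      unfolding \<phi>_def e by simp
  qed
  also have "\<dots> = - (s\<^sup>2 * l * real n) + 2 * s * (\<Sum>k<length as. ln (cf_append (drop k as) x))"
    unfolding sum.distrib sum_distrib_left[symmetric] as(2) by (simp add: mult_ac)
  also have "\<dots> = - (s\<^sup>2 * l * real n) + (- 2 * s) * ln (cf_den as x)"
    unfolding sum_ln_cf_append[OF as(1) x(1)] by simp
  finally show ?thesis using cf_den_pos[OF as(1), of x] x by (simp add: powr_def flip: exp_add)
qed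

text \<open>
By bounded distortion the supremum over the tails may be replaced by the value at 0, at the cost of a constant factor that disappears
in the exponential growth rate.
\<close>
lemma pressure_sum_bounds:
  shows "pressure_sum {1..} \<phi> n \<le> ennreal (exp (- (s\<^sup>2 * l * real n))) * cf_zeta s n"
    and "ennreal (exp (- (s\<^sup>2 * l * real n)) * 2 powr (- 2 * s)) * cf_zeta s n \<le> pressure_sum {1..} \<phi> n"
proof -
  let ?c = "exp (- (s\<^sup>2 * l * real n))"
  have ps: "pressure_sum {1..} \<phi> n = (\<integral>\<^sup>+ as. (SUP x\<in>cf_digits_in {1..}.
      ennreal (?c * cf_den as x powr (- 2 * s))) \<partial>count_space (words n))"
    unfolding pressure_sum_def words_def[symmetric] infsum_eq_nn_integral_count_space[OF countable_words]
    by (intro nn_integral_cong SUP_cong refl) (simp add: exp_birkhoff)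
  have den: "1 \<le> cf_den as 0 \<and> cf_den as 0 \<le> cf_den as x \<and> cf_den as x \<le> 2 * cf_den as 0"
    if "as \<in> words n" "x \<in> cf_digits_in {1..}" for as x
    using cf_den_bounds[of as x] cf_digits_in_pos[OF that(2)] cf_den_ge_1[of as 0] that(1) by (auto simp: words_def)
  show "pressure_sum {1..} \<phi> n \<le> ennreal ?c * cf_zeta s n"
    unfolding ps cf_zeta_def
  proof (subst nn_integral_cmult[symmetric], simp, intro nn_integral_mono SUP_least)
    fix as x assume "as \<in> space (count_space (words n))" and x: "x \<in> cf_digits_in {1..}"
    then have "as \<in> words n" by simp
    note d = den[OF this x]
    have "cf_den as x powr (- 2 * s) \<le> cf_den as 0 powr (- 2 * s)" using d s by (intro powr_mono2') auto
    then have "?c * cf_den as x powr (- 2 * s) \<le> ?c * cf_den as 0 powr (- 2 * s)" by (intro mult_left_mono) auto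
    then show "ennreal (?c * cf_den as x powr (- 2 * s)) \<le> ennreal ?c * ennreal (cf_den as 0 powr (- 2 * s))"
      by (simp add: ennreal_mult[symmetric] ennreal_leI)
  qed
  obtain x0 where x0: "x0 \<in> cf_digits_in {1..}" using cf_digits_in_nonempty by blast
  show "ennreal (?c * 2 powr (- 2 * s)) * cf_zeta s n \<le> pressure_sum {1..} \<phi> n"
    unfolding ps cf_zeta_def
  proof (subst nn_integral_cmult[symmetric], simp, intro nn_integral_mono SUP_upper2[OF x0])
    fix as assume "as \<in> space (count_space (words n))"
    then have "as \<in> words n" by simp
    note d = den[OF this x0]
    have "2 powr (- 2 * s) * cf_den as 0 powr (- 2 * s) = (2 * cf_den as 0) powr (- 2 * s)"
      by (simp add: powr_mult)
    also have "\<dots> \<le> cf_den as x0 powr (- 2 * s)" using d s by (intro powr_mono2') auto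
    finally have "?c * (2 powr (- 2 * s) * cf_den as 0 powr (- 2 * s)) \<le> ?c * cf_den as x0 powr (- 2 * s)"
      by (intro mult_left_mono) auto
    then show "ennreal (?c * 2 powr (- 2 * s)) * ennreal (cf_den as 0 powr (- 2 * s))
       \<le> ennreal (?c * cf_den as x0 powr (- 2 * s))"
      by (simp add: ennreal_mult[symmetric] ennreal_leI mult.assoc)
  qed
qed

text \<open>
By quasi-multiplicativity \<open>cf_zeta s n\<close> is infinite for all \<open>n \<ge> 1\<close> as soon as it is infinite for \<open>n = 1\<close>.
\<close>
lemma pressure_eq_infinity:
  assumes "cf_zeta s 1 = \<infinity>"
  shows "pressure \<phi> = \<infinity>"
proof -
  have z: "cf_zeta s (Suc n) = \<infinity>" for n
    using cf_zeta_add_ge[OF s, of n 1] assms cf_zeta_pos[of s n]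
    by (auto simp: top_unique ennreal_mult_top split: if_splits)
  have ps: "pressure_sum {1..} \<phi> (Suc n) = \<infinity>" for n
    using pressure_sum_bounds(2)[of "Suc n"] unfolding z by (auto simp: ennreal_mult_top top_unique)
  have "(\<lambda>n. ln_ennreal (pressure_sum {1..} \<phi> (Suc n)) / ereal (real (Suc n))) \<longlonglongrightarrow> \<infinity>"
    unfolding ps by (simp add: ln_ennreal_def)
  then have "(\<lambda>n. ln_ennreal (pressure_sum {1..} \<phi> n) / ereal (real n)) \<longlonglongrightarrow> \<infinity>"
    by (rule LIMSEQ_imp_Suc)
  then show ?thesis unfolding pressure_on_def by (rule limI)
qed

text \<open>
The pressure controls \<open>cf_zeta s n\<close> up to a constant for every \<open>n\<close>, and not only asymptotically. The bounds from
both sides are what allows one to pass from the sign of the pressure to a cover or to a single finite alphabet.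
\<close>
lemma pressure_finite:
  assumes fin: "cf_zeta s 1 < \<infinity>"
  obtains P where "pressure \<phi> = ereal P"
    "\<And>n. ennreal (exp (real n * (P + s\<^sup>2 * l) - 2 * s * ln 2)) \<le> cf_zeta s n"
    "\<And>n. cf_zeta s n \<le> ennreal (exp (real n * (P + s\<^sup>2 * l) + 2 * s * ln 2))"
proof -
  have zfin: "cf_zeta s n < \<infinity>" for n
  proof (induction n)
    case (Suc n)
    have "cf_zeta s (Suc n) \<le> cf_zeta s n * cf_zeta s 1" using cf_zeta_add_le[OF s, of n 1] by simp
    also have "\<dots> < \<infinity>" using Suc fin by (simp add: ennreal_mult_less_top)
    finally show ?case .
  qed simp
  define z where "z n = enn2real (cf_zeta s n)" for n
  have zz: "cf_zeta s n = ennreal (z n)" for n using zfin[of n] by (simp add: z_def)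
  have z0: "0 < z n" for n using cf_zeta_pos[of s n] zfin[of n] by (simp add: z_def enn2real_positive_iff)
  have up: "z (m + n) \<le> z m * z n" for m n
    using cf_zeta_add_le[OF s, of m n] z0[of m] z0[of n] unfolding zz by (simp add: ennreal_mult[symmetric])
  have lo: "2 powr (- 2 * s) * (z m * z n) \<le> z (m + n)" for m n
    using cf_zeta_add_ge[OF s, of m n] z0[of m] z0[of n] z0[of "m + n"] unfolding zz
    by (simp add: ennreal_mult[symmetric])
  have l2: "ln (2 powr (- 2 * s)) = - 2 * s * ln 2" by (simp add: ln_powr)
  have qa: "\<bar>ln (z (m + n)) - ln (z m) - ln (z n)\<bar> \<le> 2 * s * ln 2" for m n
  proof -
    have "ln (z (m + n)) \<le> ln (z m * z n)" using up[of m n] z0 by simp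
    moreover have "ln (2 powr (- 2 * s) * (z m * z n)) \<le> ln (z (m + n))" using lo[of m n] z0 by simp
    moreover have "ln (2 powr (- 2 * s) * (z m * z n)) = - 2 * s * ln 2 + (ln (z m) + ln (z n))"
      using z0[of m] z0[of n] by (simp add: ln_mult l2)
    moreover have "ln (z m * z n) = ln (z m) + ln (z n)" using z0[of m] z0[of n] by (simp add: ln_mult)
    moreover have "0 \<le> 2 * s * ln 2" using s by simp
    ultimately show ?thesis by linarith
  qed
  obtain L where L: "\<And>n. \<bar>ln (z n) - real n * L\<bar> \<le> 2 * s * ln 2" "(\<lambda>n. ln (z n) / real n) \<longlonglongrightarrow> L"
    using quasi_additive[of "\<lambda>n. ln (z n)", OF qa] by blast
  define P where "P = L - s\<^sup>2 * l"
  define p where "p n = enn2real (pressure_sum {1..} \<phi> n)" for n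
  have pfin: "pressure_sum {1..} \<phi> n < \<infinity>" for n
    using pressure_sum_bounds(1)[of n] zfin[of n] by (simp add: le_less_trans ennreal_mult_less_top)
  have pp: "pressure_sum {1..} \<phi> n = ennreal (p n)" for n using pfin[of n] by (simp add: p_def)
  have p1: "p n \<le> exp (- (s\<^sup>2 * l * real n)) * z n" for n
    using pressure_sum_bounds(1)[of n] z0[of n] unfolding pp zz by (simp add: ennreal_mult[symmetric])
  have p2: "exp (- (s\<^sup>2 * l * real n)) * 2 powr (- 2 * s) * z n \<le> p n" for n
    using pressure_sum_bounds(2)[of n] z0[of n] unfolding pp zz
    by (simp add: ennreal_mult[symmetric] p_def)
  have p0: "0 < p n" for n 
    by (rule less_le_trans[OF _ p2]) (use z0[of n] in simp)
  have pl: "\<bar>ln (p n) - (ln (z n) - s\<^sup>2 * l * real n)\<bar> \<le> 2 * s * ln 2" for n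
  proof -
    have "ln (p n) \<le> ln (exp (- (s\<^sup>2 * l * real n)) * z n)" using p0[of n] p1[of n] by simp
    also have "\<dots> = - (s\<^sup>2 * l * real n) + ln (z n)" using z0[of n] by (simp add: ln_mult)
    finally have 1: "ln (p n) \<le> - (s\<^sup>2 * l * real n) + ln (z n)" .
    have "ln (exp (- (s\<^sup>2 * l * real n)) * 2 powr (- 2 * s) * z n) \<le> ln (p n)" using p0[of n] p2[of n] z0[of n] by simp
    also have "ln (exp (- (s\<^sup>2 * l * real n)) * 2 powr (- 2 * s) * z n) = - (s\<^sup>2 * l * real n) - 2 * s * ln 2 + ln (z n)"
      using z0[of n] by (simp add: ln_mult l2)
    finally show ?thesis using 1 s by simp
  qed
  have "(\<lambda>n. ln (p n) / real n) \<longlonglongrightarrow> P"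
  proof -
    have "(\<lambda>n. (ln (p n) - (ln (z n) - s\<^sup>2 * l * real n)) / real n) \<longlonglongrightarrow> 0"
    proof (rule Lim_null_comparison)
      show "\<forall>\<^sub>F n in sequentially. norm ((ln (p n) - (ln (z n) - s\<^sup>2 * l * real n)) / real n) \<le> (2 * s * ln 2) / real n"
        using pl by (intro always_eventually allI) (simp add: divide_right_mono)
      show "(\<lambda>n. (2 * s * ln 2) / real n) \<longlonglongrightarrow> 0" by (rule lim_const_over_n)
    qed
    from tendsto_diff[OF tendsto_add[OF this L(2)] tendsto_const[of "s\<^sup>2 * l"]]
    have "(\<lambda>n. (ln (p n) - (ln (z n) - s\<^sup>2 * l * real n)) / real n + ln (z n) / real n - s\<^sup>2 * l) \<longlonglongrightarrow> P"
      by (simp add: P_def)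
    then show ?thesis
    proof (rule Lim_transform_eventually)
      show "\<forall>\<^sub>F n in sequentially. (ln (p n) - (ln (z n) - s\<^sup>2 * l * real n)) / real n + ln (z n) / real n - s\<^sup>2 * l = ln (p n) / real n"
        using eventually_gt_at_top[of 0] by eventually_elim (simp add: field_simps)
    qed
  qed
  then have "(\<lambda>n. ereal (ln (p n) / real n)) \<longlonglongrightarrow> ereal P" by simp
  then have "(\<lambda>n. ln_ennreal (pressure_sum {1..} \<phi> n) / ereal (real n)) \<longlonglongrightarrow> ereal P"
  proof (rule Lim_transform_eventually)
    show "\<forall>\<^sub>F n in sequentially. ereal (ln (p n) / real n) = ln_ennreal (pressure_sum {1..} \<phi> n) / ereal (real n)"
      using eventually_gt_at_top[of 0]
    proof eventually_elim
      case (elim n)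
      then show ?case unfolding pp using p0[of n] by (simp add: ln_ennreal_def ennreal_eq_0_iff not_le)
    qed
  qed
  then have P: "pressure \<phi> = ereal P" unfolding pressure_on_def by (rule limI)
  have PL: "P + s\<^sup>2 * l = L" by (simp add: P_def)
  have ze: "z n = exp (ln (z n))" for n using z0[of n] by simp
  show ?thesis
  proof (rule that[OF P])
    fix n
    have "real n * L - 2 * s * ln 2 \<le> ln (z n)" "ln (z n) \<le> real n * L + 2 * s * ln 2"
      using L(1)[of n] by linarith+
    then have "exp (real n * L - 2 * s * ln 2) \<le> exp (ln (z n))"
      "exp (ln (z n)) \<le> exp (real n * L + 2 * s * ln 2)" by simp_all
    then show "ennreal (exp (real n * (P + s\<^sup>2 * l) - 2 * s * ln 2)) \<le> cf_zeta s n"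
      "cf_zeta s n \<le> ennreal (exp (real n * (P + s\<^sup>2 * l) + 2 * s * ln 2))"
      unfolding zz PL ze[of n, symmetric] by (simp_all only: ennreal_leI)
  qed
qed

end


section \<open>Upper bounds for the dimension\<close>

text \<open>
The Borel-Cantelli lemma for cylinders. A point belongs to the image of \<open>{0..\<tau> w}\<close> under the
inverse branch of \<open>w\<close> if it begins with \<open>w\<close> and the next iterate is at most \<open>\<tau> w\<close>, that is, if the digit after \<open>w\<close> is
large.
\<close>
lemma cf_limsup_measure_zero:
  fixes \<tau> :: "nat list \<Rightarrow> real"
  assumes s: "0 < s" and \<tau>: "\<And>w. 0 \<le> \<tau> w"
    and sum: "(\<Sum>n. \<integral>\<^sup>+ w. ennreal ((\<tau> w / (cf_den w 0)\<^sup>2) powr s) \<partial>count_space (words n)) < \<infinity>"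
    and orb: "\<And>x k. x \<in> E \<Longrightarrow> 0 < (gauss_map ^^ k) x" "\<And>x. x \<in> E \<Longrightarrow> x < 1"
    and io: "\<And>x. x \<in> E \<Longrightarrow> \<exists>\<^sub>\<infinity>n. (gauss_map ^^ n) x \<le> \<tau> (digits n x)"
  shows "hausdorff_measure s E = 0"
proof -
  define J where "J = (\<lambda>(n::nat, w). cf_append w ` {0..\<tau> w})"
  have diam: "bounded (J (n, w))" "diameter (J (n, w)) \<le> \<tau> w / (cf_den w 0)\<^sup>2"
    if w: "w \<in> words n" for n w
  proof -
    have "norm (u - v) \<le> \<tau> w / (cf_den w 0)\<^sup>2" if "u \<in> J (n, w)" "v \<in> J (n, w)" for u v
    proof -
      have J: "J (n, w) = cf_append w ` {0..\<tau> w}" by (simp add: J_def)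
      from that(1) obtain x where x: "u = cf_append w x" "x \<in> {0..\<tau> w}" unfolding J by (rule imageE)
      from that(2) obtain y where y: "v = cf_append w y" "y \<in> {0..\<tau> w}" unfolding J by (rule imageE)
      have xy: "u = cf_append w x" "v = cf_append w y" "0 \<le> x" "x \<le> \<tau> w" "0 \<le> y" "y \<le> \<tau> w"
        using x y by simp_all
      have w1: "set w \<subseteq> {1..}" using w by (auto simp: words_def)
      have mono: "cf_den w 0 \<le> cf_den w z" if "0 \<le> z" for z
        using w1 that by (rule cf_den_ge_at_0)
      have p: "0 < cf_den w 0" using w1 by (rule cf_den_pos) simp
      have "\<bar>u - v\<bar> = \<bar>x - y\<bar> / (cf_den w x * cf_den w y)" unfolding xy using w1 xy by (intro cf_append_diff) auto
      also have "\<dots> \<le> \<tau> w / (cf_den w 0 * cf_den w 0)"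
        using xy mono p \<tau>[of w] cf_den_pos[OF w1, of x] by (intro frac_le mult_mono mult_pos_pos) auto
      finally show ?thesis by (simp add: power2_eq_square)
    qed
    then show "diameter (J (n, w)) \<le> \<tau> w / (cf_den w 0)\<^sup>2" using \<tau>
      by (intro diameter_le) (auto simp: J_def)
    show "bounded (J (n, w))"
    proof (rule boundedI)
      fix u assume u: "u \<in> J (n, w)"
      have "cf_append w 0 \<in> J (n, w)" using \<tau>[of w] by (auto simp: J_def)
      with u show "norm u \<le> norm (cf_append w 0) + \<tau> w / (cf_den w 0)\<^sup>2"
        using \<open>\<And>u v. u \<in> J (n, w) \<Longrightarrow> v \<in> J (n, w) \<Longrightarrow> norm (u - v) \<le> \<tau> w / (cf_den w 0)\<^sup>2\<close>[of u "cf_append w 0"]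
          norm_triangle_sub[of u "cf_append w 0"] by linarith
    qed
  qed
  show ?thesis
  proof (rule hausdorff_measure_limsup[where I = "Sigma UNIV words" and J = J
        and w = "\<lambda>p. (\<tau> (snd p) / (cf_den (snd p) 0)\<^sup>2) powr s"])
    show "countable (Sigma UNIV words)" by simp
    show "bounded (J i)" if "i \<in> Sigma UNIV words" for i using that diam(1) by auto
    show "diameter (J i) powr s \<le> (\<tau> (snd i) / (cf_den (snd i) 0)\<^sup>2) powr s" if I: "i \<in> Sigma UNIV words" for i
    proof -
      obtain n w where i: "i = (n, w)" "w \<in> words n" using I by auto
      show ?thesis unfolding i snd_conv using diam[OF i(2)] s
        by (intro powr_mono2 diameter_ge_0) auto
    qed
    show "(\<integral>\<^sup>+ i. ennreal ((\<tau> (snd i) / (cf_den (snd i) 0)\<^sup>2) powr s) \<partial>count_space (Sigma UNIV words)) < \<infinity>"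
      using sum by (subst nn_integral_count_space_Sigma[where f = "\<lambda>_ w. ennreal ((\<tau> w / (cf_den w 0)\<^sup>2) powr s)"])
        (simp add: nn_integral_count_space_nat)
    show "infinite {i \<in> Sigma UNIV words. x \<in> J i}" if x: "x \<in> E" for x
    proof -
      let ?N = "{n. (gauss_map ^^ n) x \<le> \<tau> (digits n x)}"
      have "infinite ((\<lambda>n. (n, digits n x)) ` ?N)"
        using io[OF x] by (subst finite_image_iff) (auto simp: INFM_iff_infinite inj_on_def)
      moreover have "(\<lambda>n. (n, digits n x)) ` ?N \<subseteq> {i \<in> Sigma UNIV words. x \<in> J i}"
      proof (clarsimp, intro conjI)
        fix n assume n: "(gauss_map ^^ n) x \<le> \<tau> (digits n x)"
        note ce = cf_expansion[OF orb(1)[OF x] orb(2)[OF x], of n]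
        show "digits n x \<in> words n" using ce(1) by (simp add: words_def)
        show "x \<in> J (n, digits n x)" using ce(2) orb(1)[OF x, of n] n
          by (auto simp: J_def intro!: image_eqI[where x = "(gauss_map ^^ n) x"])
      qed
      ultimately show ?thesis using finite_subset by blast
    qed
  qed (rule s)
qed

lemma gauss_map_le_inverse_quotient:
  assumes "0 < (gauss_map ^^ n) x" "0 < t" "t \<le> real (partial_quotient (Suc n) x)"
  shows "(gauss_map ^^ n) x \<le> 1 / t"
proof -
  define y where "y = (gauss_map ^^ n) x"
  have y: "0 < y" using assms(1) by (simp add: y_def)
  have "t \<le> real (nat \<lfloor>1 / y\<rfloor>)" using assms(3) by (simp add: partial_quotient_def y_def)
  also have "\<dots> \<le> 1 / y" using y by simp
  finally show ?thesis using y assms(2) by (simp add: y_def[symmetric] field_simps)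
qed

lemma nn_integral_words_prod:
  fixes g :: "nat \<Rightarrow> ennreal"
  shows "(\<integral>\<^sup>+ w. prod_list (map g w) \<partial>count_space (words n)) = (\<integral>\<^sup>+ a. g a \<partial>count_space {1..}) ^ n"
proof (induction n)
  case 0 then show ?case by (simp add: nn_integral_count_space_finite)
next
  case (Suc n)
  then show ?case by (simp add: nn_integral_words_Suc nn_integral_cmult nn_integral_multc mult.commute)
qed

lemma nn_integral_powr_finite:
  assumes "1 < \<sigma>"
  shows "(\<integral>\<^sup>+ a. ennreal (real a powr (- \<sigma>)) \<partial>count_space {1..}) < \<infinity>"
proof -
  have "(\<integral>\<^sup>+ a. ennreal (real a powr (- \<sigma>)) \<partial>count_space {1..})
     \<le> (\<integral>\<^sup>+ a. ennreal (real a powr (- \<sigma>)) \<partial>count_space UNIV)"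
    by (subst nn_integral_count_space_indicator) (auto intro!: nn_integral_mono split: split_indicator)
  also have "\<dots> = (\<Sum>a. ennreal (real a powr (- \<sigma>)))" by (rule nn_integral_count_space_nat)
  also have "\<dots> = ennreal (\<Sum>a. real a powr (- \<sigma>))"
    using assms by (intro suminf_ennreal2) (auto simp: summable_real_powr_iff)
  finally show ?thesis by (simp add: le_less_trans)
qed

lemma exceptional_orbit:
  assumes \<Phi>: "\<forall>n\<ge>1. \<Phi> n > 1" and x: "x \<in> exceptional_set \<Phi>"
  shows "0 < (gauss_map ^^ k) x" "x < 1"
proof -
  have io: "\<exists>\<^sub>\<infinity>n. real (partial_quotient (n + 1) x) * real (partial_quotient n x) \<ge> \<Phi> n"
    and x0: "0 \<le> x" "x < 1" using x by (auto simp: exceptional_set_def)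
  have "\<exists>\<^sub>\<infinity>n. 0 < partial_quotient n x"
    unfolding INFM_nat_le
  proof
    fix m
    obtain n where n: "n \<ge> Suc m" "real (partial_quotient (n + 1) x) * real (partial_quotient n x) \<ge> \<Phi> n"
      using io unfolding INFM_nat_le by blast
    have "1 < \<Phi> n" using n \<Phi> by auto
    then have "partial_quotient n x \<noteq> 0" using n(2) by (intro notI) auto
    then show "\<exists>n\<ge>m. 0 < partial_quotient n x" using n(1) by (intro exI[of _ n]) auto
  qed
  with x0(1) show "0 < (gauss_map ^^ k) x" by (rule gauss_orbit_pos)
  show "x < 1" by (rule x0)
qed

lemma ennreal_prod_list:
  assumes "\<And>a. 0 \<le> g a"
  shows "ennreal (prod_list (map g w)) = prod_list (map (\<lambda>a. ennreal (g a)) w)"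
proof (induction w)
  case (Cons a w)
  have "0 \<le> prod_list (map g w)" using assms by (intro prod_list_nonneg) auto
  then show ?case using Cons assms[of a] by (simp only: list.map prod_list.Cons ennreal_mult)
qed simp

text \<open>
The points that for every \<open>K\<close> have infinitely many digits larger than the \<open>\<gamma>\<close>-th power of the product of all earlier ones, with an
additional factor \<open>K\<close> for each earlier digit. The cost of a word is then a product over its letters, so
that the sum over the words of length \<open>n\<close> is an \<open>n\<close>-th power. Its base is a convergent zeta sum
times \<open>K\<^sup>-\<^sup>s\<close>, and a large \<open>K\<close> makes it smaller than 1/2.
\<close>
lemma large_quotients_measure_zero:
  assumes s: "0 < s" and \<gamma>: "0 \<le> \<gamma>" and sg: "1 < (2 + \<gamma>) * s"
    and orb: "\<And>x k. x \<in> E \<Longrightarrow> 0 < (gauss_map ^^ k) x" "\<And>x. x \<in> E \<Longrightarrow> x < 1"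
    and io: "\<And>K x. 1 < K \<Longrightarrow> x \<in> E \<Longrightarrow>
       \<exists>\<^sub>\<infinity>n. (\<Prod>a\<leftarrow>digits n x. K * real a powr \<gamma>) \<le> real (partial_quotient (Suc n) x)"
  shows "hausdorff_measure s E = 0"
proof -
  let ?\<sigma> = "(2 + \<gamma>) * s"
  define \<zeta> where "\<zeta> = enn2real (\<integral>\<^sup>+ a. ennreal (real a powr (- ?\<sigma>)) \<partial>count_space {1..})"
  have \<zeta>: "(\<integral>\<^sup>+ a. ennreal (real a powr (- ?\<sigma>)) \<partial>count_space {1..}) = ennreal \<zeta>" "0 \<le> \<zeta>"
    using nn_integral_powr_finite[OF sg] by (auto simp: \<zeta>_def)
  \<comment> \<open>chosen so that the sum over one digit is at most 1/2\<close>
  define K where "K = max 2 ((2 * (\<zeta> + 1)) powr (1 / s))"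
  have K: "1 < K" by (auto simp: K_def)
  have "2 * (\<zeta> + 1) = ((2 * (\<zeta> + 1)) powr (1 / s)) powr s" using s \<zeta>(2) by (simp add: powr_powr)
  also have "\<dots> \<le> K powr s" using s by (intro powr_mono2) (auto simp: K_def)
  finally have Ks: "K powr (- s) * \<zeta> \<le> 1 / 2" using \<zeta>(2) K by (simp add: powr_minus divide_simps)
  define \<tau> where "\<tau> w = 1 / (\<Prod>a\<leftarrow>w. K * real a powr \<gamma>)" for w :: "nat list"
  have pr: "0 \<le> (\<Prod>a\<leftarrow>w. K * real a powr \<gamma>)" for w :: "nat list"
    using K by (intro prod_list_nonneg) auto
  have pos: "0 < (\<Prod>a\<leftarrow>w. K * real a powr \<gamma>)" if "set w \<subseteq> {1..}" for w
    using that K by (induction w) auto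
  have ptw: "(\<tau> w / (cf_den w 0)\<^sup>2) powr s \<le> (\<Prod>a\<leftarrow>w. K powr (- s) * real a powr (- ?\<sigma>))"
    if "set w \<subseteq> {1..}" for w
  proof -
    have pa: "0 < (\<Prod>a\<leftarrow>w. real a)" using that by (induction w) auto
    note pk = pos[OF that]
    have "\<tau> w / (cf_den w 0)\<^sup>2 \<le> \<tau> w / (\<Prod>a\<leftarrow>w. real a)\<^sup>2"
      using cf_den_ge_prod[OF that] pa pk cf_den_pos[OF that, of 0] by (intro divide_left_mono power_mono) (auto simp: \<tau>_def)
    then have "(\<tau> w / (cf_den w 0)\<^sup>2) powr s \<le> (\<tau> w / (\<Prod>a\<leftarrow>w. real a)\<^sup>2) powr s"
      using s pr by (intro powr_mono2) (auto simp: \<tau>_def)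
    also have "\<dots> = (\<Prod>a\<leftarrow>w. K powr (- s) * real a powr (- ?\<sigma>))"
      using that
    proof (induction w)
      case Nil then show ?case by (simp add: \<tau>_def)
    next
      case (Cons a w)
      have a: "0 < real a" using Cons.prems by auto
      have "\<tau> (a # w) / (\<Prod>a\<leftarrow>a # w. real a)\<^sup>2
         = (1 / (K * real a powr \<gamma>) / (real a)\<^sup>2) * (\<tau> w / (\<Prod>a\<leftarrow>w. real a)\<^sup>2)"
        by (simp add: \<tau>_def power_mult_distrib)
      then have "(\<tau> (a # w) / (\<Prod>a\<leftarrow>a # w. real a)\<^sup>2) powr s
         = (1 / (K * real a powr \<gamma>) / (real a)\<^sup>2) powr s * (\<tau> w / (\<Prod>a\<leftarrow>w. real a)\<^sup>2) powr s"
        by (simp only: powr_mult)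
      also have "(1 / (K * real a powr \<gamma>) / (real a)\<^sup>2) powr s = K powr (- s) * real a powr (- ?\<sigma>)"
      proof -
        have "1 / (K * real a powr \<gamma>) / (real a)\<^sup>2 = K powr (-1) * real a powr (- (2 + \<gamma>))"
        proof -
          have "real a powr (- (2 + \<gamma>)) * (real a powr \<gamma> * (real a)\<^sup>2) = real a powr (- (2 + \<gamma>) + (\<gamma> + 2))"
            using a by (simp only: powr_add powr_numeral)
          also have "\<dots> = 1" using a by simp
          finally show ?thesis using a K by (simp add: powr_minus divide_simps)
        qed
        then have "(1 / (K * real a powr \<gamma>) / (real a)\<^sup>2) powr s = K powr (-1 * s) * real a powr (- (2 + \<gamma>) * s)"
          by (simp only: powr_mult powr_powr)
        then show ?thesis by (simp only: mult_minus_left mult_1_left)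
      qed
      finally show ?case using Cons by simp
    qed
    finally show ?thesis .
  qed
  have prod_enn: "ennreal (\<Prod>a\<leftarrow>w. K powr (- s) * real a powr (- ?\<sigma>))
      = prod_list (map (\<lambda>a. ennreal (K powr (- s) * real a powr (- ?\<sigma>))) w)" for w :: "nat list"
    by (rule ennreal_prod_list) simp
  show ?thesis
  proof (rule cf_limsup_measure_zero[where \<tau> = \<tau>])
    show "0 \<le> \<tau> w" for w using pr by (simp add: \<tau>_def)
    have "(\<integral>\<^sup>+ w. ennreal ((\<tau> w / (cf_den w 0)\<^sup>2) powr s) \<partial>count_space (words n)) \<le> ennreal ((1 / 2) ^ n)" for n
    proof -
      have "(\<integral>\<^sup>+ w. ennreal ((\<tau> w / (cf_den w 0)\<^sup>2) powr s) \<partial>count_space (words n))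
        \<le> (\<integral>\<^sup>+ w. prod_list (map (\<lambda>a. ennreal (K powr (- s) * real a powr (- ?\<sigma>))) w) \<partial>count_space (words n))"
        unfolding prod_enn[symmetric] by (intro nn_integral_mono ennreal_leI ptw) (simp add: words_def)
      also have "\<dots> = (\<integral>\<^sup>+ a. ennreal (K powr (- s)) * ennreal (real a powr (- ?\<sigma>)) \<partial>count_space {1..}) ^ n"
        by (simp only: nn_integral_words_prod ennreal_mult powr_ge_zero)
      also have "(\<integral>\<^sup>+ a. ennreal (K powr (- s)) * ennreal (real a powr (- ?\<sigma>)) \<partial>count_space {1..}) = ennreal (K powr (- s) * \<zeta>)"
        by (subst nn_integral_cmult, simp, subst \<zeta>(1), simp add: ennreal_mult \<zeta>(2))
      also have "ennreal (K powr (- s) * \<zeta>) ^ n \<le> ennreal (1 / 2) ^ n"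
        using Ks by (intro power_mono ennreal_leI) auto
      finally show ?thesis using ennreal_power[of "1/2" n] by simp
    qed
    then have "(\<Sum>n. \<integral>\<^sup>+ w. ennreal ((\<tau> w / (cf_den w 0)\<^sup>2) powr s) \<partial>count_space (words n)) \<le> (\<Sum>n. ennreal ((1 / 2) ^ n))"
      by (intro suminf_le) auto
    also have "\<dots> < \<infinity>"
    proof -
      have "summable (\<lambda>n. (1 / 2 :: real) ^ n)" by (rule summable_geometric) simp
      then have "(\<Sum>n. ennreal ((1 / 2) ^ n)) = ennreal (\<Sum>n. (1 / 2) ^ n)" by (intro suminf_ennreal2) auto
      then show ?thesis by (simp only: infinity_ennreal_def ennreal_less_top)
    qed
    finally show "(\<Sum>n. \<integral>\<^sup>+ w. ennreal ((\<tau> w / (cf_den w 0)\<^sup>2) powr s) \<partial>count_space (words n)) < \<infinity>" .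
    fix x assume x: "x \<in> E"
    have "\<exists>\<^sub>\<infinity>n. (\<Prod>a\<leftarrow>digits n x. K * real a powr \<gamma>) \<le> real (partial_quotient (Suc n) x)"
      by (rule io[OF K x])
    then show "\<exists>\<^sub>\<infinity>n. (gauss_map ^^ n) x \<le> \<tau> (digits n x)"
    proof (rule INFM_mono)
      fix n assume *: "(\<Prod>a\<leftarrow>digits n x. K * real a powr \<gamma>) \<le> real (partial_quotient (Suc n) x)"
      have "set (digits n x) \<subseteq> {1..}" by (rule cf_expansion(1)[OF orb(1)[OF x] orb(2)[OF x]])
      then have "0 < (\<Prod>a\<leftarrow>digits n x. K * real a powr \<gamma>)" by (rule pos)
      with * show "(gauss_map ^^ n) x \<le> \<tau> (digits n x)"
        unfolding \<tau>_def by (intro gauss_map_le_inverse_quotient[OF orb(1)[OF x]])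
    qed
  qed (fact s, fact orb(1), fact orb(2))
qed

text \<open>
Comparison with the integral of \<open>x\<^sup>-\<^sup>s\<close>.
\<close>
lemma sum_powr_le:
  assumes s: "0 < s" "s < 1"
  shows "(\<Sum>a=1..N. real a powr (- s)) \<le> real N powr (1 - s) / (1 - s)"
proof (induction N)
  case (Suc N)
  have step: "real (Suc N) powr (- s) \<le> (real (Suc N) powr (1 - s) - real N powr (1 - s)) / (1 - s)"
  proof (cases "N = 0")
    case True then show ?thesis using s by simp
  next
    case False
    have "\<exists>z>real N. z < real (Suc N) \<and> real (Suc N) powr (1 - s) - real N powr (1 - s)
        = (real (Suc N) - real N) * ((1 - s) * z powr (1 - s - 1))"
    proof (rule MVT2)
      fix x assume "real N \<le> x" "x \<le> real (Suc N)"
      then show "((\<lambda>x. x powr (1 - s)) has_real_derivative (1 - s) * x powr (1 - s - 1)) (at x)"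
        using False by (intro has_real_derivative_powr) auto
    qed simp
    then obtain z where z: "real N < z" "z < real (Suc N)"
      "real (Suc N) powr (1 - s) - real N powr (1 - s) = (real (Suc N) - real N) * ((1 - s) * z powr (1 - s - 1))"
      by blast
    then have "(real (Suc N) powr (1 - s) - real N powr (1 - s)) / (1 - s) = z powr (- s)" using s by simp
    moreover have "real (Suc N) powr (- s) \<le> z powr (- s)" using z s by (intro powr_mono2') auto
    ultimately show ?thesis by simp
  qed
  have "(\<Sum>a=1..Suc N. real a powr (- s)) = (\<Sum>a=1..N. real a powr (- s)) + real (Suc N) powr (- s)" by simp
  also have "\<dots> \<le> real N powr (1 - s) / (1 - s) + (real (Suc N) powr (1 - s) - real N powr (1 - s)) / (1 - s)"
    using Suc step by (rule add_mono)
  also have "\<dots> = real (Suc N) powr (1 - s) / (1 - s)" by (simp add: diff_divide_distrib)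
  finally show ?case .
qed simp

lemma nn_integral_powr_below:
  assumes s: "0 < s" "s < 1" and A: "0 \<le> A"
  shows "(\<integral>\<^sup>+ a. ennreal (if real a < A then real a powr (- s) else 0) \<partial>count_space {1..}) \<le> ennreal (A powr (1 - s) / (1 - s))"
proof -
  define N where "N = nat \<lfloor>A\<rfloor>"
  have N: "real N \<le> A" using A by (simp add: N_def)
  have "(\<integral>\<^sup>+ a. ennreal (if real a < A then real a powr (- s) else 0) \<partial>count_space {1..})
     \<le> (\<integral>\<^sup>+ a. ennreal (real a powr (- s)) * indicator {1..N} a \<partial>count_space {1..})"
  proof (intro nn_integral_mono)
    fix a :: nat assume "a \<in> space (count_space {1..})"
    moreover have "a \<le> N" if "real a < A" using that by (simp add: N_def le_nat_iff le_floor_iff)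
    ultimately show "ennreal (if real a < A then real a powr (- s) else 0) \<le> ennreal (real a powr (- s)) * indicator {1..N} a"
      by auto
  qed
  also have "\<dots> = (\<Sum>a=1..N. ennreal (real a powr (- s)))"
    by (subst nn_integral_indicator_finite) (auto intro!: sum.cong)
  also have "\<dots> = ennreal (\<Sum>a=1..N. real a powr (- s))" by (rule sum_ennreal) simp
  also have "\<dots> \<le> ennreal (real N powr (1 - s) / (1 - s))" by (rule ennreal_leI[OF sum_powr_le[OF s]])
  also have "\<dots> \<le> ennreal (A powr (1 - s) / (1 - s))"
    using N s by (intro ennreal_leI divide_right_mono powr_mono2) auto
  finally show ?thesis .
qed

text \<open>
The product \<open>a\<^sub>n a\<^sub>n\<^sub>+\<^sub>1\<close> is large for one of two reasons. Either \<open>a\<^sub>n \<ge> A n\<close>, which is a condition on the digit after a word of length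
\<open>n - 1\<close>, or \<open>a\<^sub>n < A n\<close> and the digit after a word of length \<open>n\<close> is at least \<open>exp (l' n) / a\<^sub>n\<close>. The choice
\<open>A n = exp (s l' n)\<close> balances the two contributions: each is at most a constant times \<open>cf_zeta s n\<close> times
\<open>exp (- s\<^sup>2 l' n)\<close>.
\<close>
lemma product_quotients_measure_zero:
  assumes s: "0 < s" "s < 1" and l': "0 < l'" and r: "0 \<le> r" "r < s\<^sup>2 * l'"
    and zeta: "\<And>n. cf_zeta s n \<le> ennreal (C * exp (real n * r))" and C: "0 \<le> C"
    and orb: "\<And>x k. x \<in> E \<Longrightarrow> 0 < (gauss_map ^^ k) x" "\<And>x. x \<in> E \<Longrightarrow> x < 1"
    and io: "\<And>x. x \<in> E \<Longrightarrow> \<exists>\<^sub>\<infinity>n. exp (l' * real n) \<le> real (partial_quotient (n + 1) x) * real (partial_quotient n x)"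
  shows "hausdorff_measure s E = 0"
proof -
  define A where "A n = exp (s * l' * real n)" for n :: nat
  have A: "0 < A n" for n by (simp add: A_def)
  define \<tau>1 where "\<tau>1 w = 1 / A (Suc (length w))" for w :: "nat list"
  define \<tau>2 where "\<tau>2 w = (if w \<noteq> [] \<and> real (last w) < A (length w)
     then real (last w) / exp (l' * real (length w)) else 0)" for w :: "nat list"
  define \<tau> where "\<tau> w = max (\<tau>1 w) (\<tau>2 w)" for w
  have \<tau>0: "0 \<le> \<tau>1 w" "0 \<le> \<tau>2 w" for w using A by (auto simp: \<tau>1_def \<tau>2_def less_imp_le)
  define q where "q = exp (r - s\<^sup>2 * l')"
  have q: "0 < q" "q < 1" using r by (auto simp: q_def)
  let ?X = "\<lambda>\<tau> n. \<integral>\<^sup>+ w. ennreal ((\<tau> w / (cf_den w 0)\<^sup>2) powr s) \<partial>count_space (words n)"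
  have X1: "?X \<tau>1 n \<le> ennreal (C * q ^ n)" for n
  proof -
    have "?X \<tau>1 n = (\<integral>\<^sup>+ w. ennreal (exp (- (s\<^sup>2 * l' * real (Suc n)))) * ennreal (cf_den w 0 powr (- 2 * s)) \<partial>count_space (words n))"
    proof (intro nn_integral_cong)
      fix w assume "w \<in> space (count_space (words n))"
      then have w: "set w \<subseteq> {1..}" "length w = n" by (auto simp: words_def)
      have d: "0 < cf_den w 0" by (rule cf_den_pos[OF w(1)]) simp
      have "(\<tau>1 w / (cf_den w 0)\<^sup>2) powr s = \<tau>1 w powr s * (1 / (cf_den w 0)\<^sup>2) powr s"
        by (simp add: powr_mult[symmetric])
      also have "(1 / (cf_den w 0)\<^sup>2) powr s = (cf_den w 0 powr (- 2)) powr s"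
        using d by (simp add: powr_minus_divide powr_numeral)
      also have "\<dots> = cf_den w 0 powr (- 2 * s)" by (simp only: powr_powr)
      also have "\<tau>1 w powr s = exp (- (s\<^sup>2 * l' * real (Suc n)))"
        unfolding \<tau>1_def w(2) A_def
        by (simp add: powr_def exp_minus[symmetric] inverse_eq_divide[symmetric] power2_eq_square algebra_simps)
      finally show "ennreal ((\<tau>1 w / (cf_den w 0)\<^sup>2) powr s)
         = ennreal (exp (- (s\<^sup>2 * l' * real (Suc n)))) * ennreal (cf_den w 0 powr (- 2 * s))"
        by (simp add: ennreal_mult[symmetric])
    qed
    also have "\<dots> = ennreal (exp (- (s\<^sup>2 * l' * real (Suc n)))) * cf_zeta s n"
      unfolding cf_zeta_def by (rule nn_integral_cmult) simp
    also have "\<dots> \<le> ennreal (exp (- (s\<^sup>2 * l' * real (Suc n)))) * ennreal (C * exp (real n * r))"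
      by (intro mult_left_mono zeta) simp
    also have "\<dots> = ennreal (exp (- (s\<^sup>2 * l' * real (Suc n))) * (C * exp (real n * r)))"
      by (rule ennreal_mult[symmetric]) (use C in auto)
    also have "\<dots> \<le> ennreal (C * q ^ n)"
    proof (rule ennreal_leI)
      have "exp (- (s\<^sup>2 * l' * real (Suc n))) * exp (real n * r) = exp (- (s\<^sup>2 * l')) * q ^ n"
        unfolding q_def by (simp add: exp_add[symmetric] exp_of_nat_mult[symmetric] algebra_simps)
      also have "\<dots> \<le> 1 * q ^ n" using q l' by (intro mult_right_mono) auto
      finally have "C * (exp (- (s\<^sup>2 * l' * real (Suc n))) * exp (real n * r)) \<le> C * (1 * q ^ n)"
        using C by (rule mult_left_mono)
      then show "exp (- (s\<^sup>2 * l' * real (Suc n))) * (C * exp (real n * r)) \<le> C * q ^ n" by (simp add: mult_ac)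
    qed
    finally show ?thesis .
  qed
  have X2: "?X \<tau>2 (Suc n) \<le> ennreal (C / (1 - s) * q ^ n)" for n
  proof -
    let ?e = "exp (- (s * l' * real (Suc n)))"
    have "?X \<tau>2 (Suc n) \<le> (\<integral>\<^sup>+ u. \<integral>\<^sup>+ a. ennreal (cf_den u 0 powr (- 2 * s)) * (ennreal ?e *
         ennreal (if real a < A (Suc n) then real a powr (- s) else 0)) \<partial>count_space {1..} \<partial>count_space (words n))"
      unfolding nn_integral_words_Suc
    proof (intro nn_integral_mono)
      fix u and a :: nat assume "u \<in> space (count_space (words n))" "a \<in> space (count_space {1..})"
      then have u: "set u \<subseteq> {1..}" "length u = n" and a: "1 \<le> a" by (auto simp: words_def)
      have d: "0 < cf_den u 0" by (rule cf_den_pos[OF u(1)]) simp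
      have dd: "cf_den u 0 * real a \<le> cf_den (u @ [a]) 0"
        using cf_den_append_ge[of u "[a]"] u(1) a by simp
      have "(\<tau>2 (u @ [a]) / (cf_den (u @ [a]) 0)\<^sup>2) powr s
          \<le> cf_den u 0 powr (- 2 * s) * (?e * (if real a < A (Suc n) then real a powr (- s) else 0))"
      proof (cases "real a < A (Suc n)")
        case True
        have "\<tau>2 (u @ [a]) / (cf_den (u @ [a]) 0)\<^sup>2 \<le> (real a / exp (l' * real (Suc n))) / (cf_den u 0 * real a)\<^sup>2"
          unfolding \<tau>2_def using True u(2) dd d a by (intro frac_le power_mono) auto
        also have "\<dots> = 1 / (cf_den u 0)\<^sup>2 * (1 / exp (l' * real (Suc n)) * (1 / real a))"
          using a by (simp add: field_simps power2_eq_square)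
        also have "\<dots> = cf_den u 0 powr (- 2) * (exp (l' * real (Suc n)) powr (- 1) * real a powr (- 1))"
          using d a by (simp add: powr_minus_divide powr_numeral)
        finally have "(\<tau>2 (u @ [a]) / (cf_den (u @ [a]) 0)\<^sup>2) powr s
          \<le> (cf_den u 0 powr (- 2) * (exp (l' * real (Suc n)) powr (- 1) * real a powr (- 1))) powr s"
          using \<tau>0 s by (intro powr_mono2) auto
        also have "\<dots> = cf_den u 0 powr (- 2 * s) * (exp (l' * real (Suc n)) powr (- 1 * s) * real a powr (- 1 * s))"
          by (simp only: powr_mult powr_powr)
        also have "exp (l' * real (Suc n)) powr (- 1 * s) = ?e"
          by (simp add: powr_def algebra_simps)
        finally show ?thesis using True by simp
      next
        case False
        then show ?thesis using u(2) by (simp add: \<tau>2_def)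
      qed
      then show "ennreal ((\<tau>2 (u @ [a]) / (cf_den (u @ [a]) 0)\<^sup>2) powr s)
         \<le> ennreal (cf_den u 0 powr (- 2 * s)) * (ennreal ?e * ennreal (if real a < A (Suc n) then real a powr (- s) else 0))"
        by (subst ennreal_mult[symmetric], simp, simp, subst ennreal_mult[symmetric], simp, simp, rule ennreal_leI)
    qed
    also have "\<dots> = cf_zeta s n * (ennreal ?e * (\<integral>\<^sup>+ a. ennreal (if real a < A (Suc n) then real a powr (- s) else 0) \<partial>count_space {1..}))"
      unfolding cf_zeta_def by (simp only: nn_integral_cmult nn_integral_multc borel_measurable_count_space)
    also have "\<dots> \<le> ennreal (C * exp (real n * r)) * (ennreal ?e * ennreal (A (Suc n) powr (1 - s) / (1 - s)))"
      by (intro mult_mono zeta nn_integral_powr_below s order_refl less_imp_le[OF A]) auto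
    also have "\<dots> = ennreal (C * exp (real n * r) * (?e * (A (Suc n) powr (1 - s) / (1 - s))))"
    proof -
      have "0 \<le> C * exp (real n * r)" "0 \<le> A (Suc n) powr (1 - s) / (1 - s)" using C s by auto
      then show ?thesis by (simp only: ennreal_mult exp_ge_zero mult_nonneg_nonneg)
    qed
    also have "\<dots> \<le> ennreal (C / (1 - s) * q ^ n)"
    proof (rule ennreal_leI)
      have "A (Suc n) powr (1 - s) = exp ((1 - s) * (s * l' * real (Suc n)))" by (simp add: A_def powr_def)
      then have "exp (real n * r) * (?e * A (Suc n) powr (1 - s)) = exp (real n * r + (- (s * l' * real (Suc n)) + (1 - s) * (s * l' * real (Suc n))))"
        by (simp only: exp_add)
      also have "\<dots> = exp (- (s\<^sup>2 * l')) * q ^ n"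
        unfolding q_def by (simp add: exp_add[symmetric] exp_of_nat_mult[symmetric] algebra_simps power2_eq_square)
      also have "\<dots> \<le> 1 * q ^ n" using q l' by (intro mult_right_mono) auto
      finally have "C / (1 - s) * (exp (real n * r) * (?e * A (Suc n) powr (1 - s))) \<le> C / (1 - s) * (1 * q ^ n)"
        using C s by (intro mult_left_mono) auto
      then show "C * exp (real n * r) * (?e * (A (Suc n) powr (1 - s) / (1 - s))) \<le> C / (1 - s) * q ^ n"
        by (simp add: mult_ac)
    qed
    finally show ?thesis .
  qed
  have X20: "?X \<tau>2 0 = 0" by (simp add: nn_integral_count_space_finite \<tau>2_def)
  show ?thesis
  proof (rule cf_limsup_measure_zero[where \<tau> = \<tau>])
    show "0 \<le> \<tau> w" for w using \<tau>0 by (simp add: \<tau>_def max_def)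
    have sg: "summable (\<lambda>n. K * q ^ n)" for K using q by (intro summable_mult summable_geometric) auto
    have fin: "(\<Sum>n. ennreal (K * q ^ n)) < \<infinity>" if "0 \<le> K" for K
    proof -
      have "(\<Sum>n. ennreal (K * q ^ n)) = ennreal (\<Sum>n. K * q ^ n)" using q that by (intro suminf_ennreal2 sg) auto
      then show ?thesis by (simp only: infinity_ennreal_def ennreal_less_top)
    qed
    have "(\<Sum>n. ?X \<tau> n) \<le> (\<Sum>n. ?X \<tau>1 n + ?X \<tau>2 n)"
    proof (intro suminf_le)
      fix n
      have "?X \<tau> n \<le> (\<integral>\<^sup>+ w. ennreal ((\<tau>1 w / (cf_den w 0)\<^sup>2) powr s) + ennreal ((\<tau>2 w / (cf_den w 0)\<^sup>2) powr s) \<partial>count_space (words n))"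
        by (intro nn_integral_mono) (auto simp: \<tau>_def max_def)
      also have "\<dots> = ?X \<tau>1 n + ?X \<tau>2 n" by (rule nn_integral_add) auto
      finally show "?X \<tau> n \<le> ?X \<tau>1 n + ?X \<tau>2 n" .
    qed auto
    also have "\<dots> = (\<Sum>n. ?X \<tau>1 n) + (\<Sum>n. ?X \<tau>2 n)" by (rule suminf_add[symmetric]) auto
    also have "(\<Sum>n. ?X \<tau>2 n) = (\<Sum>n. ?X \<tau>2 (Suc n))"
      by (subst suminf_offset[where i = 1]) (simp_all add: X20[simplified])
    also have "(\<Sum>n. ?X \<tau>1 n) + (\<Sum>n. ?X \<tau>2 (Suc n)) \<le> (\<Sum>n. ennreal (C * q ^ n)) + (\<Sum>n. ennreal (C / (1 - s) * q ^ n))"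
      by (intro add_mono suminf_le X1 X2) auto
    also have "\<dots> < \<infinity>" using fin[of C] fin[of "C / (1 - s)"] C s by (simp add: ennreal_add_less_top)
    finally show "(\<Sum>n. ?X \<tau> n) < \<infinity>" .
    fix x assume x: "x \<in> E"
    show "\<exists>\<^sub>\<infinity>n. (gauss_map ^^ n) x \<le> \<tau> (digits n x)"
      unfolding INFM_nat_le
    proof
      fix m
      obtain n where n: "n \<ge> Suc m" and big: "exp (l' * real n) \<le> real (partial_quotient (n + 1) x) * real (partial_quotient n x)"
        using io[OF x] unfolding INFM_nat_le by blast
      obtain n' where n': "n = Suc n'" using n by (cases n) auto
      have an: "1 \<le> partial_quotient n x"
        using cf_expansion(1)[OF orb(1)[OF x] orb(2)[OF x], of n] unfolding n' by (auto simp: digits_Suc)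
      show "\<exists>n\<ge>m. (gauss_map ^^ n) x \<le> \<tau> (digits n x)"
      proof (cases "real (partial_quotient n x) < A n")
        case True
        have "exp (l' * real n) / real (partial_quotient n x) \<le> real (partial_quotient (Suc n) x)"
          using big an by (simp add: divide_le_eq)
        then have "(gauss_map ^^ n) x \<le> 1 / (exp (l' * real n) / real (partial_quotient n x))"
          using an by (intro gauss_map_le_inverse_quotient[OF orb(1)[OF x]]) auto
        also have "\<dots> = \<tau>2 (digits n x)" using True n' by (simp add: \<tau>2_def digits_Suc)
        also have "\<dots> \<le> \<tau> (digits n x)" by (simp add: \<tau>_def)
        finally show ?thesis using n by (intro exI[of _ n]) auto
      next
        case False
        then have "(gauss_map ^^ n') x \<le> 1 / A n"
          using n' A by (intro gauss_map_le_inverse_quotient[OF orb(1)[OF x]]) auto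
        also have "\<dots> = \<tau>1 (digits n' x)" by (simp add: \<tau>1_def n')
        also have "\<dots> \<le> \<tau> (digits n' x)" by (simp add: \<tau>_def)
        finally show ?thesis using n n' by (intro exI[of _ n']) auto
      qed
    qed
  qed (fact s(1), fact orb(1), fact orb(2))
qed

lemma exceptional_dim_le_1: "hausdorff_dim (exceptional_set \<Phi>) \<le> 1"
proof -
  have "hausdorff_dim (exceptional_set \<Phi>) \<le> hausdorff_dim {0..<1::real}"
    by (rule hausdorff_dim_mono) (auto simp: exceptional_set_def)
  also have "\<dots> \<le> ennreal 1" by (rule hausdorff_dim_leI[of _ 2]) (auto intro: hausdorff_measure_unit_interval)
  finally show ?thesis by simp
qed

text \<open>
The pressure bound at \<open>t\<close> carries over to every \<open>s > t\<close> because \<open>cf_zeta\<close> decreases in its first argument, and the strict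
increase of \<open>s\<^sup>2\<close> leaves room for replacing \<open>l\<close> by a smaller \<open>l'\<close>. For \<open>t \<ge> 1\<close> the bound is
trivial.
\<close>
lemma exceptional_dim_le_pressure:
  fixes \<Phi> :: "nat \<Rightarrow> real"
  assumes \<Phi>: "\<forall>n\<ge>1. \<Phi> n > 1" and l: "0 < l"
    and ev: "\<And>l'. l' < l \<Longrightarrow> \<forall>\<^sub>F n in sequentially. exp (l' * real n) \<le> \<Phi> n"
    and t: "0 \<le> t" and P: "pressure (\<lambda>x. - (t\<^sup>2) * l - t * ln \<bar>deriv gauss_map x\<bar>) \<le> 0"
  shows "hausdorff_dim (exceptional_set \<Phi>) \<le> ennreal t"
proof (cases "t < 1")
  case False
  then have "1 \<le> ennreal t" by simp
  with exceptional_dim_le_1 show ?thesis by (rule order_trans)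
next
  case True
  have "cf_zeta t 1 < \<infinity>" using pressure_eq_infinity[OF t, of l] P by (auto simp: less_top[symmetric])
  then obtain p where p: "pressure (\<lambda>x. - (t\<^sup>2) * l - t * ln \<bar>deriv gauss_map x\<bar>) = ereal p"
    and z: "\<And>n. cf_zeta t n \<le> ennreal (exp (real n * (p + t\<^sup>2 * l) + 2 * t * ln 2))"
    using pressure_finite[OF t, of l] by metis
  have "p \<le> 0" using P p by simp
  have zt: "cf_zeta t n \<le> ennreal (exp (2 * t * ln 2) * exp (real n * (t\<^sup>2 * l)))" for n
  proof -
    have "real n * (p + t\<^sup>2 * l) \<le> real n * (t\<^sup>2 * l)" using \<open>p \<le> 0\<close> by (intro mult_left_mono) auto
    then have "exp (real n * (p + t\<^sup>2 * l) + 2 * t * ln 2) \<le> exp (2 * t * ln 2) * exp (real n * (t\<^sup>2 * l))"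
      unfolding exp_add[symmetric] by simp
    with z[of n] show ?thesis by (meson ennreal_leI order_trans)
  qed
  show ?thesis
  proof (rule hausdorff_dim_leI[OF t True])
    fix s assume s: "t < s" "s < 1"
    define l' where "l' = l * (1 + t\<^sup>2 / s\<^sup>2) / 2"
    have s0: "0 < s" using s t by simp
    have ts: "t\<^sup>2 < s\<^sup>2" using s t by (simp add: power_strict_mono)
    then have l': "0 < l'" "l' < l" "t\<^sup>2 * l < s\<^sup>2 * l'"
    proof -
      have f: "t\<^sup>2 / s\<^sup>2 < 1" "0 \<le> t\<^sup>2 / s\<^sup>2" using ts s0 by (simp_all add: divide_simps)
      then show "0 < l'" using l by (simp add: l'_def mult_pos_pos add_pos_nonneg)
      have "l * (1 + t\<^sup>2 / s\<^sup>2) < l * 2" using f l by (intro mult_strict_left_mono) auto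
      then show "l' < l" by (simp add: l'_def)
      have "s\<^sup>2 * l' = l * (s\<^sup>2 + t\<^sup>2) / 2" using s0 by (simp add: l'_def field_simps)
      moreover have "l * (2 * t\<^sup>2) < l * (s\<^sup>2 + t\<^sup>2)" using ts l by (intro mult_strict_left_mono) auto
      moreover have "t\<^sup>2 * l = l * (2 * t\<^sup>2) / 2" by simp
      ultimately show "t\<^sup>2 * l < s\<^sup>2 * l'" by (simp only: divide_strict_right_mono zero_less_numeral)
    qed
    show "hausdorff_measure s (exceptional_set \<Phi>) = 0"
    proof (rule product_quotients_measure_zero[OF s0 s(2) l'(1) _ l'(3)])
      show "0 \<le> t\<^sup>2 * l" using l by simp
      show "cf_zeta s n \<le> ennreal (exp (2 * t * ln 2) * exp (real n * (t\<^sup>2 * l)))" for n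
        by (rule order_trans[OF cf_zeta_antimono zt]) (use s in simp)
      fix x assume x: "x \<in> exceptional_set \<Phi>"
      show "0 < (gauss_map ^^ k) x" "x < 1" for k by (rule exceptional_orbit[OF \<Phi> x])+
      have "\<exists>\<^sub>\<infinity>n. real (partial_quotient (n + 1) x) * real (partial_quotient n x) \<ge> \<Phi> n"
        using x by (simp add: exceptional_set_def)
      from INFM_conjI[OF this, folded cofinite_eq_sequentially, OF ev[OF l'(2), folded cofinite_eq_sequentially]]
      have "\<exists>\<^sub>\<infinity>n. real (partial_quotient (n + 1) x) * real (partial_quotient n x) \<ge> \<Phi> n \<and> exp (l' * real n) \<le> \<Phi> n"
        .
      then show "\<exists>\<^sub>\<infinity>n. exp (l' * real n) \<le> real (partial_quotient (n + 1) x) * real (partial_quotient n x)"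
        by (rule INFM_mono) auto
    qed simp
  qed
qed

text \<open>
If from some point on every digit stayed below the bound of \<open>large_quotients_measure_zero\<close> with \<open>\<gamma> = c - 1\<close>, then the logarithm \<open>L n\<close> of that bound would
satisfy \<open>L (n + 1) \<le> c L n + ln K\<close>, and the products of consecutive digits could not reach \<open>\<Phi>\<close>.
\<close>
lemma exceptional_dim_le_growth:
  fixes \<Phi> :: "nat \<Rightarrow> real"
  assumes \<Phi>: "\<forall>n\<ge>1. \<Phi> n > 1" and c: "1 \<le> c"
    and ev: "\<And>C K. \<forall>\<^sub>F n in sequentially. c ^ n * (C + real n * K) < ln (\<Phi> n)"
  shows "hausdorff_dim (exceptional_set \<Phi>) \<le> ennreal (1 / (1 + c))"
proof (rule hausdorff_dim_leI[of _ 2])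
  show "0 \<le> 1 / (1 + c)" "1 / (1 + c) < 2" using c by (auto simp: divide_simps)
  fix s assume "1 / (1 + c) < s"
  then have s: "0 < s" "1 < (2 + (c - 1)) * s" using c
    by (auto simp: divide_simps mult.commute intro: less_trans[of 0 "1 / (1 + c)"])
  show "hausdorff_measure s (exceptional_set \<Phi>) = 0"
  proof (rule large_quotients_measure_zero[OF s(1) _ s(2)])
    show "0 \<le> c - 1" using c by simp
    show orb: "0 < (gauss_map ^^ k) x" "x < 1" if "x \<in> exceptional_set \<Phi>" for x k
      by (rule exceptional_orbit[OF \<Phi> that])+
    fix K x assume K: "(1::real) < K" and x: "x \<in> exceptional_set \<Phi>"
    let ?p = "\<lambda>n. \<Prod>a\<leftarrow>digits n x. K * real a powr (c - 1)"
    let ?a = "\<lambda>n. partial_quotient n x"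
    define L where "L n = ln (?p n)" for n
    have dg: "set (digits n x) \<subseteq> {1..}" for n by (rule cf_expansion(1)[OF orb[OF x]])
    have a1: "1 \<le> ?a (Suc n)" for n using dg[of "Suc n"] by (simp add: digits_Suc)
    have pos: "0 < ?p n" for n
    proof -
      have "0 < (\<Prod>a\<leftarrow>w. K * real a powr (c - 1))" if "set w \<subseteq> {1..}" for w
        using that K by (induction w) auto
      from this[OF dg] show ?thesis .
    qed
    have LS: "L (Suc n) = L n + ln K + (c - 1) * ln (real (?a (Suc n)))" for n
    proof -
      have "?p (Suc n) = ?p n * (K * real (?a (Suc n)) powr (c - 1))" by (simp add: digits_Suc)
      then show ?thesis unfolding L_def using pos[of n] a1[of n] K by (simp add: ln_mult ln_powr)
    qed
    have L0: "0 \<le> L n" for n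
    proof (induction n)
      case 0 then show ?case by (simp add: L_def digits_def)
    next
      case (Suc n)
      have "0 \<le> (c - 1) * ln (real (?a (Suc n)))" using c a1[of n] by (intro mult_nonneg_nonneg) auto
      then show ?case using Suc K by (simp add: LS)
    qed
    have Lmono: "L n \<le> L (Suc n)" for n
    proof -
      have "0 \<le> (c - 1) * ln (real (?a (Suc n)))" using c a1[of n] by (intro mult_nonneg_nonneg) auto
      then show ?thesis using K by (simp add: LS)
    qed
    show "\<exists>\<^sub>\<infinity>n. ?p n \<le> real (?a (Suc n))"
    proof (rule ccontr)
      assume "\<not> (\<exists>\<^sub>\<infinity>n. ?p n \<le> real (?a (Suc n)))"
      then have "\<forall>\<^sub>\<infinity>n. \<not> ?p n \<le> real (?a (Suc n))" by (simp add: not_INFM)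
      then obtain m where "\<And>n. n \<ge> m \<Longrightarrow> real (?a (Suc n)) < ?p n" unfolding MOST_nat_le by (auto simp: not_le)
      then have m: "ln (real (?a (Suc n))) < L n" if "n \<ge> m" for n
        unfolding L_def using that a1[of n] pos[of n] by (subst ln_less_cancel_iff) auto
      \<comment> \<open>the recursion \<open>L (n + 1) \<le> c L n + ln K\<close>, solved up to a linear factor that also covers \<open>c = 1\<close>\<close>
      have grow: "L (m + j) \<le> c ^ (m + j) * (L m + real (m + j) * ln K)" for j
      proof (induction j)
        case 0
        have "1 * (L m + 0) \<le> c ^ m * (L m + real m * ln K)"
          using c K L0[of m] by (intro mult_mono add_mono one_le_power) auto
        then show ?case by simp
      next
        case (Suc j)
        let ?n = "m + j"
        have "L (Suc ?n) \<le> L ?n + ln K + (c - 1) * L ?n"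
          unfolding LS using c m[of ?n] by (intro add_left_mono mult_left_mono) auto
        also have "\<dots> = c * L ?n + ln K" by (simp add: algebra_simps)
        also have "\<dots> \<le> c * (c ^ ?n * (L m + real ?n * ln K)) + c ^ Suc ?n * ln K"
        proof (intro add_mono mult_left_mono Suc)
          have "1 * ln K \<le> c ^ Suc ?n * ln K" using c K by (intro mult_right_mono one_le_power) auto
          then show "ln K \<le> c ^ Suc ?n * ln K" by simp
        qed (use c in auto)
        also have "\<dots> = c ^ Suc ?n * (L m + real (Suc ?n) * ln K)" by (simp add: algebra_simps)
        finally show ?case by simp
      qed
      have io: "\<exists>\<^sub>\<infinity>n. real (?a (n + 1)) * real (?a n) \<ge> \<Phi> n" using x by (simp add: exceptional_set_def)
      have "\<forall>\<^sub>\<infinity>n. c ^ n * (2 * L m + real n * (2 * ln K)) < ln (\<Phi> n) \<and> m < n"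
        unfolding cofinite_eq_sequentially by (intro eventually_conj ev eventually_gt_at_top)
      from INFM_conjI[OF io this] obtain n where n: "real (?a (n + 1)) * real (?a n) \<ge> \<Phi> n"
        "c ^ n * (2 * L m + real n * (2 * ln K)) < ln (\<Phi> n)" "m < n" by (auto dest: INFM_EX)
      obtain k where k: "n = Suc k" "m \<le> k" using n(3) by (cases n) auto
      have "1 < \<Phi> n" using \<Phi> k by simp
      then have "ln (\<Phi> n) \<le> ln (real (?a (Suc n)) * real (?a n))" using n(1) by simp
      also have "\<dots> = ln (real (?a (Suc n))) + ln (real (?a n))" using a1[of n] a1[of k] k by (subst ln_mult) auto
      also have "\<dots> \<le> L n + L k" using m[of n] m[of k] k by (intro add_mono) auto
      also have "\<dots> \<le> 2 * L n" using Lmono[of k] k by simp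
      also have "\<dots> \<le> 2 * (c ^ n * (L m + real n * ln K))" using grow[of "n - m"] n(3) by simp
      also have "\<dots> = c ^ n * (2 * L m + real n * (2 * ln K))" by (simp add: algebra_simps)
      finally show False using n(2) by simp
    qed
  qed
qed


section \<open>Points with prescribed blocks of digits\<close>

definition prefix_word :: "(nat \<Rightarrow> nat list) \<Rightarrow> nat \<Rightarrow> nat list" where
  "prefix_word \<omega> n = concat (map \<omega> [0..<n])"

text \<open>
The continued fraction whose digits are the entries of the blocks \<open>\<omega> 0\<close>, \<open>\<omega> 1\<close>, \<open>\<dots>\<close> in this order. Blocks instead of single
digits serve as coordinates because words of several digits are to be chosen independently of each other.
\<close>
definition cf_limit :: "(nat \<Rightarrow> nat list) \<Rightarrow> real" where
  "cf_limit \<omega> = lim (\<lambda>n. cf_append (prefix_word \<omega> n) 0)"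

definition valid_blocks :: "(nat \<Rightarrow> nat list) \<Rightarrow> bool" where
  "valid_blocks \<omega> \<longleftrightarrow> (\<forall>i. \<omega> i \<noteq> [] \<and> set (\<omega> i) \<subseteq> {1..})"

lemma prefix_word_0 [simp]: "prefix_word \<omega> 0 = []" by (simp add: prefix_word_def)

lemma prefix_word_Suc: "prefix_word \<omega> (Suc n) = prefix_word \<omega> n @ \<omega> n"
  by (simp add: prefix_word_def)

lemma prefix_word_add: "prefix_word \<omega> (m + n) = prefix_word \<omega> m @ prefix_word (\<lambda>i. \<omega> (m + i)) n"
  by (induction n) (auto simp: prefix_word_Suc)

lemma prefix_word_cong: "(\<And>i. i < n \<Longrightarrow> \<omega> i = \<eta> i) \<Longrightarrow> prefix_word \<omega> n = prefix_word \<eta> n"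
  by (induction n) (auto simp: prefix_word_Suc)

lemma valid_prefix_word: "valid_blocks \<omega> \<Longrightarrow> set (prefix_word \<omega> n) \<subseteq> {1..}"
  by (auto simp: prefix_word_def valid_blocks_def)

lemma valid_blocks_shift: "valid_blocks \<omega> \<Longrightarrow> valid_blocks (\<lambda>i. \<omega> (m + i))"
  by (simp add: valid_blocks_def)

lemma length_prefix_word_ge: "valid_blocks \<omega> \<Longrightarrow> n \<le> length (prefix_word \<omega> n)"
proof (induction n)
  case (Suc n)
  have "0 < length (\<omega> n)" using Suc.prems by (simp add: valid_blocks_def)
  then show ?case using Suc.IH[OF Suc.prems] unfolding prefix_word_Suc length_append by linarith
qed simp

lemma cf_append_prefix_bounds:
  assumes "valid_blocks \<omega>"
  shows "0 \<le> cf_append (prefix_word \<omega> n) 0" "cf_append (prefix_word \<omega> n) 0 \<le> 1"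
  using cf_append_le_1[OF valid_prefix_word[OF assms], of 0 n] by (auto intro: cf_append_nonneg)

lemma cf_append_diff_le:
  assumes "set as \<subseteq> {1..}" "0 \<le> x" "0 \<le> y"
  shows "\<bar>cf_append as x - cf_append as y\<bar> \<le> \<bar>x - y\<bar> / cf_den as 0"
proof -
  have d: "1 \<le> cf_den as 0" "cf_den as 0 \<le> cf_den as x" "1 \<le> cf_den as y"
    using assms by (auto intro!: cf_den_ge_1 cf_den_ge_at_0)
  have "cf_den as 0 * 1 \<le> cf_den as x * cf_den as y" using d by (intro mult_mono) auto
  then have "\<bar>x - y\<bar> / (cf_den as x * cf_den as y) \<le> \<bar>x - y\<bar> / cf_den as 0"
    using d by (intro divide_left_mono mult_pos_pos) auto
  then show ?thesis using cf_append_diff[OF assms] by simp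
qed

lemma cf_den_prefix_ge: "valid_blocks \<omega> \<Longrightarrow> 2 ^ (n div 2) \<le> cf_den (prefix_word \<omega> n) 0"
proof -
  assume v: "valid_blocks \<omega>"
  have "(2::real) ^ (n div 2) \<le> 2 ^ (length (prefix_word \<omega> n) div 2)"
    using length_prefix_word_ge[OF v, of n] by (intro power_increasing div_le_mono) auto
  also have "\<dots> \<le> cf_den (prefix_word \<omega> n) 0" by (rule cf_den_ge_power[OF valid_prefix_word[OF v]])
  finally show ?thesis .
qed

lemma half_power_tendsto_0: "(\<lambda>n. 1 / 2 ^ (n div 2) :: real) \<longlonglongrightarrow> 0"
proof -
  have "(\<lambda>n. (1/2::real) ^ n) \<longlonglongrightarrow> 0" by (rule LIMSEQ_power_zero) simp
  moreover have "filterlim (\<lambda>n::nat. n div 2) sequentially sequentially"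
    unfolding filterlim_at_top
  proof
    fix Z show "\<forall>\<^sub>F n::nat in sequentially. Z \<le> n div 2"
      using eventually_ge_at_top[of "2 * Z"] by eventually_elim auto
  qed
  ultimately have "(\<lambda>n. (1/2::real) ^ (n div 2)) \<longlonglongrightarrow> 0" by (rule filterlim_compose)
  then show ?thesis by (simp add: power_one_over)
qed

lemma cf_limit_tendsto:
  assumes v: "valid_blocks \<omega>"
  shows "(\<lambda>n. cf_append (prefix_word \<omega> n) 0) \<longlonglongrightarrow> cf_limit \<omega>"
proof -
  let ?f = "\<lambda>n. cf_append (prefix_word \<omega> n) 0"
  have bnd: "\<bar>?f m - ?f n\<bar> \<le> 1 / 2 ^ (n div 2)" if "n \<le> m" for m n
  proof -
    have p: "prefix_word \<omega> m = prefix_word \<omega> n @ prefix_word (\<lambda>i. \<omega> (n + i)) (m - n)"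
      using prefix_word_add[of \<omega> n "m - n"] that by simp
    define y where "y = cf_append (prefix_word (\<lambda>i. \<omega> (n + i)) (m - n)) 0"
    have y: "0 \<le> y" "y \<le> 1" unfolding y_def by (rule cf_append_prefix_bounds[OF valid_blocks_shift[OF v]])+
    have "\<bar>?f m - ?f n\<bar> \<le> \<bar>y - 0\<bar> / cf_den (prefix_word \<omega> n) 0"
      unfolding p cf_append_append y_def[symmetric] using valid_prefix_word[OF v] y by (intro cf_append_diff_le) auto
    also have "\<dots> \<le> 1 / 2 ^ (n div 2)"
      using y cf_den_prefix_ge[OF v, of n] by (intro frac_le) auto
    finally show ?thesis .
  qed
  have "Cauchy ?f"
  proof (rule metric_CauchyI)
    fix e :: real assume e: "0 < e"
    have "\<forall>\<^sub>F n in sequentially. 1 / 2 ^ (n div 2) < e / 2"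
      using order_tendstoD(2)[OF half_power_tendsto_0, of "e / 2"] e by simp
    then obtain M where M: "1 / 2 ^ (M div 2) < e / 2" unfolding eventually_sequentially by blast
    show "\<exists>M. \<forall>m\<ge>M. \<forall>n\<ge>M. dist (?f m) (?f n) < e"
    proof (intro exI[of _ M] allI impI)
      fix m n assume "M \<le> m" "M \<le> n"
      then have "\<bar>?f m - ?f M\<bar> \<le> 1 / 2 ^ (M div 2)" "\<bar>?f n - ?f M\<bar> \<le> 1 / 2 ^ (M div 2)" by (auto intro: bnd)
      then show "dist (?f m) (?f n) < e" using M unfolding dist_real_def by linarith
    qed
  qed
  then show ?thesis unfolding cf_limit_def by (simp add: Cauchy_convergent_iff convergent_LIMSEQ_iff)
qed

lemma cf_limit_bounds:
  assumes "valid_blocks \<omega>"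
  shows "0 \<le> cf_limit \<omega>" "cf_limit \<omega> \<le> 1"
  using LIMSEQ_le_const[OF cf_limit_tendsto[OF assms], of 0] LIMSEQ_le_const2[OF cf_limit_tendsto[OF assms], of 1]
    cf_append_prefix_bounds[OF assms] by auto

text \<open>
This identity reduces all questions about \<open>cf_limit\<close> to finite continued fractions with a tail in the open interval \<open>(0, 1)\<close>.
\<close>
lemma cf_limit_split:
  assumes v: "valid_blocks \<omega>"
  shows "cf_limit \<omega> = cf_append (prefix_word \<omega> n) (cf_limit (\<lambda>i. \<omega> (n + i)))"
proof -
  note v' = valid_blocks_shift[OF v, of n]
  let ?g = "\<lambda>m. cf_append (prefix_word (\<lambda>i. \<omega> (n + i)) m) 0"
  have "(\<lambda>m. cf_append (prefix_word \<omega> (m + n)) 0) \<longlonglongrightarrow> cf_limit \<omega>"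
    by (rule LIMSEQ_ignore_initial_segment[OF cf_limit_tendsto[OF v]])
  then have 1: "(\<lambda>m. cf_append (prefix_word \<omega> n) (?g m)) \<longlonglongrightarrow> cf_limit \<omega>"
    by (simp add: add.commute[of _ n] prefix_word_add cf_append_append)
  have "(\<lambda>m. \<bar>?g m - cf_limit (\<lambda>i. \<omega> (n + i))\<bar>) \<longlonglongrightarrow> 0"
    using tendsto_rabs_zero[OF LIM_zero[OF cf_limit_tendsto[OF v']]] .
  then have "(\<lambda>m. cf_append (prefix_word \<omega> n) (?g m) - cf_append (prefix_word \<omega> n) (cf_limit (\<lambda>i. \<omega> (n + i)))) \<longlonglongrightarrow> 0"
  proof (rule Lim_null_comparison[rotated], intro always_eventually allI)
    fix m
    have "1 \<le> cf_den (prefix_word \<omega> n) 0" by (rule cf_den_ge_1[OF valid_prefix_word[OF v]]) simp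
    then have "\<bar>?g m - cf_limit (\<lambda>i. \<omega> (n + i))\<bar> / cf_den (prefix_word \<omega> n) 0 \<le> \<bar>?g m - cf_limit (\<lambda>i. \<omega> (n + i))\<bar> / 1"
      by (intro divide_left_mono) auto
    with cf_append_diff_le[OF valid_prefix_word[OF v] cf_append_prefix_bounds(1)[OF v'] cf_limit_bounds(1)[OF v'], of n m]
    show "norm (cf_append (prefix_word \<omega> n) (?g m) - cf_append (prefix_word \<omega> n) (cf_limit (\<lambda>i. \<omega> (n + i))))
       \<le> \<bar>?g m - cf_limit (\<lambda>i. \<omega> (n + i))\<bar>" by simp
  qed
  then have "(\<lambda>m. cf_append (prefix_word \<omega> n) (?g m)) \<longlonglongrightarrow> cf_append (prefix_word \<omega> n) (cf_limit (\<lambda>i. \<omega> (n + i)))"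
    by (rule LIM_zero_cancel)
  with 1 show ?thesis by (rule LIMSEQ_unique)
qed

lemma cf_limit_open_bounds:
  assumes v: "valid_blocks \<omega>"
  shows "0 < cf_limit \<omega>" "cf_limit \<omega> < 1"
proof -
  have pos: "0 < cf_limit \<eta>" if v: "valid_blocks \<eta>" for \<eta>
  proof -
    have "prefix_word \<eta> 1 \<noteq> []" using v by (simp add: prefix_word_def valid_blocks_def)
    then show ?thesis unfolding cf_limit_split[OF v, of 1]
      by (intro cf_append_pos' valid_prefix_word v cf_limit_bounds valid_blocks_shift)
  qed
  show "0 < cf_limit \<omega>" by (rule pos[OF v])
  obtain a as where w: "prefix_word \<omega> 1 = a # as" using v
    by (cases "prefix_word \<omega> 1") (auto simp: prefix_word_def valid_blocks_def)
  have aas: "set (a # as) \<subseteq> {1..}" using valid_prefix_word[OF v, of 1] w by simp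
  define z where "z = cf_append as (cf_limit (\<lambda>i. \<omega> (1 + i)))"
  have "0 < z" unfolding z_def using aas pos[OF valid_blocks_shift[OF v, of 1]] by (intro cf_append_pos) auto
  moreover have "1 \<le> real a" using aas by simp
  moreover have "cf_limit \<omega> = 1 / (real a + z)" using cf_limit_split[OF v, of 1] w by (simp add: z_def)
  ultimately show "cf_limit \<omega> < 1" by simp
qed

lemma cf_limit_shift_open: "valid_blocks \<omega> \<Longrightarrow> 0 < cf_limit (\<lambda>i. \<omega> (n + i)) \<and> cf_limit (\<lambda>i. \<omega> (n + i)) < 1"
  using cf_limit_open_bounds[OF valid_blocks_shift] by blast

lemma partial_quotient_cf_limit:
  assumes v: "valid_blocks \<omega>" and pre: "set pre \<subseteq> {1..}" and i: "i < length (pre @ prefix_word \<omega> n)"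
  shows "partial_quotient (Suc i) (cf_append pre (cf_limit \<omega>)) = (pre @ prefix_word \<omega> n) ! i"
proof -
  have "cf_append pre (cf_limit \<omega>) = cf_append (pre @ prefix_word \<omega> n) (cf_limit (\<lambda>i. \<omega> (n + i)))"
    by (simp add: cf_append_append cf_limit_split[OF v, of n, symmetric])
  then show ?thesis using valid_prefix_word[OF v, of n] cf_limit_shift_open[OF v, of n] pre i
    by (simp add: partial_quotient_cf_append)
qed

lemma length_prefix_word:
  "(\<And>i. length (\<omega> i) = L) \<Longrightarrow> length (prefix_word \<omega> n) = n * L"
  by (induction n) (auto simp: prefix_word_Suc)

lemma partial_quotient_block:
  assumes v: "valid_blocks \<omega>" and pre: "set pre \<subseteq> {1..}" and len: "\<And>i. length (\<omega> i) = L" and i: "i < L"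
  shows "partial_quotient (Suc (length pre + k * L + i)) (cf_append pre (cf_limit \<omega>)) = \<omega> k ! i"
proof -
  have lp: "length (prefix_word \<omega> k) = k * L" by (rule length_prefix_word[OF len])
  have "partial_quotient (Suc (length pre + k * L + i)) (cf_append pre (cf_limit \<omega>))
     = (pre @ prefix_word \<omega> (Suc k)) ! (length pre + k * L + i)"
    using i by (intro partial_quotient_cf_limit[OF v pre]) (simp add: length_prefix_word[OF len])
  also have "\<dots> = \<omega> k ! i" using lp len i by (simp add: prefix_word_Suc nth_append)
  finally show ?thesis .
qed

lemma cf_limit_block:
  assumes v: "valid_blocks \<omega>"
  shows "cf_append pre (cf_limit \<omega>) = cf_append ((pre @ prefix_word \<omega> k) @ \<omega> k) (cf_limit (\<lambda>i. \<omega> (Suc k + i)))"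
  using cf_limit_split[OF v, of "Suc k"] by (simp add: prefix_word_Suc cf_append_append)


section \<open>Cantor sets of uniformly distributed digits\<close>

text \<open>
A set of integers of diameter at most \<open>\<Delta>\<close> with at least two elements has at most \<open>2 \<Delta>\<close> elements. Its proportion \<open>y\<close> in \<open>{N..<2 N}\<close>
is at most 1, so \<open>y \<le> y\<^sup>s\<close>.
\<close>
lemma uniform_mass_le_powr:
  fixes V :: "nat set" and N :: nat and \<Delta> s :: real
  assumes V: "V \<subseteq> {N..<2 * N}" and v: "v1 \<in> V" "v2 \<in> V" "v1 \<noteq> v2" and s: "0 \<le> s" "s \<le> 1"
    and \<Delta>: "\<And>v v'. v \<in> V \<Longrightarrow> v' \<in> V \<Longrightarrow> \<bar>real v - real v'\<bar> \<le> \<Delta>"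
  shows "real (card V) / real N \<le> (2 * \<Delta> / real N) powr s"
proof -
  have fin: "finite V" using V by (rule finite_subset) simp
  have ne: "V \<noteq> {}" using v by auto
  have N: "0 < N" using V v(1) by (cases "N = 0") auto
  have "card V \<le> card {N..<2 * N}" using V by (intro card_mono) auto
  then have cN: "card V \<le> N" by simp
  have "V \<subseteq> {Min V..Max V}" using fin by auto
  then have "card V \<le> card {Min V..Max V}" by (intro card_mono) auto
  then have "real (card V) \<le> real (Max V) - real (Min V) + 1"
    using Min_le[OF fin Max_in[OF fin ne]] by (simp add: of_nat_diff)
  also have "\<dots> \<le> \<Delta> + 1" using \<Delta>[OF Max_in[OF fin ne] Min_in[OF fin ne]] by linarith
  also have "1 \<le> \<bar>real v1 - real v2\<bar>" using v(3) by (cases "v1 < v2") auto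
  then have "1 \<le> \<Delta>" using \<Delta>[OF v(1,2)] by linarith
  finally have c: "real (card V) \<le> 2 * \<Delta>" using \<open>1 \<le> \<Delta>\<close> by linarith
  have "real (card V) / real N = (real (card V) / real N) powr 1"
    using fin ne N by (simp add: card_gt_0_iff)
  also have "\<dots> \<le> (real (card V) / real N) powr s"
    using s cN N by (intro powr_mono') (auto simp: divide_simps)
  also have "\<dots> \<le> (2 * \<Delta> / real N) powr s"
    using s c N by (intro powr_mono2 divide_right_mono) auto
  finally show ?thesis .
qed

lemma cf_append_Cons_le_half:
  assumes "2 \<le> b" "0 \<le> z"
  shows "cf_append (b # bs) z \<le> 1 / 2"
proof -
  have "2 \<le> real b + cf_append bs z" using assms cf_append_nonneg[of z bs] by simp
  then show ?thesis by (simp add: divide_simps)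
qed

text \<open>
A tail can be close to 1 only if it begins with 1 followed by a large digit. This supplies the gap \<open>\<kappa>\<close> of
\<open>cf_append_separation\<close>.
\<close>
lemma cf_append_Cons_Cons_le:
  assumes "1 \<le> x" "1 \<le> y" "y \<le> M" "set zs \<subseteq> {1..}" "0 \<le> z" "z \<le> 1"
  shows "cf_append (x # y # zs) z \<le> 1 - 1 / (real M + 2)"
proof -
  define r where "r = cf_append zs z"
  have r: "0 \<le> r" "r \<le> 1" unfolding r_def using cf_append_nonneg[OF assms(5)] cf_append_le_1[OF assms(4-6)] by auto
  have x: "1 \<le> real x" and y: "1 \<le> real y" "real y \<le> real M" using assms by auto
  have "1 / (real M + 1) \<le> 1 / (real y + r)" using y r by (intro divide_left_mono) auto
  then have "1 + 1 / (real M + 1) \<le> real x + 1 / (real y + r)" using x by linarith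
  then have "1 / (real x + 1 / (real y + r)) \<le> 1 / (1 + 1 / (real M + 1))"
  proof (intro divide_left_mono)
    have "0 < 1 + 1 / (real M + 1)" by (simp add: add_pos_pos)
    then show "0 < (real x + 1 / (real y + r)) * (1 + 1 / (real M + 1))"
      using \<open>1 + 1 / (real M + 1) \<le> real x + 1 / (real y + r)\<close> by (intro mult_pos_pos) linarith+
  qed auto
  also have "\<dots> = 1 - 1 / (real M + 2)"
  proof -
    have "0 < real M + 1" by simp
    then show ?thesis by (simp add: field_simps)
  qed
  finally show ?thesis by (simp add: r_def)
qed

text \<open>
The digits are chosen independently and uniformly from \<open>{N k..<2 N k}\<close>. Given a prefix with continuant at most \<open>Q\<close>, a set of
diameter \<open>r\<close> meets a proportion \<open>O(N k Q\<^sup>2 r)\<close> of the next cylinders, and also a proportion of at most 1. Interpolating between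
these bounds with the exponent \<open>s\<close> leads to the hypothesis \<open>bound\<close>.
\<close>
theorem uniform_digit_set_dim:
  fixes N :: "nat \<Rightarrow> nat"
  defines "E \<equiv> (\<lambda>d. cf_limit (\<lambda>i. [d i])) ` (Pi UNIV (\<lambda>k. {N k..<2 * N k}))"
  assumes N: "\<And>k. 2 \<le> N k" and s: "0 < s" "s \<le> 1" and C: "0 < C"
    and bound: "\<And>k. (\<Prod>i<k. 1 / real (N i)) * (\<Prod>i<k. 2 * real (N i)) powr (2 * s) * real (N k) powr s \<le> C"
  shows "ennreal s \<le> hausdorff_dim E"
  unfolding E_def
proof (rule mass_distribution_principle[where f = "\<lambda>k _. 1 / real (N k)" and C = "C * 64 powr s"])
  fix k
  show "finite {N k..<2 * N k}" by simp
  show "(\<Sum>v\<in>{N k..<2 * N k}. 1 / real (N k)) = 1" using N[of k] by simp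
  show "0 < s" "0 < C * 64 powr s" using s C by auto
next
  fix d :: "nat \<Rightarrow> nat" and e :: real assume e: "0 < e"
  have "(\<lambda>n. (1/2::real) ^ n) \<longlonglongrightarrow> 0" by (rule LIMSEQ_power_zero) simp
  from order_tendstoD(2)[OF this e] obtain k where k: "(1/2::real) ^ k < e" unfolding eventually_sequentially by blast
  have "(\<Prod>i<k. 1 / real (N i)) \<le> (\<Prod>i<k. 1/2)"
  proof (intro prod_mono conjI)
    fix i show "1 / real (N i) \<le> 1/2" using N[of i] by (simp add: divide_simps)
  qed simp
  then show "\<exists>k. (\<Prod>i<k. 1 / real (N i)) < e" using k by (intro exI[of _ k]) simp
next
  fix d k V r v1 v2
  assume d: "d \<in> Pi UNIV (\<lambda>k. {N k..<2 * N k})" and V: "V \<subseteq> {N k..<2 * N k}"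
    and v: "v1 \<in> V" "v2 \<in> V" "v1 \<noteq> v2"
    and close: "\<And>v v'. v \<in> V \<Longrightarrow> v' \<in> V \<Longrightarrow> \<exists>\<eta>\<in>Pi UNIV (\<lambda>k. {N k..<2 * N k}). \<exists>\<eta>'\<in>Pi UNIV (\<lambda>k. {N k..<2 * N k}).
          (\<forall>i<k. \<eta> i = d i) \<and> (\<forall>i<k. \<eta>' i = d i) \<and> \<eta> k = v \<and> \<eta>' k = v' \<and>
          dist (cf_limit (\<lambda>i. [\<eta> i])) (cf_limit (\<lambda>i. [\<eta>' i])) \<le> r"
  define Q where "Q = (\<Prod>i<k. 2 * real (N i))"
  define m where "m = (\<Prod>i<k. 1 / real (N i))"
  have Q: "0 < Q" unfolding Q_def using N by (intro prod_pos) (auto simp: less_le_trans[OF _ N] intro: Suc_le_lessD order_trans[OF _ N])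
  have m: "0 \<le> m" unfolding m_def by (intro prod_nonneg) auto
  have Nk: "2 \<le> real (N k)" using N[of k] by simp
  have valid: "valid_blocks (\<lambda>i. [\<eta> i])" if "\<eta> \<in> Pi UNIV (\<lambda>k. {N k..<2 * N k})" for \<eta>
    unfolding valid_blocks_def
  proof
    fix i
    have "N i \<le> \<eta> i" using that by (auto simp: Pi_iff)
    then show "[\<eta> i] \<noteq> [] \<and> set [\<eta> i] \<subseteq> {1..}" using N[of i] by auto
  qed
  have sep: "\<bar>real v - real v'\<bar> \<le> 32 * (real (N k))\<^sup>2 * Q\<^sup>2 * r" if vv: "v \<in> V" "v' \<in> V" for v v'
  proof (cases "v = v'")
    case True
    obtain \<eta> \<eta>' where "dist (cf_limit (\<lambda>i. [\<eta> i])) (cf_limit (\<lambda>i. [\<eta>' i])) \<le> r" using close[OF vv] by blast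
    then have "0 \<le> r" by (meson order_trans zero_le_dist)
    then show ?thesis using True by simp
  next
    case False
    obtain \<eta> \<eta>' where \<eta>: "\<eta> \<in> Pi UNIV (\<lambda>k. {N k..<2 * N k})" "\<eta>' \<in> Pi UNIV (\<lambda>k. {N k..<2 * N k})"
      "\<And>i. i < k \<Longrightarrow> \<eta> i = d i" "\<And>i. i < k \<Longrightarrow> \<eta>' i = d i" "\<eta> k = v" "\<eta>' k = v'"
      and dist: "dist (cf_limit (\<lambda>i. [\<eta> i])) (cf_limit (\<lambda>i. [\<eta>' i])) \<le> r"
      using close[OF vv] by blast
    define c where "c = prefix_word (\<lambda>i. [d i]) k"
    have cset: "set c \<subseteq> {1..}" unfolding c_def by (rule valid_prefix_word[OF valid[OF d]])
    have c: "prefix_word (\<lambda>i. [\<eta> i]) k = c" "prefix_word (\<lambda>i. [\<eta>' i]) k = c"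
      unfolding c_def using \<eta>(3,4) by (auto intro!: prefix_word_cong)
    have cQ: "cf_den c 0 \<le> Q"
    proof -
      have "cf_den c 0 \<le> (\<Prod>a\<leftarrow>c. real a + 1)" by (rule cf_den_le_prod[OF cset])
      also have "\<dots> = (\<Prod>i<k. real (d i) + 1)" unfolding c_def
        by (induction k) (auto simp: prefix_word_Suc)
      also have "\<dots> \<le> Q" unfolding Q_def
      proof (intro prod_mono conjI)
        fix i have "d i < 2 * N i" using d by (auto simp: Pi_iff)
        then have "d i + 1 \<le> 2 * N i" by simp
        then have "real (d i + 1) \<le> real (2 * N i)" by (simp only: of_nat_le_iff)
        then show "real (d i) + 1 \<le> 2 * real (N i)" by simp
      qed simp
      finally show ?thesis .
    qed
    have tail: "0 \<le> cf_limit (\<lambda>i. [\<xi> (Suc k + i)]) \<and> cf_limit (\<lambda>i. [\<xi> (Suc k + i)]) \<le> 1 - 1/2"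
      if \<xi>: "\<xi> \<in> Pi UNIV (\<lambda>k. {N k..<2 * N k})" for \<xi>
    proof -
      note val = valid_blocks_shift[OF valid[OF \<xi>], of "Suc k"]
      have "cf_limit (\<lambda>i. [\<xi> (Suc k + i)]) = cf_append [\<xi> (Suc k)] (cf_limit (\<lambda>i. [\<xi> (Suc k + (1 + i))]))"
        using cf_limit_split[OF val, of 1] by (simp add: prefix_word_def)
      also have "\<dots> \<le> 1/2"
      proof (rule cf_append_Cons_le_half)
        have "N (Suc k) \<le> \<xi> (Suc k)" using \<xi> by (auto simp: Pi_iff)
        then show "2 \<le> \<xi> (Suc k)" using N[of "Suc k"] by simp
        show "0 \<le> cf_limit (\<lambda>i. [\<xi> (Suc k + (1 + i))])"
          by (rule cf_limit_bounds(1)[OF valid_blocks_shift[OF val, of 1]])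
      qed
      finally show ?thesis using cf_limit_bounds(1)[OF val] by simp
    qed
    have rep: "cf_limit (\<lambda>i. [\<xi> i]) = cf_append (prefix_word (\<lambda>i. [\<xi> i]) k @ [\<xi> k]) (cf_limit (\<lambda>i. [\<xi> (Suc k + i)]))"
      if "\<xi> \<in> Pi UNIV (\<lambda>k. {N k..<2 * N k})" for \<xi>
      using cf_limit_block[OF valid[OF that], of "[]" k] by simp
    have vN: "1 \<le> v" "1 \<le> v'" "real v + 1 \<le> 2 * real (N k)" "real v' + 1 \<le> 2 * real (N k)"
    proof -
      have "N k \<le> v" "v + 1 \<le> 2 * N k" "N k \<le> v'" "v' + 1 \<le> 2 * N k" using V vv by auto
      then have "real (v + 1) \<le> real (2 * N k)" "real (v' + 1) \<le> real (2 * N k)" "N k \<le> v" "N k \<le> v'"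
        by (auto simp only: of_nat_le_iff)
      then show "1 \<le> v" "1 \<le> v'" "real v + 1 \<le> 2 * real (N k)" "real v' + 1 \<le> 2 * real (N k)" using N[of k] by auto
    qed
    have q: "1 \<le> cf_den c 0" by (rule cf_den_ge_1[OF cset]) simp
    have "1/2 * \<bar>real v - real v'\<bar> / ((2 * real (N k)) * (2 * real (N k))) / (4 * Q\<^sup>2)
       \<le> 1/2 * \<bar>real v - real v'\<bar> / ((real v + 1) * (real v' + 1)) / (4 * (cf_den c 0)\<^sup>2)"
      using vN cQ q by (intro frac_le mult_mono power_mono divide_nonneg_nonneg mult_pos_pos) auto
    also have "\<dots> \<le> \<bar>cf_append (c @ [v]) (cf_limit (\<lambda>i. [\<eta> (Suc k + i)])) - cf_append (c @ [v']) (cf_limit (\<lambda>i. [\<eta>' (Suc k + i)]))\<bar>"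
      using tail[OF \<eta>(1)] tail[OF \<eta>(2)] by (intro cf_append_separation[OF cset vN(1,2) False]) auto
    also have "\<dots> \<le> r" using dist unfolding rep[OF \<eta>(1)] rep[OF \<eta>(2)] c \<eta>(5,6) dist_real_def by simp
    finally show ?thesis using Nk Q by (simp add: field_simps power2_eq_square)
  qed
  have "real (card V) / real (N k) \<le> (2 * (32 * (real (N k))\<^sup>2 * Q\<^sup>2 * r) / real (N k)) powr s"
    using V v s sep by (intro uniform_mass_le_powr) auto
  also have "2 * (32 * (real (N k))\<^sup>2 * Q\<^sup>2 * r) / real (N k) = 64 * Q powr 2 * real (N k) * r"
    using Nk Q by (simp add: power2_eq_square powr_numeral)
  also have "\<dots> powr s = 64 powr s * Q powr (2 * s) * real (N k) powr s * r powr s"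
    by (simp only: powr_mult powr_powr)
  finally have "m * (real (card V) / real (N k)) \<le> m * (64 powr s * Q powr (2 * s) * real (N k) powr s * r powr s)"
    using m by (rule mult_left_mono)
  also have "\<dots> = (m * Q powr (2 * s) * real (N k) powr s) * (64 powr s * r powr s)" by (simp add: mult_ac)
  also have "\<dots> \<le> C * (64 powr s * r powr s)"
    using bound[of k] unfolding m_def Q_def by (intro mult_right_mono) auto
  finally show "(\<Prod>i<k. 1 / real (N i)) * (\<Sum>v\<in>V. 1 / real (N k)) \<le> C * 64 powr s * r powr s"
    by (simp add: m_def mult_ac)
qed simp

text \<open>
Let \<open>u (k + 1) = min (ln \<Phi>(k + 1)) (\<beta> u k)\<close>, kept above a large constant, and let the digit after the first \<open>k\<close> ones be comparable with
\<open>exp (u k)\<close>. Thus \<open>u\<close> stays below \<open>ln \<Phi>\<close>, but it equals \<open>ln \<Phi>\<close> infinitely often, because otherwise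
\<open>ln \<Phi>\<close> would grow at least like \<open>\<beta>\<^sup>n\<close>. Summing \<open>u (k + 1) \<le> \<beta> u k\<close> shows that \<open>u k\<close> is at most \<open>\<beta> - 1\<close> times the sum of its predecessors, up to
a constant, which is the condition of \<open>uniform_digit_set_dim\<close> for \<open>s < 1 / (1 + \<beta>)\<close>.
\<close>
theorem exceptional_dim_ge_growth:
  fixes \<Phi> :: "nat \<Rightarrow> real"
  assumes \<Phi>: "\<forall>n\<ge>1. \<Phi> n > 1" and lim: "filterlim \<Phi> at_top sequentially"
    and \<beta>: "1 < \<beta>" and s: "0 < s" "s * (1 + \<beta>) < 1"
    and freq: "\<And>c. 0 < c \<Longrightarrow> \<exists>\<^sub>\<infinity>n. ln (\<Phi> n) < c * \<beta> ^ n"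
  shows "ennreal s \<le> hausdorff_dim (exceptional_set \<Phi>)"
proof -
  \<comment> \<open>the first bound makes the gain per digit exceed the constant 4 lost per digit, the second one yields digits of at least 4\<close>
  define L where "L = max (ln 4 / (1 - s * (1 + \<beta>))) (ln 8)"
  have L8: "ln 8 \<le> L" by (simp add: L_def)
  have L0: "0 < L" using L8 ln_gt_zero[of "8::real"] by linarith
  have L4: "ln 4 \<le> L * (1 - s * (1 + \<beta>))"
  proof -
    have "ln 4 / (1 - s * (1 + \<beta>)) \<le> L" by (simp add: L_def)
    then show ?thesis using s(2) by (simp add: divide_le_eq)
  qed
  define \<Lambda> where "\<Lambda> n = ln (\<Phi> n)" for n
  define u where "u = rec_nat L (\<lambda>k x. max L (min (\<Lambda> (Suc k)) (\<beta> * x)))"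
  have u0: "u 0 = L" and uS: "u (Suc k) = max L (min (\<Lambda> (Suc k)) (\<beta> * u k))" for k
    by (simp_all add: u_def)
  have uL: "L \<le> u k" for k by (cases k) (auto simp: u0 uS)
  have ugrow: "u (Suc k) \<le> \<beta> * u k" for k
  proof -
    have "1 * L \<le> \<beta> * u k" using \<beta> uL[of k] L0 by (intro mult_mono) auto
    then show ?thesis by (simp add: uS)
  qed
  have e8: "8 \<le> exp (u k)" for k
  proof -
    have "exp (ln 8) \<le> exp (u k)" using L8 uL[of k] by (simp only: exp_le_cancel_iff)
    then show ?thesis by simp
  qed
  \<comment> \<open>all digits in \<open>{N k..<2 N k}\<close> are below \<open>exp (u k)\<close>, and \<open>4 N k \<ge> exp (u k)\<close>\<close>
  define N where "N k = nat \<lfloor>exp (u k) / 2\<rfloor>" for k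
  have N4: "4 \<le> N k" for k
  proof -
    have "real 4 \<le> exp (u k) / 2" using e8[of k] by simp
    then show ?thesis unfolding N_def by (rule le_nat_floor)
  qed
  have Nup: "2 * real (N k) \<le> exp (u k)" for k
  proof -
    have "real (N k) = of_int \<lfloor>exp (u k) / 2\<rfloor>" by (simp add: N_def)
    then show ?thesis using of_int_floor_le[of "exp (u k) / 2"] by simp
  qed
  have Nlo: "exp (u k) \<le> 4 * real (N k)" for k
  proof -
    have "real (N k) = of_int \<lfloor>exp (u k) / 2\<rfloor>" by (simp add: N_def)
    then show ?thesis using e8[of k] floor_correct[of "exp (u k) / 2"] by linarith
  qed
  let ?A = "Pi UNIV (\<lambda>k. {N k..<2 * N k})"
  define U where "U k = (\<Sum>i<k. u i)" for k
  have Uu: "u k \<le> (\<beta> - 1) * U k + L" for k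
  proof (induction k)
    case 0 show ?case by (simp add: U_def u0)
  next
    case (Suc k)
    have "u (Suc k) \<le> (\<beta> - 1) * u k + u k" using ugrow[of k] by (simp add: algebra_simps)
    also have "\<dots> \<le> (\<beta> - 1) * u k + ((\<beta> - 1) * U k + L)" using Suc by simp
    also have "\<dots> = (\<beta> - 1) * U (Suc k) + L" by (simp add: U_def algebra_simps)
    finally show ?case .
  qed
  have UL: "real k * L \<le> U k" for k
    unfolding U_def using sum_bounded_below[of "{..<k}" L u] uL by simp
  have bound: "(\<Prod>i<k. 1 / real (N i)) * (\<Prod>i<k. 2 * real (N i)) powr (2 * s) * real (N k) powr s \<le> exp (s * L)" for k
  proof -
    have "(\<Prod>i<k. 1 / real (N i)) \<le> (\<Prod>i<k. 4 / exp (u i))"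
    proof (intro prod_mono conjI)
      fix i
      have "0 < real (N i)" using N4[of i] by simp
      then show "1 / real (N i) \<le> 4 / exp (u i)" using Nlo[of i] by (simp add: field_simps)
    qed simp
    also have "\<dots> = exp (real k * ln 4 - U k)"
      by (simp add: prod_dividef U_def exp_diff exp_sum exp_of_nat_mult)
    finally have 1: "(\<Prod>i<k. 1 / real (N i)) \<le> exp (real k * ln 4 - U k)" .
    have "(\<Prod>i<k. 2 * real (N i)) \<le> (\<Prod>i<k. exp (u i))" by (intro prod_mono conjI Nup) auto
    also have "\<dots> = exp (U k)" by (simp add: U_def exp_sum)
    finally have "(\<Prod>i<k. 2 * real (N i)) powr (2 * s) \<le> exp (U k) powr (2 * s)"
      using s by (intro powr_mono2 prod_nonneg) auto
    then have 2: "(\<Prod>i<k. 2 * real (N i)) powr (2 * s) \<le> exp (2 * s * U k)" by (simp add: powr_def)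
    have "real (N k) powr s \<le> exp (u k) powr s" using Nup[of k] s by (intro powr_mono2) auto
    then have 3: "real (N k) powr s \<le> exp (s * u k)" by (simp add: powr_def)
    have "(\<Prod>i<k. 1 / real (N i)) * (\<Prod>i<k. 2 * real (N i)) powr (2 * s) * real (N k) powr s
       \<le> exp (real k * ln 4 - U k) * exp (2 * s * U k) * exp (s * u k)"
      by (intro mult_mono 1 2 3 mult_nonneg_nonneg prod_nonneg) auto
    also have "\<dots> = exp (real k * ln 4 - U k + 2 * s * U k + s * u k)" by (simp only: exp_add)
    also have "\<dots> \<le> exp (s * L)"
    proof -
      have "s * u k \<le> s * ((\<beta> - 1) * U k + L)" using Uu[of k] s by (intro mult_left_mono) auto
      moreover have "real k * ln 4 \<le> real k * (L * (1 - s * (1 + \<beta>)))" using L4 by (intro mult_left_mono) auto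
      moreover have "real k * L * (1 - s * (1 + \<beta>)) \<le> U k * (1 - s * (1 + \<beta>))" using UL[of k] s by (intro mult_right_mono) auto
      ultimately show ?thesis by (simp add: algebra_simps)
    qed
    finally show ?thesis .
  qed
  have "s * 1 \<le> s * (1 + \<beta>)" using s \<beta> by (intro mult_left_mono) auto
  then have s1: "s \<le> 1" using s(2) unfolding mult_1_right by linarith
  have "ennreal s \<le> hausdorff_dim ((\<lambda>d. cf_limit (\<lambda>i. [d i])) ` ?A)"
    by (rule uniform_digit_set_dim[OF _ s(1) s1 exp_gt_zero bound]) (use N4 in \<open>auto intro: order_trans[of 2 4]\<close>)
  also have "\<dots> \<le> hausdorff_dim (exceptional_set \<Phi>)"
  proof (rule hausdorff_dim_mono, clarify)
    fix d assume d: "d \<in> ?A"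
    define x where "x = cf_limit (\<lambda>i. [d i])"
    have dN: "N i \<le> d i" "d i < 2 * N i" for i using d by (auto simp: Pi_iff)
    have valid: "valid_blocks (\<lambda>i. [d i])"
      unfolding valid_blocks_def
    proof
      fix i show "[d i] \<noteq> [] \<and> set [d i] \<subseteq> {1..}" using dN[of i] N4[of i] by auto
    qed
    have pq: "partial_quotient (Suc n) x = d n" for n
      using partial_quotient_block[OF valid, of "[]" 1 0 n] by (simp add: x_def)
    have "\<forall>\<^sub>F n in sequentially. exp L < \<Phi> n" using lim by (simp add: filterlim_at_top_dense)
    then obtain m where m: "\<And>n. m \<le> n \<Longrightarrow> exp L < \<Phi> n" unfolding eventually_sequentially by blast
    have \<Lambda>L: "L < \<Lambda> n" "exp (\<Lambda> n) = \<Phi> n" if "m \<le> n" for n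
    proof -
      have p: "0 < \<Phi> n" using m[OF that] by (meson exp_gt_zero less_trans)
      show "exp (\<Lambda> n) = \<Phi> n" using p by (simp add: \<Lambda>_def)
      have "exp L < exp (\<Lambda> n)" using m[OF that] p by (simp add: \<Lambda>_def)
      then show "L < \<Lambda> n" by simp
    qed
    have io: "\<exists>\<^sub>\<infinity>n. u n = \<Lambda> n"
    proof (rule ccontr)
      assume "\<not> (\<exists>\<^sub>\<infinity>n. u n = \<Lambda> n)"
      then have "\<forall>\<^sub>\<infinity>n. u n \<noteq> \<Lambda> n" by (simp add: not_INFM)
      then obtain m' where m': "\<And>n. n \<ge> m' \<Longrightarrow> u n \<noteq> \<Lambda> n" unfolding MOST_nat_le by blast
      define M where "M = max m m'"
      have st: "u (Suc n) = \<beta> * u n \<and> \<beta> * u n < \<Lambda> (Suc n)" if "M \<le> n" for n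
      proof -
        have ne: "u (Suc n) \<noteq> \<Lambda> (Suc n)" using m' that by (simp add: M_def)
        have "L < \<Lambda> (Suc n)" using \<Lambda>L(1) that by (simp add: M_def)
        moreover have "L \<le> \<beta> * u n" using ugrow[of n] uL[of "Suc n"] by linarith
        ultimately show ?thesis using ne by (auto simp: uS max_def min_def split: if_splits)
      qed
      have geo: "u (M + j) = \<beta> ^ j * u M" for j
        by (induction j) (auto simp: st)
      have "0 < u M / \<beta> ^ M" using uL[of M] L0 \<beta> by simp
      from freq[OF this] obtain n where n: "n \<ge> Suc M" "ln (\<Phi> n) < u M / \<beta> ^ M * \<beta> ^ n"
        unfolding INFM_nat_le by blast
      define j where "j = n - Suc M"
      have nj: "n = Suc (M + j)" using n(1) by (simp add: j_def)
      have "\<beta> * (\<beta> ^ j * u M) < \<Lambda> n" using st[of "M + j"] geo[of j] nj by simp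
      moreover have "u M / \<beta> ^ M * \<beta> ^ n = \<beta> * (\<beta> ^ j * u M)" using \<beta> by (simp add: nj power_add)
      ultimately show False using n(2) by (simp add: \<Lambda>_def)
    qed
    have "x \<in> {0..<1}" using cf_limit_open_bounds[OF valid] by (simp add: x_def)
    moreover have "\<forall>\<^sub>\<infinity>n. real (partial_quotient (n + 1) x) < \<Phi> n"
      unfolding MOST_nat_le
    proof (intro exI[of _ "Suc m"] allI impI)
      fix n assume n: "Suc m \<le> n"
      then obtain k where k: "n = Suc k" by (cases n) auto
      have "u n \<le> \<Lambda> n" using \<Lambda>L(1)[of n] n by (simp add: k uS)
      then have "exp (u n) \<le> \<Phi> n" using \<Lambda>L(2)[of n] n by (metis Suc_leD exp_le_cancel_iff)
      moreover have "real (d n) < 2 * real (N n)" using dN(2)[of n] by (metis of_nat_less_iff of_nat_mult of_nat_numeral)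
      ultimately show "real (partial_quotient (n + 1) x) < \<Phi> n" using Nup[of n] pq[of n] by simp
    qed
    moreover have "\<exists>\<^sub>\<infinity>n. \<Phi> n \<le> real (partial_quotient (n + 1) x) * real (partial_quotient n x)"
      unfolding INFM_nat_le
    proof
      fix l
      obtain n where n: "n \<ge> max l (Suc m)" "u n = \<Lambda> n" using io unfolding INFM_nat_le by blast
      then obtain k where k: "n = Suc k" by (cases n) auto
      have "\<Phi> n = exp (u n)" using \<Lambda>L(2)[of n] n by simp
      also have "\<dots> \<le> real (N n) * 4" using Nlo[of n] by simp
      also have "\<dots> \<le> real (d n) * real (d k)" using dN(1)[of n] dN(1)[of k] N4[of k] by (intro mult_mono) auto
      finally show "\<exists>n\<ge>l. \<Phi> n \<le> real (partial_quotient (n + 1) x) * real (partial_quotient n x)"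
        using n(1) pq[of n] pq[of k] by (intro exI[of _ n]) (simp add: k)
    qed
    ultimately show "cf_limit (\<lambda>i. [d i]) \<in> exceptional_set \<Phi>" by (simp add: exceptional_set_def x_def)
  qed
  finally show ?thesis .
qed


section \<open>Cantor sets of words with inserted large digits\<close>

text \<open>
At the levels outside \<open>K\<close> a word of \<open>W\<close> is chosen, at the levels in \<open>K\<close> a pair of large digits. The
word \<open>pre\<close> only shifts the positions of the blocks.
\<close>
locale block_construction =
  fixes W :: "nat list set" and p M :: nat and pre :: "nat list" and K :: "nat set"
    and A D :: "nat \<Rightarrow> nat" and s Z :: real
  assumes finW: "finite W" and neW: "W \<noteq> {}"
    and W: "\<And>w. w \<in> W \<Longrightarrow> length w = p" "\<And>w. w \<in> W \<Longrightarrow> set w \<subseteq> {1..M}"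
    and p: "2 \<le> p" and pre: "set pre \<subseteq> {1..}"
    and A: "\<And>k. 2 \<le> A k" and D: "\<And>k. 2 \<le> D k"
    and s: "0 < s" "s \<le> 1"
    and Z: "Z = (\<Sum>w\<in>W. cf_den w 0 powr (- 2 * s))"
begin

text \<open>
Ordinary and special blocks have the same length \<open>p + 2\<close>, so that the position of a block does not depend on the choices. The final
ones separate the points: if two points branch inside a word or at the second large digit, then the next two digits are
bounded, and if they branch at the first large digit, then the next digit is at least 2. In all cases the tails
stay away from 1.
\<close>
definition blocks :: "nat \<Rightarrow> nat list set" where
  "blocks k = (if k \<in> K then (\<lambda>(a, b). a # b # replicate p 1) ` ({A k..<2 * A k} \<times> {D k..<2 * D k})
     else (\<lambda>w. w @ [1, 1]) ` W)"

definition weight :: "nat \<Rightarrow> nat list \<Rightarrow> real" where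
  "weight k v = (if k \<in> K then 1 / (real (A k) * real (D k)) else cf_den (take p v) 0 powr (- 2 * s) / Z)"

text \<open>
A bound for \<open>m q\<^sup>2\<^sup>s\<close>, where \<open>m\<close> is the mass and \<open>q\<close> the continuant of a prefix of \<open>k\<close> blocks. It does not depend on the
choices, since the weights \<open>q(w)\<^sup>-\<^sup>2\<^sup>s\<close> cancel the contribution of each word.
\<close>
primrec mass_bound :: "nat \<Rightarrow> real" where
  "mass_bound 0 = cf_den pre 0 powr (2 * s)"
| "mass_bound (Suc k) = (if k \<in> K
     then mass_bound k * (real (A k) * real (D k)) powr (2 * s - 1) * (2 ^ (p + 3)) powr (2 * s)
     else mass_bound k * 64 powr s / Z)"

definition rep_point :: "(nat \<Rightarrow> nat list) \<Rightarrow> real" where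
  "rep_point \<omega> = cf_append pre (cf_limit \<omega>)"

lemma W1: "w \<in> W \<Longrightarrow> set w \<subseteq> {1..}"
  using W(2) by fastforce

lemma M1: "1 \<le> M"
proof -
  obtain w where w: "w \<in> W" using neW by blast
  then obtain a where "a \<in> set w" using W(1)[OF w] p by (cases w) auto
  then show ?thesis using W(2)[OF w] by auto
qed

lemma Zpos: "0 < Z"
  unfolding Z
proof (rule sum_pos[OF finW neW])
  fix w assume "w \<in> W"
  then have "0 < cf_den w 0" by (intro cf_den_pos W1) auto
  then show "0 < cf_den w 0 powr (- 2 * s)" by simp
qed

lemma block_props:
  assumes "v \<in> blocks k"
  shows "length v = p + 2" "set v \<subseteq> {1..}"
proof -
  have "length v = p + 2 \<and> set v \<subseteq> {1..}"
  proof (cases "k \<in> K")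
    case True
    then obtain a b where v: "v = a # b # replicate p 1" "A k \<le> a" "D k \<le> b"
      using assms by (auto simp: blocks_def)
    then have "1 \<le> a" "1 \<le> b" using A[of k] D[of k] by auto
    then show ?thesis by (auto simp: v)
  next
    case False
    then obtain w where "v = w @ [1, 1]" "w \<in> W" using assms by (auto simp: blocks_def)
    then show ?thesis using W(1) W1 by auto
  qed
  then show "length v = p + 2" "set v \<subseteq> {1..}" by auto
qed

lemma valid_Pi: "\<omega> \<in> Pi UNIV blocks \<Longrightarrow> valid_blocks \<omega>"
  using block_props unfolding valid_blocks_def Pi_iff
  by (metis UNIV_I add_eq_0_iff_both_eq_0 length_0_conv zero_neq_numeral)

lemma inj_special: "inj_on (\<lambda>(a::nat, b::nat). a # b # replicate p (1::nat)) X"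
  by (auto simp: inj_on_def)

lemma finite_blocks: "finite (blocks k)"
  using finW by (auto simp: blocks_def)

lemma sum_weight: "sum (weight k) (blocks k) = 1"
proof (cases "k \<in> K")
  case True
  have "card (blocks k) = A k * D k"
    unfolding blocks_def if_P[OF True] card_image[OF inj_special] by simp
  then show ?thesis using True A[of k] D[of k] by (simp add: weight_def)
next
  case False
  have inj: "inj_on (\<lambda>w. w @ [1, 1]) W" by (auto simp: inj_on_def)
  have "sum (weight k) (blocks k) = (\<Sum>w\<in>W. cf_den (take p (w @ [1, 1])) 0 powr (- 2 * s) / Z)"
    unfolding blocks_def if_not_P[OF False] sum.reindex[OF inj] using False by (simp add: weight_def)
  also have "\<dots> = (\<Sum>w\<in>W. cf_den w 0 powr (- 2 * s) / Z)"
    using W(1) by (intro sum.cong) auto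
  also have "\<dots> = 1" unfolding sum_divide_distrib[symmetric] Z[symmetric] using Zpos by simp
  finally show ?thesis .
qed

lemma weight_nonneg: "0 \<le> weight k v"
  using Zpos by (simp add: weight_def)

lemma mass_bound_nonneg: "0 \<le> mass_bound k"
  using Zpos by (induction k) auto

lemma special_blockE:
  assumes "k \<in> K" "v \<in> blocks k"
  obtains a b where "v = a # b # replicate p 1" "A k \<le> a" "a < 2 * A k" "D k \<le> b" "b < 2 * D k"
proof -
  have "v \<in> (\<lambda>(a, b). a # b # replicate p 1) ` ({A k..<2 * A k} \<times> {D k..<2 * D k})"
    using assms by (simp add: blocks_def)
  then show ?thesis using that by auto
qed

lemma cf_den_special:
  assumes "k \<in> K" "v \<in> blocks k" "set c \<subseteq> {1..}"
  shows "cf_den (c @ v) 0 \<le> cf_den c 0 * (2 ^ (p + 3) * (real (A k) * real (D k)))"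
proof -
  obtain a b where v: "v = a # b # replicate p 1" "a < 2 * A k" "b < 2 * D k"
    using assms by (auto simp: blocks_def)
  have ab: "real a + 1 \<le> 2 * real (A k)" "real b + 1 \<le> 2 * real (D k)"
    using v(2,3) by linarith+
  have "cf_den v 0 \<le> (\<Prod>a\<leftarrow>v. real a + 1)" by (rule cf_den_le_prod[OF block_props(2)[OF assms(2)]])
  also have "\<dots> = (real a + 1) * ((real b + 1) * 2 ^ p)"
    by (simp add: v prod_list_replicate)
  also have "\<dots> \<le> (2 * real (A k)) * ((2 * real (D k)) * 2 ^ p)"
    using ab by (intro mult_mono) auto
  finally have "cf_den v 0 \<le> (2 * real (A k)) * ((2 * real (D k)) * 2 ^ p)" .
  then have "2 * cf_den c 0 * cf_den v 0 \<le> 2 * cf_den c 0 * ((2 * real (A k)) * ((2 * real (D k)) * 2 ^ p))"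
    using cf_den_pos[OF assms(3), of 0] by (intro mult_left_mono) auto
  with cf_den_append_le[OF assms(3) block_props(2)[OF assms(2)]]
  show ?thesis by (simp add: power_add mult_ac)
qed

lemma cf_den_regular:
  assumes "w \<in> W" "set c \<subseteq> {1..}"
  shows "cf_den (c @ w @ [1, 1]) 0 \<le> 8 * (cf_den c 0 * cf_den w 0)"
proof -
  have "cf_den (c @ w @ [1, 1]) 0 \<le> 2 * cf_den c 0 * cf_den (w @ [1, 1]) 0"
    using assms W1 by (intro cf_den_append_le) auto
  also have "\<dots> \<le> 2 * cf_den c 0 * (2 * cf_den w 0 * cf_den [1, 1] 0)"
    using assms W1 cf_den_pos[OF assms(2), of 0] by (intro mult_left_mono cf_den_append_le) auto
  also have "cf_den [1, 1] 0 = 2" by simp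
  finally show ?thesis by simp
qed

lemma mass_le_bound:
  assumes "\<omega> \<in> Pi UNIV blocks"
  shows "(\<Prod>i<k. weight i (\<omega> i)) * cf_den (pre @ prefix_word \<omega> k) 0 powr (2 * s) \<le> mass_bound k"
proof (induction k)
  case (Suc k)
  define c where "c = pre @ prefix_word \<omega> k"
  define m where "m = (\<Prod>i<k. weight i (\<omega> i))"
  have m: "0 \<le> m" unfolding m_def by (rule prod_nonneg) (rule weight_nonneg)
  have c: "set c \<subseteq> {1..}" using pre valid_prefix_word[OF valid_Pi[OF assms]] by (auto simp: c_def)
  have q: "0 < cf_den c 0" by (rule cf_den_pos[OF c]) simp
  have \<omega>k: "\<omega> k \<in> blocks k" using assms by auto
  have d0: "0 < cf_den (c @ \<omega> k) 0" using c block_props(2)[OF \<omega>k] by (intro cf_den_pos) auto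
  have IH: "m * cf_den c 0 powr (2 * s) \<le> mass_bound k" using Suc by (simp add: m_def c_def)
  have split: "(\<Prod>i<Suc k. weight i (\<omega> i)) * cf_den (pre @ prefix_word \<omega> (Suc k)) 0 powr (2 * s)
      = m * weight k (\<omega> k) * cf_den (c @ \<omega> k) 0 powr (2 * s)"
    by (simp add: m_def c_def prefix_word_Suc)
  show ?case
  proof (cases "k \<in> K")
    case True
    define X where "X = real (A k) * real (D k)"
    have X: "0 < X" unfolding X_def using A[of k] D[of k] by simp
    have "cf_den (c @ \<omega> k) 0 powr (2 * s) \<le> (cf_den c 0 * (2 ^ (p + 3) * X)) powr (2 * s)"
      unfolding X_def using cf_den_special[OF True \<omega>k c] d0 s by (intro powr_mono2) auto
    also have "\<dots> = cf_den c 0 powr (2 * s) * ((2 ^ (p + 3)) powr (2 * s) * X powr (2 * s))"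
      by (simp only: powr_mult)
    finally have "m * weight k (\<omega> k) * cf_den (c @ \<omega> k) 0 powr (2 * s)
       \<le> m * weight k (\<omega> k) * (cf_den c 0 powr (2 * s) * ((2 ^ (p + 3)) powr (2 * s) * X powr (2 * s)))"
      using m weight_nonneg by (intro mult_left_mono mult_nonneg_nonneg) auto
    also have "\<dots> = (m * cf_den c 0 powr (2 * s)) * (X powr (2 * s) / X * (2 ^ (p + 3)) powr (2 * s))"
      using True by (simp add: weight_def X_def)
    also have "X powr (2 * s) / X = X powr (2 * s - 1)" using X by (simp add: powr_diff)
    also have "(m * cf_den c 0 powr (2 * s)) * (X powr (2 * s - 1) * (2 ^ (p + 3)) powr (2 * s))
        \<le> mass_bound k * (X powr (2 * s - 1) * (2 ^ (p + 3)) powr (2 * s))"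
      by (intro mult_right_mono IH) auto
    finally show ?thesis unfolding split using True by (simp add: X_def mult.assoc)
  next
    case False
    then obtain w where w: "\<omega> k = w @ [1, 1]" "w \<in> W" using \<omega>k by (auto simp: blocks_def)
    have dw: "0 < cf_den w 0" using W1[OF w(2)] by (rule cf_den_pos) simp
    have "cf_den (c @ \<omega> k) 0 powr (2 * s) \<le> (8 * (cf_den c 0 * cf_den w 0)) powr (2 * s)"
      using cf_den_regular[OF w(2) c] w(1) d0 s by (intro powr_mono2) auto
    also have "\<dots> = (8 powr 2) powr s * (cf_den c 0 powr (2 * s) * cf_den w 0 powr (2 * s))"
      by (simp only: powr_mult powr_powr)
    also have "(8::real) powr 2 = 64" by (simp add: powr_numeral)
    finally have "m * weight k (\<omega> k) * cf_den (c @ \<omega> k) 0 powr (2 * s)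
       \<le> m * weight k (\<omega> k) * (64 powr s * (cf_den c 0 powr (2 * s) * cf_den w 0 powr (2 * s)))"
      using m weight_nonneg by (intro mult_left_mono mult_nonneg_nonneg) auto
    also have "m * weight k (\<omega> k) * (64 powr s * (cf_den c 0 powr (2 * s) * cf_den w 0 powr (2 * s)))
       = m * (cf_den w 0 powr (- 2 * s) / Z) * (64 powr s * (cf_den c 0 powr (2 * s) * cf_den w 0 powr (2 * s)))"
      using False w W(1) by (simp add: weight_def)
    also have "m * (cf_den w 0 powr (- 2 * s) / Z) * (64 powr s * (cf_den c 0 powr (2 * s) * cf_den w 0 powr (2 * s)))
       = (m * cf_den c 0 powr (2 * s)) * (64 powr s / Z) * (cf_den w 0 powr (- 2 * s) * cf_den w 0 powr (2 * s))"
      by simp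
    also have "cf_den w 0 powr (- 2 * s) * cf_den w 0 powr (2 * s) = 1"
      using dw by (simp add: powr_add[symmetric])
    also have "(m * cf_den c 0 powr (2 * s)) * (64 powr s / Z) * 1 \<le> mass_bound k * (64 powr s / Z) * 1"
      using Zpos by (intro mult_right_mono IH) auto
    finally show ?thesis unfolding split using False by simp
  qed
qed simp

definition sep_const :: real where
  "sep_const = 16 * (real M + 2) * (real M + 1) ^ 2 * (real M + 1) ^ (2 * p)"

lemma sep_const_ge: "1536 \<le> sep_const"
proof -
  have "2 \<le> real M + 1" "3 \<le> real M + 2" using M1 by auto
  then have "16 * 3 * 2 ^ 2 * 2 ^ (2 * p) \<le> sep_const" unfolding sep_const_def
    by (intro mult_mono power_mono) auto
  moreover have "(2::real) ^ 4 \<le> 2 ^ (2 * p)" using p by (intro power_increasing) auto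
  ultimately show ?thesis by simp
qed

lemma cf_den_le_power:
  assumes "set w \<subseteq> {1..M}" "length w \<le> p"
  shows "cf_den w 0 \<le> (real M + 1) ^ p"
proof -
  have w: "set w \<subseteq> {1..}" using assms(1) by fastforce
  have "cf_den w 0 \<le> (\<Prod>a\<leftarrow>w. real a + 1)" by (rule cf_den_le_prod[OF w])
  also have "\<dots> \<le> (real M + 1) ^ length w"
    using assms(1)
  proof (induction w)
    case (Cons a w)
    then show ?case using M1 by (auto intro!: mult_mono prod_list_nonneg)
  qed simp
  also have "\<dots> \<le> (real M + 1) ^ p" using assms(2) by (intro power_increasing) auto
  finally show ?thesis .
qed

text \<open>
Two different words of the finite set \<open>W\<close> lead to points whose distance is comparable with the length of the whole parent
cylinder, so it suffices to bound the mass by 1.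
\<close>
lemma regular_mass:
  assumes k: "k \<notin> K" and c: "set c \<subseteq> {1..}" and V: "V \<subseteq> blocks k" "v1 \<in> V" "v2 \<in> V" "v1 \<noteq> v2"
    and z: "0 < z" "z < 1" "0 < z'" "z' < 1"
    and close: "\<bar>cf_append (c @ v1) z - cf_append (c @ v2) z'\<bar> \<le> d"
  shows "sum (weight k) V \<le> (sep_const * (cf_den c 0)\<^sup>2 * d) powr s"
proof -
  have "v1 \<in> (\<lambda>w. w @ [1, 1]) ` W" "v2 \<in> (\<lambda>w. w @ [1, 1]) ` W" using V k by (auto simp: blocks_def)
  then obtain w1 w2 where w: "v1 = w1 @ [1, 1]" "v2 = w2 @ [1, 1]" "w1 \<in> W" "w2 \<in> W" by blast
  have "w1 \<noteq> w2" "length w1 = length w2" using V(4) w W(1) by auto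
  then obtain c0 a t a' t' where d: "a \<noteq> a'" "w1 = c0 @ [a] @ t" "w2 = c0 @ [a'] @ t'"
    using same_length_different by blast
  have sub: "set c0 \<subseteq> {1..M}" "set t \<subseteq> {1..M}" "set t' \<subseteq> {1..M}" "a \<in> {1..M}" "a' \<in> {1..M}" "length c0 \<le> p"
    using W(2)[OF w(3)] W(2)[OF w(4)] W(1)[OF w(3)] d by auto
  have tail: "0 \<le> cf_append (y @ [1, 1]) x \<and> cf_append (y @ [1, 1]) x \<le> 1 - 1 / (real M + 2)"
    if "set y \<subseteq> {1..M}" "0 < x" "x < 1" for x y
  proof -
    have y1: "set y \<subseteq> {1..}" using that(1) by fastforce
    have "cf_append (y @ [1, 1]) x \<le> 1 - 1 / (real M + 2)"
    proof (cases y)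
      case Nil
      show ?thesis unfolding Nil append_Nil by (rule cf_append_Cons_Cons_le) (use M1 that in auto)
    next
      case C1: (Cons y1 ys)
      show ?thesis
      proof (cases ys)
        case Nil
        show ?thesis unfolding C1 Nil append_Cons append_Nil by (rule cf_append_Cons_Cons_le) (use M1 that C1 in auto)
      next
        case (Cons y2 ys')
        show ?thesis unfolding C1 Cons append_Cons
          by (rule cf_append_Cons_Cons_le) (use that C1 Cons y1 in auto)
      qed
    qed
    then show ?thesis using that by (auto intro: cf_append_nonneg)
  qed
  have cc0: "set (c @ c0) \<subseteq> {1..}" using c sub(1) by fastforce
  have q: "1 \<le> cf_den c 0" by (rule cf_den_ge_1[OF c]) simp
  have qc: "1 \<le> cf_den (c @ c0) 0" by (rule cf_den_ge_1[OF cc0]) simp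
  have "cf_den (c @ c0) 0 \<le> 2 * cf_den c 0 * cf_den c0 0"
    using c sub(1) by (intro cf_den_append_le) fastforce+
  also have "\<dots> \<le> 2 * cf_den c 0 * (real M + 1) ^ p"
    using q cf_den_le_power[OF sub(1,6)] by (intro mult_left_mono) auto
  finally have qq: "cf_den (c @ c0) 0 \<le> 2 * cf_den c 0 * (real M + 1) ^ p" .
  have dif: "1 \<le> \<bar>real a - real a'\<bar>" using d(1) by (cases "a < a'") auto
  have "1 / (real M + 2) * 1 / ((real M + 1) * (real M + 1)) / (4 * (2 * cf_den c 0 * (real M + 1) ^ p)\<^sup>2)
     \<le> 1 / (real M + 2) * \<bar>real a - real a'\<bar> / ((real a + 1) * (real a' + 1)) / (4 * (cf_den (c @ c0) 0)\<^sup>2)"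
    using dif sub(4,5) qq qc q by (intro frac_le mult_mono power_mono divide_nonneg_nonneg mult_pos_pos) auto
  also have "\<dots> \<le> \<bar>cf_append ((c @ c0) @ [a]) (cf_append (t @ [1, 1]) z) - cf_append ((c @ c0) @ [a']) (cf_append (t' @ [1, 1]) z')\<bar>"
    using tail[OF sub(2) z(1,2)] tail[OF sub(3) z(3,4)] sub(4,5)
    by (intro cf_append_separation[OF cc0 _ _ d(1)]) auto
  also have "\<dots> = \<bar>cf_append (c @ v1) z - cf_append (c @ v2) z'\<bar>"
    by (simp add: w d cf_append_append)
  also have "\<dots> \<le> d" by (rule close)
  finally have "1 / (real M + 2) * 1 / ((real M + 1) * (real M + 1)) / (4 * (2 * cf_den c 0 * (real M + 1) ^ p)\<^sup>2) \<le> d" .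
  moreover have "1 / (real M + 2) * 1 / ((real M + 1) * (real M + 1)) / (4 * (2 * cf_den c 0 * (real M + 1) ^ p)\<^sup>2)
      = 1 / (sep_const * (cf_den c 0)\<^sup>2)"
  proof -
    define x y where "x = real M + 1" and "y = real M + 2"
    have "sep_const = 16 * y * x\<^sup>2 * (x ^ p)\<^sup>2" by (simp add: sep_const_def x_def y_def power_even_eq)
    then show ?thesis unfolding x_def[symmetric] y_def[symmetric]
      by (simp add: power_mult_distrib power2_eq_square mult_ac)
  qed
  ultimately have "1 / (sep_const * (cf_den c 0)\<^sup>2) \<le> d" by simp
  then have ge1: "1 \<le> sep_const * (cf_den c 0)\<^sup>2 * d" using sep_const_ge q by (simp add: divide_le_eq mult_ac)
  have "sum (weight k) V \<le> sum (weight k) (blocks k)"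
    using V(1) finite_blocks weight_nonneg by (intro sum_mono2) auto
  also have "\<dots> \<le> (sep_const * (cf_den c 0)\<^sup>2 * d) powr s"
    unfolding sum_weight using ge1 s by (intro ge_one_powr_ge_zero) auto
  finally show ?thesis .
qed

text \<open>
If the set contains two different first large digits, only the proportion of these digits is estimated. If
the first large digit is constant, its weight \<open>1 / A k\<close> is gained, and the proportion of the second digits
is estimated in the cylinder of continuant about \<open>q A k\<close>.
\<close>
lemma special_mass:
  assumes k: "k \<in> K" and c: "set c \<subseteq> {1..}" and V: "V \<subseteq> blocks k" "v1 \<in> V" "v2 \<in> V" "v1 \<noteq> v2"
    and close: "\<And>v v'. v \<in> V \<Longrightarrow> v' \<in> V \<Longrightarrow> \<exists>z z'. 0 < z \<and> z < 1 \<and> 0 < z' \<and> z' < 1 \<and>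
        \<bar>cf_append (c @ v) z - cf_append (c @ v') z'\<bar> \<le> d"
  shows "sum (weight k) V \<le> (sep_const * (cf_den c 0)\<^sup>2 * d) powr s * real (A k) powr s \<or>
    sum (weight k) V \<le> (sep_const * (cf_den c 0)\<^sup>2 * d) powr s * (real (A k) powr (2 * s - 1) * real (D k) powr s)"
proof -
  define q where "q = cf_den c 0"
  have q: "1 \<le> q" unfolding q_def by (rule cf_den_ge_1[OF c]) simp
  have d0: "0 \<le> d" using close[OF V(2,2)] by (meson abs_ge_zero order_trans)
  have A2: "2 \<le> real (A k)" "2 \<le> real (D k)" using A[of k] D[of k] by auto
  have Vform: "\<exists>a b. v = a # b # replicate p 1 \<and> a \<in> {A k..<2 * A k} \<and> b \<in> {D k..<2 * D k}" if "v \<in> V" for v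
    using that V(1) k by (auto simp: blocks_def)
  define Va where "Va = (\<lambda>v. v ! 0) ` V"
  define Vb where "Vb = (\<lambda>v. v ! 1) ` V"
  have VaA: "Va \<subseteq> {A k..<2 * A k}" and VbD: "Vb \<subseteq> {D k..<2 * D k}"
    using Vform unfolding Va_def Vb_def by force+
  have finV: "finite V" using V(1) finite_blocks finite_subset by blast
  have cardV: "card V \<le> card Va * card Vb"
  proof -
    have "inj_on (\<lambda>v. (v ! 0, v ! 1)) V"
    proof (rule inj_onI)
      fix v v' assume "v \<in> V" "v' \<in> V" "(v ! 0, v ! 1) = (v' ! 0, v' ! 1)"
      then show "v = v'" using Vform[of v] Vform[of v'] by auto
    qed
    moreover have "(\<lambda>v. (v ! 0, v ! 1)) ` V \<subseteq> Va \<times> Vb" by (auto simp: Va_def Vb_def)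
    ultimately have "card V \<le> card (Va \<times> Vb)"
      by (rule card_inj_on_le) (use finV in \<open>auto simp: Va_def Vb_def\<close>)
    then show ?thesis by (simp only: card_cartesian_product)
  qed
  have sumV: "sum (weight k) V = real (card V) / (real (A k) * real (D k))"
    using k by (simp add: weight_def)
  show ?thesis
  proof (cases "\<exists>a\<in>Va. \<exists>a'\<in>Va. a \<noteq> a'")
    case True
    then obtain a1 a2 where a12: "a1 \<in> Va" "a2 \<in> Va" "a1 \<noteq> a2" by blast
    have sep: "\<bar>real a - real a'\<bar> \<le> 32 * (real (A k))\<^sup>2 * q\<^sup>2 * d" if aa: "a \<in> Va" "a' \<in> Va" for a a'
    proof (cases "a = a'")
      case True then show ?thesis using d0 by simp
    next
      case False
      obtain v v' where v: "v \<in> V" "v ! 0 = a" "v' \<in> V" "v' ! 0 = a'" using aa by (auto simp: Va_def)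
      obtain b where vb: "v = a # b # replicate p 1" "a \<in> {A k..<2 * A k}" "b \<in> {D k..<2 * D k}"
        using Vform[OF v(1)] v(2) by auto
      obtain b' where vb': "v' = a' # b' # replicate p 1" "a' \<in> {A k..<2 * A k}" "b' \<in> {D k..<2 * D k}"
        using Vform[OF v(3)] v(4) by auto
      obtain z z' where z: "0 < z" "z < 1" "0 < z'" "z' < 1" "\<bar>cf_append (c @ v) z - cf_append (c @ v') z'\<bar> \<le> d"
        using close[OF v(1,3)] by blast
      have u: "0 \<le> cf_append (b # replicate p 1) z" "cf_append (b # replicate p 1) z \<le> 1 - 1/2"
        "0 \<le> cf_append (b' # replicate p 1) z'" "cf_append (b' # replicate p 1) z' \<le> 1 - 1/2"
        using cf_append_Cons_le_half[of b z] cf_append_Cons_le_half[of b' z'] D[of k] vb(3) vb'(3) z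
          cf_append_nonneg[of z "b # replicate p 1"] cf_append_nonneg[of z' "b' # replicate p 1"]
        by (auto simp del: cf_append.simps)
      have ab: "1 \<le> a" "1 \<le> a'" "real a + 1 \<le> 2 * real (A k)" "real a' + 1 \<le> 2 * real (A k)"
      proof -
        have "a < 2 * A k" "a' < 2 * A k" using vb vb' by auto
        then show "real a + 1 \<le> 2 * real (A k)" "real a' + 1 \<le> 2 * real (A k)" by linarith+
        show "1 \<le> a" "1 \<le> a'" using A[of k] vb vb' by auto
      qed
      have "1/2 * \<bar>real a - real a'\<bar> / ((2 * real (A k)) * (2 * real (A k))) / (4 * q\<^sup>2)
         \<le> 1/2 * \<bar>real a - real a'\<bar> / ((real a + 1) * (real a' + 1)) / (4 * (cf_den c 0)\<^sup>2)"
        unfolding q_def[symmetric] using ab q by (intro frac_le mult_mono divide_nonneg_nonneg mult_pos_pos) auto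
      also have "\<dots> \<le> \<bar>cf_append (c @ [a]) (cf_append (b # replicate p 1) z) - cf_append (c @ [a']) (cf_append (b' # replicate p 1) z')\<bar>"
        using u by (intro cf_append_separation[OF c ab(1,2) False]) (auto simp del: cf_append.simps)
      also have "\<dots> \<le> d" using z(5) by (simp add: vb(1) vb'(1) cf_append_append)
      finally show ?thesis using A2 q by (simp add: field_simps power2_eq_square)
    qed
    have "sum (weight k) V \<le> real (card Va) / real (A k)"
    proof -
      have "card Vb \<le> D k" using card_mono[OF _ VbD] by simp
      then have "card V \<le> card Va * D k" using cardV by (meson mult_le_mono2 order_trans)
      then have "real (card V) \<le> real (card Va * D k)" by (simp only: of_nat_le_iff)
      then have "real (card V) / (real (A k) * real (D k)) \<le> real (card Va * D k) / (real (A k) * real (D k))"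
        by (intro divide_right_mono) auto
      also have "\<dots> = real (card Va) / real (A k)" using A2 by simp
      finally show ?thesis unfolding sumV .
    qed
    also have "\<dots> \<le> (2 * (32 * (real (A k))\<^sup>2 * q\<^sup>2 * d) / real (A k)) powr s"
      using VaA a12 s sep by (intro uniform_mass_le_powr) auto
    also have "\<dots> = (64 * q\<^sup>2 * d * real (A k)) powr s"
      using A2 by (simp add: power2_eq_square mult_ac)
    also have "\<dots> \<le> (sep_const * q\<^sup>2 * d * real (A k)) powr s"
      using s d0 sep_const_ge by (intro powr_mono2 mult_right_mono) auto
    also have "\<dots> = (sep_const * q\<^sup>2 * d) powr s * real (A k) powr s" by (simp only: powr_mult)
    finally show ?thesis by (simp add: q_def)
  next
    case False
    obtain a b1 where v1: "v1 = a # b1 # replicate p 1" "a \<in> {A k..<2 * A k}" "b1 \<in> {D k..<2 * D k}"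
      using Vform[OF V(2)] by blast
    have "a \<in> Va" using V(2) v1(1) by (force simp: Va_def)
    then have Va: "Va = {a}" using False by blast
    obtain b2 where v2: "v2 = a # b2 # replicate p 1" "b2 \<in> {D k..<2 * D k}"
    proof -
      obtain a2 b where v2: "v2 = a2 # b # replicate p 1" "b \<in> {D k..<2 * D k}" using Vform[OF V(3)] by blast
      have "a2 \<in> Va" using V(3) v2(1) by (force simp: Va_def)
      then have "a2 = a" unfolding Va by simp
      with v2 that show ?thesis by blast
    qed
    have b12: "b1 \<in> Vb" "b2 \<in> Vb" "b1 \<noteq> b2" using V v1 v2 by (force simp: Vb_def)+
    have first: "\<exists>b. v = a # b # replicate p 1 \<and> b \<in> {D k..<2 * D k}" if "v \<in> V" for v
    proof -
      obtain a2 b where v2: "v = a2 # b # replicate p 1" "b \<in> {D k..<2 * D k}" using Vform[OF \<open>v \<in> V\<close>] by blast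
      have "a2 \<in> Va" using \<open>v \<in> V\<close> v2(1) by (force simp: Va_def)
      then show ?thesis using v2 unfolding Va by simp
    qed
    have ca: "set (c @ [a]) \<subseteq> {1..}" using c v1(2) A[of k] by auto
    have qa1: "1 \<le> cf_den (c @ [a]) 0" by (rule cf_den_ge_1[OF ca]) simp
    have qa: "cf_den (c @ [a]) 0 \<le> 4 * real (A k) * q"
    proof -
      have "cf_den (c @ [a]) 0 \<le> 2 * cf_den c 0 * cf_den [a] 0" using ca by (intro cf_den_append_le) auto
      also have "\<dots> = 2 * q * real a" by (simp add: q_def)
      also have "\<dots> \<le> 2 * q * (2 * real (A k))" using v1(2) q by (intro mult_left_mono) auto
      finally show ?thesis by (simp add: mult_ac)
    qed
    have sep: "\<bar>real b - real b'\<bar> \<le> 768 * (real (D k))\<^sup>2 * (real (A k))\<^sup>2 * q\<^sup>2 * d" if bb: "b \<in> Vb" "b' \<in> Vb" for b b'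
    proof (cases "b = b'")
      case True then show ?thesis using d0 by simp
    next
      case ne: False
      obtain v v' where v: "v \<in> V" "v ! 1 = b" "v' \<in> V" "v' ! 1 = b'" using bb by (auto simp: Vb_def)
      have vb: "v = a # b # replicate p 1" "b \<in> {D k..<2 * D k}"
        using first[OF v(1)] v(2) by auto
      have vb': "v' = a # b' # replicate p 1" "b' \<in> {D k..<2 * D k}"
        using first[OF v(3)] v(4) by auto
      obtain z z' where z: "0 < z" "z < 1" "0 < z'" "z' < 1" "\<bar>cf_append (c @ v) z - cf_append (c @ v') z'\<bar> \<le> d"
        using close[OF v(1,3)] by blast
      define p' where "p' = p - 2"
      have "p = Suc (Suc p')" using p by (simp add: p'_def)
      then have p': "replicate p (1::nat) = 1 # 1 # replicate p' 1" by simp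
      have u: "0 \<le> cf_append (replicate p 1) x \<and> cf_append (replicate p 1) x \<le> 1 - 1/3" if "0 < x" "x < 1" for x
      proof -
        have "cf_append (replicate p 1) x \<le> 1 - 1 / (real 1 + 2)"
          unfolding p' by (rule cf_append_Cons_Cons_le) (use that in auto)
        then show ?thesis using that by (simp add: cf_append_nonneg)
      qed
      have ab: "1 \<le> b" "1 \<le> b'" "real b + 1 \<le> 2 * real (D k)" "real b' + 1 \<le> 2 * real (D k)"
      proof -
        have "b < 2 * D k" "b' < 2 * D k" using vb vb' by auto
        then show "real b + 1 \<le> 2 * real (D k)" "real b' + 1 \<le> 2 * real (D k)" by linarith+
        show "1 \<le> b" "1 \<le> b'" using D[of k] vb vb' by auto
      qed
      have "1/3 * \<bar>real b - real b'\<bar> / ((2 * real (D k)) * (2 * real (D k))) / (4 * (4 * real (A k) * q)\<^sup>2)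
         \<le> 1/3 * \<bar>real b - real b'\<bar> / ((real b + 1) * (real b' + 1)) / (4 * (cf_den (c @ [a]) 0)\<^sup>2)"
        using ab q qa qa1 by (intro frac_le mult_mono power_mono divide_nonneg_nonneg mult_pos_pos) auto
      also have "\<dots> \<le> \<bar>cf_append ((c @ [a]) @ [b]) (cf_append (replicate p 1) z) - cf_append ((c @ [a]) @ [b']) (cf_append (replicate p 1) z')\<bar>"
        using u[OF z(1,2)] u[OF z(3,4)] by (intro cf_append_separation[OF ca ab(1,2) ne]) auto
      also have "\<dots> \<le> d" using z(5) by (simp add: vb(1) vb'(1) cf_append_append)
      finally show ?thesis using A2 q by (simp add: field_simps power2_eq_square)
    qed
    have "real (card V) \<le> real (card Vb)" using cardV by (simp add: Va)
    then have "sum (weight k) V \<le> real (card Vb) / (real (A k) * real (D k))"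
      unfolding sumV by (intro divide_right_mono) auto
    also have "\<dots> = real (card Vb) / real (D k) / real (A k)" by simp
    also have "\<dots> \<le> (2 * (768 * (real (D k))\<^sup>2 * (real (A k))\<^sup>2 * q\<^sup>2 * d) / real (D k)) powr s / real (A k)"
      using VbD b12 s sep by (intro divide_right_mono uniform_mass_le_powr) auto
    also have "2 * (768 * (real (D k))\<^sup>2 * (real (A k))\<^sup>2 * q\<^sup>2 * d) / real (D k) = 1536 * q\<^sup>2 * d * ((real (A k))\<^sup>2 * real (D k))"
      using A2 by (simp add: power2_eq_square mult_ac)
    also have "(1536 * q\<^sup>2 * d * ((real (A k))\<^sup>2 * real (D k))) powr s / real (A k)
        \<le> (sep_const * q\<^sup>2 * d * ((real (A k))\<^sup>2 * real (D k))) powr s / real (A k)"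
      using s d0 sep_const_ge by (intro divide_right_mono powr_mono2 mult_right_mono) auto
    also have "\<dots> = (sep_const * q\<^sup>2 * d) powr s * (real (A k) powr (2 * s) / real (A k) * real (D k) powr s)"
    proof -
      have "((real (A k))\<^sup>2) powr s = (real (A k) powr 2) powr s" using A2 by (simp add: powr_numeral)
      also have "\<dots> = real (A k) powr (2 * s)" by (simp only: powr_powr)
      finally show ?thesis by (simp add: powr_mult)
    qed
    also have "real (A k) powr (2 * s) / real (A k) = real (A k) powr (2 * s - 1)"
      using A2 by (simp add: powr_diff)
    finally show ?thesis by (simp add: q_def)
  qed
qed

text \<open>
The three bounds correspond to the three places at which two points can branch: inside a word, at the first large digit
and at the second one.
\<close>
theorem block_set_dim:
  assumes C: "0 < C" and b1: "\<And>k. mass_bound k \<le> C"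
    and b2: "\<And>k. k \<in> K \<Longrightarrow> mass_bound k * real (A k) powr s \<le> C"
    and b3: "\<And>k. k \<in> K \<Longrightarrow> mass_bound k * (real (A k) powr (2 * s - 1) * real (D k) powr s) \<le> C"
  shows "ennreal s \<le> hausdorff_dim (rep_point ` Pi UNIV blocks)"
proof (rule mass_distribution_principle[where f = weight and C = "C * sep_const powr s"])
  show "finite (blocks k)" for k by (rule finite_blocks)
  show "0 \<le> weight k v" for k v by (rule weight_nonneg)
  show "sum (weight k) (blocks k) = 1" for k by (rule sum_weight)
  show "0 < s" by (rule s)
  show "0 < C * sep_const powr s" using C sep_const_ge by simp
next
  fix \<omega> and e :: real assume \<omega>: "\<omega> \<in> Pi UNIV blocks" and e: "0 < e"
  have "(\<lambda>k. (1 / 2 ^ (k div 2)) powr (2 * s) :: real) \<longlonglongrightarrow> 0 powr (2 * s)"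
    by (intro tendsto_powr' half_power_tendsto_0 tendsto_const) (use s in auto)
  then have "(\<lambda>k. (1 / 2 ^ (k div 2)) powr (2 * s) :: real) \<longlonglongrightarrow> 0" by simp
  from order_tendstoD(2)[OF this, of "e / C"] e C obtain k where k: "(1 / 2 ^ (k div 2)) powr (2 * s) < e / C"
    unfolding eventually_sequentially by (auto simp: divide_simps)
  define q where "q = cf_den (pre @ prefix_word \<omega> k) 0"
  note vp = valid_prefix_word[OF valid_Pi[OF \<omega>], of k]
  have "1 * 2 ^ (k div 2) \<le> cf_den pre 0 * cf_den (prefix_word \<omega> k) 0"
    using cf_den_prefix_ge[OF valid_Pi[OF \<omega>], of k] cf_den_ge_1[OF pre, of 0] by (intro mult_mono) auto
  also have "\<dots> \<le> q" unfolding q_def by (rule cf_den_append_ge[OF pre vp])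
  finally have q: "2 ^ (k div 2) \<le> q" by simp
  have q0: "0 < q" by (rule less_le_trans[OF _ q]) simp
  have "(\<Prod>i<k. weight i (\<omega> i)) * q powr (2 * s) \<le> C"
    using mass_le_bound[OF \<omega>, of k] b1[of k] by (simp add: q_def)
  then have "(\<Prod>i<k. weight i (\<omega> i)) \<le> C * (1 / q powr (2 * s))"
    using q0 by (simp add: field_simps)
  also have "1 / q powr (2 * s) = (1 / q) powr (2 * s)" by (simp add: powr_divide)
  also have "C * (1 / q) powr (2 * s) \<le> C * (1 / 2 ^ (k div 2)) powr (2 * s)"
    using C s q q0 by (intro mult_left_mono powr_mono2 divide_left_mono) auto
  also have "\<dots> < e" using k C by (simp add: field_simps)
  finally show "\<exists>k. (\<Prod>i<k. weight i (\<omega> i)) < e" by blast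
next
  fix \<omega> k V d v1 v2
  assume \<omega>: "\<omega> \<in> Pi UNIV blocks" and V: "V \<subseteq> blocks k" "v1 \<in> V" "v2 \<in> V" "v1 \<noteq> v2"
    and cl: "\<And>v v'. v \<in> V \<Longrightarrow> v' \<in> V \<Longrightarrow> \<exists>\<eta>\<in>Pi UNIV blocks. \<exists>\<eta>'\<in>Pi UNIV blocks.
          (\<forall>i<k. \<eta> i = \<omega> i) \<and> (\<forall>i<k. \<eta>' i = \<omega> i) \<and> \<eta> k = v \<and> \<eta>' k = v' \<and> dist (rep_point \<eta>) (rep_point \<eta>') \<le> d"
  define c where "c = pre @ prefix_word \<omega> k"
  define m where "m = (\<Prod>i<k. weight i (\<omega> i))"
  have m: "0 \<le> m" unfolding m_def by (rule prod_nonneg) (rule weight_nonneg)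
  have c: "set c \<subseteq> {1..}" using pre valid_prefix_word[OF valid_Pi[OF \<omega>]] by (auto simp: c_def)
  define q where "q = cf_den c 0"
  have q: "1 \<le> q" unfolding q_def by (rule cf_den_ge_1[OF c]) simp
  have close: "\<exists>z z'. 0 < z \<and> z < 1 \<and> 0 < z' \<and> z' < 1 \<and> \<bar>cf_append (c @ v) z - cf_append (c @ v') z'\<bar> \<le> d"
    if vv: "v \<in> V" "v' \<in> V" for v v'
  proof -
    obtain \<eta> \<eta>' where \<eta>: "\<eta> \<in> Pi UNIV blocks" "\<eta>' \<in> Pi UNIV blocks" "\<And>i. i < k \<Longrightarrow> \<eta> i = \<omega> i"
      "\<And>i. i < k \<Longrightarrow> \<eta>' i = \<omega> i" "\<eta> k = v" "\<eta>' k = v'" "dist (rep_point \<eta>) (rep_point \<eta>') \<le> d"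
      using cl[OF vv] by blast
    have "prefix_word \<eta> k = prefix_word \<omega> k" "prefix_word \<eta>' k = prefix_word \<omega> k"
      using \<eta>(3,4) by (auto intro!: prefix_word_cong)
    then have "rep_point \<eta> = cf_append (c @ v) (cf_limit (\<lambda>i. \<eta> (Suc k + i)))"
      "rep_point \<eta>' = cf_append (c @ v') (cf_limit (\<lambda>i. \<eta>' (Suc k + i)))"
      unfolding rep_point_def c_def using cf_limit_block[OF valid_Pi[OF \<eta>(1)], of pre k] cf_limit_block[OF valid_Pi[OF \<eta>(2)], of pre k] \<eta>(5,6)
      by simp_all
    then show ?thesis using \<eta>(7) cf_limit_shift_open[OF valid_Pi[OF \<eta>(1)], of "Suc k"]
        cf_limit_shift_open[OF valid_Pi[OF \<eta>(2)], of "Suc k"] unfolding dist_real_def by metis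
  qed
  have mq: "m * q powr (2 * s) \<le> mass_bound k" using mass_le_bound[OF \<omega>, of k] by (simp add: m_def q_def c_def)
  have fin: "m * sum (weight k) V \<le> C * sep_const powr s * d powr s"
    if "sum (weight k) V \<le> (sep_const * q\<^sup>2 * d) powr s * y" "0 \<le> y" "mass_bound k * y \<le> C" for y
  proof -
    have "m * sum (weight k) V \<le> m * ((sep_const * q\<^sup>2 * d) powr s * y)" using that(1) m by (rule mult_left_mono)
    also have "(sep_const * q\<^sup>2 * d) powr s = sep_const powr s * (q powr 2) powr s * d powr s"
      using q by (simp add: powr_mult powr_numeral)
    also have "m * (sep_const powr s * (q powr 2) powr s * d powr s * y) = (m * q powr (2 * s)) * y * (sep_const powr s * d powr s)"
      by (simp add: powr_powr)
    also have "\<dots> \<le> mass_bound k * y * (sep_const powr s * d powr s)" using mq that(2) by (intro mult_right_mono) auto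
    also have "\<dots> \<le> C * (sep_const powr s * d powr s)" using that(3) by (intro mult_right_mono) auto
    finally show ?thesis by (simp add: mult_ac)
  qed
  show "(\<Prod>i<k. weight i (\<omega> i)) * sum (weight k) V \<le> C * sep_const powr s * d powr s"
    unfolding m_def[symmetric]
  proof (cases "k \<in> K")
    case True
    have "sum (weight k) V \<le> (sep_const * q\<^sup>2 * d) powr s * real (A k) powr s \<or>
      sum (weight k) V \<le> (sep_const * q\<^sup>2 * d) powr s * (real (A k) powr (2 * s - 1) * real (D k) powr s)"
      unfolding q_def by (rule special_mass[OF True c V]) (rule close)
    then show "m * sum (weight k) V \<le> C * sep_const powr s * d powr s"
      using fin b2[OF True] b3[OF True] by (elim disjE) auto
  next
    case False
    obtain z z' where "0 < z" "z < 1" "0 < z'" "z' < 1" "\<bar>cf_append (c @ v1) z - cf_append (c @ v2) z'\<bar> \<le> d"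
      using close[OF V(2,3)] by blast
    from regular_mass[OF False c V this] show "m * sum (weight k) V \<le> C * sep_const powr s * d powr s"
      using fin[of 1] b1[of k] by (simp add: q_def)
  qed
qed

end


section \<open>The lower bound from the pressure\<close>

lemma eventually_linear_gt:
  fixes \<alpha> \<beta> :: real
  assumes "0 < \<alpha>"
  shows "\<forall>\<^sub>F n in sequentially. \<beta> < \<alpha> * real n"
proof -
  obtain N where N: "\<beta> / \<alpha> < real N" using reals_Archimedean2 by blast
  show ?thesis using eventually_ge_at_top[of N]
  proof eventually_elim
    case (elim n)
    then have "\<beta> / \<alpha> < real n" using N by linarith
    then show ?case using assms by (simp add: divide_less_eq mult.commute)
  qed
qed

text \<open>
Each new element is chosen so large that \<open>R\<close> relates all smaller numbers to it.
\<close>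
lemma sparse_infinite_subset:
  fixes N :: "nat set" and R :: "nat \<Rightarrow> nat \<Rightarrow> bool"
  assumes N: "infinite N" and R: "\<And>i. \<forall>\<^sub>F k in sequentially. R i k" and Q: "\<forall>\<^sub>F k in sequentially. Q k"
  obtains K where "K \<subseteq> N" "infinite K" "\<And>k. k \<in> K \<Longrightarrow> Q k" "\<And>i k. i \<in> K \<Longrightarrow> k \<in> K \<Longrightarrow> i < k \<Longrightarrow> R i k"
proof -
  have next_elem: "\<exists>k. (k \<in> N \<and> Q k) \<and> x < k \<and> (\<forall>i\<in>{..x}. R i k)" for x
  proof -
    have "\<forall>\<^sub>F k in sequentially. Q k \<and> x < k \<and> (\<forall>i\<in>{..x}. R i k)"
      by (intro eventually_conj Q eventually_gt_at_top eventually_ball_finite ballI R) simp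
    then obtain m where "\<And>k. k \<ge> m \<Longrightarrow> Q k \<and> x < k \<and> (\<forall>i\<in>{..x}. R i k)" unfolding eventually_sequentially by blast
    moreover obtain k where "k \<in> N" "k \<ge> m" using N unfolding infinite_nat_iff_unbounded_le by blast
    ultimately show ?thesis by blast
  qed
  have "\<exists>f. \<forall>n. (f n \<in> N \<and> Q (f n)) \<and> (f n < f (Suc n) \<and> (\<forall>i\<in>{..f n}. R i (f (Suc n))))"
    by (rule dependent_nat_choice) (use next_elem in blast)+
  then obtain f where f: "\<And>n. f n \<in> N" "\<And>n. Q (f n)" "\<And>n. f n < f (Suc n)"
    "\<And>n i. i \<le> f n \<Longrightarrow> R i (f (Suc n))" by auto
  have mono: "strict_mono f" using f(3) by (simp add: strict_mono_Suc_iff)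
  show ?thesis
  proof (rule that[of "range f"])
    show "range f \<subseteq> N" using f(1) by auto
    show "infinite (range f)" using mono by (simp add: strict_mono_imp_inj_on finite_image_iff)
    show "Q k" if "k \<in> range f" for k using that f(2) by auto
    show "R i k" if ik: "i \<in> range f" "k \<in> range f" "i < k" for i k
    proof -
      obtain a b where ab: "i = f a" "k = f b" using ik by auto
      then have "a < b" using ik(3) mono strict_mono_less by blast
      then obtain b' where b': "b = Suc b'" "a \<le> b'" by (cases b) auto
      have "i \<le> f b'" using b' mono ab by (simp add: strict_mono_less_eq)
      then show ?thesis using f(4) ab b' by simp
    qed
  qed
qed

lemma infinite_residue_class:
  fixes N :: "nat set"
  assumes N: "infinite N" and l: "0 < l"
  obtains r where "r < l" "infinite {k. Suc (r + k * l) \<in> N}"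
proof (rule ccontr)
  assume no_class: "\<not> thesis"
  note witness = that
  have fin: "finite {k. Suc (r + k * l) \<in> N}" if "r < l" for r
    using witness[OF that] no_class by blast
  have "N \<subseteq> insert 0 (\<Union>r\<in>{..<l}. (\<lambda>k. Suc (r + k * l)) ` {k. Suc (r + k * l) \<in> N})"
  proof
    fix n assume n: "n \<in> N"
    show "n \<in> insert 0 (\<Union>r\<in>{..<l}. (\<lambda>k. Suc (r + k * l)) ` {k. Suc (r + k * l) \<in> N})"
    proof (cases n)
      case (Suc m)
      have m: "m = m mod l + (m div l) * l" by simp
      have "n = Suc (m mod l + (m div l) * l)" using Suc m by simp
      then show ?thesis using n l by (intro insertI2 UN_I[of "m mod l"] image_eqI[of _ _ "m div l"]) simp_all
    qed simp
  qed
  moreover have "finite (insert 0 (\<Union>r\<in>{..<l}. (\<lambda>k. Suc (r + k * l)) ` {k. Suc (r + k * l) \<in> N}))"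
    using fin by simp
  ultimately show False using N finite_subset by blast
qed

text \<open>
The exponent \<open>2 s - 1\<close> changes its sign at \<open>s = 1/2\<close>; this bound covers both cases.
\<close>
lemma powr_between:
  fixes X E c t :: real
  assumes "0 < E" "E \<le> X" "X \<le> c * E" "1 \<le> c" "t \<le> 1"
  shows "X powr t \<le> c * E powr t"
proof (cases "0 \<le> t")
  case True
  have "X powr t \<le> (c * E) powr t" using assms True by (intro powr_mono2) auto
  also have "\<dots> = c powr t * E powr t" by (rule powr_mult)
  also have "\<dots> \<le> c powr 1 * E powr t" using assms by (intro mult_right_mono powr_mono) auto
  finally show ?thesis using assms by simp
next
  case False
  have "X powr t \<le> E powr t" using assms False by (intro powr_mono2') auto
  also have "\<dots> \<le> c * E powr t" using assms(4) by (simp add: mult_le_cancel_right1)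
  finally show ?thesis .
qed

text \<open>
A positive pressure beats any constant factor \<open>exp c\<close> for long words, even after \<open>l\<close> has been increased slightly. The constant
absorbs the losses from concatenating words and from the two final ones of each block.
\<close>
lemma cf_zeta_exceeds:
  assumes s: "0 < s" and P: "0 < pressure (\<lambda>x. - (s\<^sup>2) * l - s * ln \<bar>deriv gauss_map x\<bar>)"
  obtains \<epsilon>0 where "0 < \<epsilon>0"
    "\<And>c \<epsilon>. \<epsilon> \<le> \<epsilon>0 \<Longrightarrow> \<exists>p\<ge>2. ennreal (exp (c + s\<^sup>2 * (l + 2 * \<epsilon>) * real p)) < cf_zeta s p"
proof (cases "cf_zeta s 1 = \<infinity>")
  case True
  have "cf_zeta s (1 + 1) = \<infinity>"
  proof -
    have "ennreal (2 powr (- 2 * s)) * (cf_zeta s 1 * cf_zeta s 1) \<le> cf_zeta s (1 + 1)"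
      by (rule cf_zeta_add_ge) (use s in simp)
    moreover have "ennreal (2 powr (- 2 * s)) * (cf_zeta s 1 * cf_zeta s 1) = \<infinity>"
      unfolding True by (simp add: ennreal_mult_top)
    ultimately show ?thesis by (simp add: top_unique)
  qed
  then have "cf_zeta s 2 = \<infinity>" by (simp only: one_add_one)
  then show ?thesis by (intro that[of 1]) (auto intro!: exI[of _ 2])
next
  case False
  then have "cf_zeta s 1 < \<infinity>" by (simp add: less_top)
  from pressure_finite[OF less_imp_le[OF s] this, of l]
  obtain Pr where Pr: "pressure (\<lambda>x. - (s\<^sup>2) * l - s * ln \<bar>deriv gauss_map x\<bar>) = ereal Pr"
    "\<And>n. ennreal (exp (real n * (Pr + s\<^sup>2 * l) - 2 * s * ln 2)) \<le> cf_zeta s n" by metis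
  have P0: "0 < Pr" using P Pr(1) by simp
  define \<epsilon>0 where "\<epsilon>0 = Pr / (4 * s\<^sup>2)"
  show ?thesis
  proof (rule that[of \<epsilon>0])
    show "0 < \<epsilon>0" using P0 s by (simp add: \<epsilon>0_def)
    fix c \<epsilon> assume \<epsilon>: "\<epsilon> \<le> \<epsilon>0"
    have "s\<^sup>2 * (2 * \<epsilon>) \<le> s\<^sup>2 * (2 * \<epsilon>0)" using \<epsilon> by (intro mult_left_mono) auto
    also have "\<dots> = Pr / 2" using s by (simp add: \<epsilon>0_def)
    finally have e: "s\<^sup>2 * (2 * \<epsilon>) \<le> Pr / 2" .
    have "\<forall>\<^sub>F p in sequentially. c + 2 * s * ln 2 < Pr / 2 * real p \<and> 2 \<le> p"
      using P0 by (intro eventually_conj eventually_linear_gt eventually_ge_at_top) auto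
    then obtain p where p: "c + 2 * s * ln 2 < Pr / 2 * real p" "2 \<le> p" by (auto dest: eventually_happens)
    have "s\<^sup>2 * (2 * \<epsilon>) * real p \<le> Pr / 2 * real p" using e by (rule mult_right_mono) simp
    then have "c + s\<^sup>2 * (l + 2 * \<epsilon>) * real p < real p * (Pr + s\<^sup>2 * l) - 2 * s * ln 2"
      using p(1) by (simp add: algebra_simps)
    then have "ennreal (exp (c + s\<^sup>2 * (l + 2 * \<epsilon>) * real p)) < ennreal (exp (real p * (Pr + s\<^sup>2 * l) - 2 * s * ln 2))"
      by (simp add: ennreal_less_iff)
    also have "\<dots> \<le> cf_zeta s p" by (rule Pr(2))
    finally show "\<exists>p\<ge>2. ennreal (exp (c + s\<^sup>2 * (l + 2 * \<epsilon>) * real p)) < cf_zeta s p" using p(2) by blast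
  qed
qed

lemma cf_zeta_finite_subset:
  assumes "ennreal x < cf_zeta s p"
  obtains W where "finite W" "W \<subseteq> words p" "x < (\<Sum>w\<in>W. cf_den w 0 powr (- 2 * s))"
proof (cases "0 \<le> x")
  case False
  then show ?thesis by (intro that[of "{}"]) auto
next
  case True
  have "cf_zeta s p = (SUP F\<in>{F. finite F \<and> F \<subseteq> words p}. \<Sum>w\<in>F. ennreal (cf_den w 0 powr (- 2 * s)))"
    unfolding cf_zeta_def infsum_eq_nn_integral_count_space[OF countable_words, symmetric]
    by (rule nonneg_infsum_complete) simp
  with assms obtain F where F: "finite F" "F \<subseteq> words p" "ennreal x < (\<Sum>w\<in>F. ennreal (cf_den w 0 powr (- 2 * s)))"
    by (auto simp: less_SUP_iff)
  then have "ennreal x < ennreal (\<Sum>w\<in>F. cf_den w 0 powr (- 2 * s))" by (subst (asm) sum_ennreal) auto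
  then show ?thesis using True F by (intro that[of F]) (auto simp: ennreal_less_iff)
qed

text \<open>
With \<open>l1\<close> slightly larger than \<open>l\<close>, the special levels are placed at positions \<open>n\<close> with \<open>\<Phi> n \<le> exp (l1 n)\<close>, and the large digits have sizes \<open>exp (s l1 n)\<close> and
\<open>exp ((1 - s) l1 n)\<close>. The words were chosen with surplus: each ordinary block improves \<open>mass_bound\<close> by a factor that
corresponds to some \<open>l2 > l1\<close>. If the special levels are sparse enough, the blocks since the previous special level alone bring
\<open>mass_bound\<close> below \<open>exp (- s\<^sup>2 l1 n)\<close> times a constant, which pays for all losses at the special level. The inequality
\<open>s\<^sup>2 \<ge> 2 s - 1\<close> makes \<open>mass_bound\<close> return below its initial value afterwards.
\<close>
theorem exceptional_dim_ge_pressure: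
  fixes \<Phi> :: "nat \<Rightarrow> real"
  assumes lim: "filterlim \<Phi> at_top sequentially" and l: "0 < l"
    and ev: "\<And>l'. l' < l \<Longrightarrow> \<forall>\<^sub>F n in sequentially. exp (l' * real n) \<le> \<Phi> n"
    and freq: "\<And>l'. l < l' \<Longrightarrow> \<exists>\<^sub>\<infinity>n. \<Phi> n \<le> exp (l' * real n)"
    and s: "0 < s" "s < 1" and P: "0 < pressure (\<lambda>x. - (s\<^sup>2) * l - s * ln \<bar>deriv gauss_map x\<bar>)"
  shows "ennreal s \<le> hausdorff_dim (exceptional_set \<Phi>)"
proof -
  obtain \<epsilon>0 where \<epsilon>0: "0 < \<epsilon>0" "\<And>c \<epsilon>. \<epsilon> \<le> \<epsilon>0 \<Longrightarrow> \<exists>p\<ge>2. ennreal (exp (c + s\<^sup>2 * (l + 2 * \<epsilon>) * real p)) < cf_zeta s p"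
    using cf_zeta_exceeds[OF s(1) P] by blast
  define \<sigma> where "\<sigma> = max s (1 - s)"
  have \<sigma>: "0 < \<sigma>" "\<sigma> < 1" "s \<le> \<sigma>" "1 - s \<le> \<sigma>" using s by (auto simp: \<sigma>_def)
  \<comment> \<open>the second bound keeps both large digits below \<open>exp ((l - \<epsilon>) n) \<le> \<Phi> n\<close> for large \<open>n\<close>\<close>
  define \<epsilon> where "\<epsilon> = min \<epsilon>0 ((1 - \<sigma>) * l / 2)"
  have \<epsilon>: "0 < \<epsilon>" "\<epsilon> \<le> \<epsilon>0" "\<epsilon> \<le> (1 - \<sigma>) * l / 2" using \<epsilon>0(1) \<sigma> l by (auto simp: \<epsilon>_def)
  define l1 l2 l' where "l1 = l + \<epsilon>" and "l2 = l + 2 * \<epsilon>" and "l' = l - \<epsilon>"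
  have ls: "0 < l1" "l < l1" "l1 < l2" "l' < l" using l \<epsilon> by (auto simp: l1_def l2_def l'_def)
  have gap: "\<sigma> * l1 < l'"
  proof -
    have "\<sigma> * \<epsilon> < 1 * \<epsilon>" using \<sigma> \<epsilon> by (intro mult_strict_right_mono) auto
    then show ?thesis using \<epsilon>(3) by (simp add: l1_def l'_def algebra_simps)
  qed
  obtain p where p: "2 \<le> p" and big: "ennreal (exp ((s * ln 64 + 2 * s\<^sup>2 * l2) + s\<^sup>2 * l2 * real p)) < cf_zeta s p"
    using \<epsilon>0(2)[OF \<epsilon>(2), of "s * ln 64 + 2 * s\<^sup>2 * l2"] unfolding l2_def[symmetric] by blast
  obtain W where W: "finite W" "W \<subseteq> words p"
    and ZW: "exp ((s * ln 64 + 2 * s\<^sup>2 * l2) + s\<^sup>2 * l2 * real p) < (\<Sum>w\<in>W. cf_den w 0 powr (- 2 * s))"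
    by (rule cf_zeta_finite_subset[OF big])
  define Z where "Z = (\<Sum>w\<in>W. cf_den w 0 powr (- 2 * s))"
  define M where "M = Max (insert 1 (\<Union>w\<in>W. set w))"
  define L where "L = p + 2"
  have neW: "W \<noteq> {}"
  proof
    assume "W = {}"
    with ZW have "exp ((s * ln 64 + 2 * s\<^sup>2 * l2) + s\<^sup>2 * l2 * real p) < 0" by simp
    then show False using exp_gt_zero by (meson less_asym)
  qed
  have Wlen: "length w = p" "set w \<subseteq> {1..M}" if "w \<in> W" for w
  proof -
    show "length w = p" using W(2) that by (auto simp: words_def)
    have "set w \<subseteq> {1..}" using W(2) that by (auto simp: words_def)
    moreover have "a \<le> M" if "a \<in> set w" for a
      unfolding M_def using W(1) \<open>w \<in> W\<close> that by (intro Max_ge) auto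
    ultimately show "set w \<subseteq> {1..M}" by fastforce
  qed
  have Z64: "64 powr s / Z \<le> exp (- (s\<^sup>2 * l2 * real L))"
  proof -
    have "64 powr s * exp (s\<^sup>2 * l2 * real L) = exp ((s * ln 64 + 2 * s\<^sup>2 * l2) + s\<^sup>2 * l2 * real p)"
      by (simp add: powr_def L_def exp_add[symmetric] algebra_simps)
    then have "64 powr s * exp (s\<^sup>2 * l2 * real L) \<le> Z" using ZW by (simp add: Z_def)
    moreover have "0 < Z" using ZW exp_gt_zero unfolding Z_def by (meson less_trans)
    ultimately show ?thesis by (simp add: exp_minus field_simps)
  qed
  have "infinite {n. \<Phi> n \<le> exp (l1 * real n)}" using freq[OF ls(2)] by (simp add: INFM_iff_infinite)
  then obtain r where r: "r < L" "infinite {k. Suc (r + k * L) \<in> {n. \<Phi> n \<le> exp (l1 * real n)}}"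
    by (rule infinite_residue_class[of _ L]) (auto simp: L_def)
  \<comment> \<open>the position of the first digit of block \<open>k\<close>; a prefix of \<open>r\<close> digits realises the right residue class\<close>
  define pos where "pos k = Suc (r + k * L)" for k
  define c1 where "c1 = 4 * (2 ^ (p + 3)) powr (2 * s)"
  have c1: "0 < c1" by (simp add: c1_def)
  have Lpos: "0 < real L" by (simp add: L_def)
  have Rev: "\<forall>\<^sub>F k in sequentially. l1 * real (pos k) \<le> l2 * real L * (real k - real i - 1)" for i
  proof -
    have "\<forall>\<^sub>F k in sequentially. l1 * (real r + 1) + l2 * real L * (real i + 1) < (l2 - l1) * real L * real k"
      using ls Lpos by (intro eventually_linear_gt) auto
    then show ?thesis by eventually_elim (simp add: pos_def algebra_simps)
  qed
  have Qev: "\<forall>\<^sub>F k in sequentially. l1 * real (pos k) \<le> l2 * real L * real k \<and> ln c1 < (1 - s)\<^sup>2 * l1 * real (pos k)"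
  proof (intro eventually_conj)
    show "\<forall>\<^sub>F k in sequentially. l1 * real (pos k) \<le> l2 * real L * real k"
      using Rev[of 0]
    proof eventually_elim
      case (elim k)
      have "l2 * real L * (real k - real 0 - 1) \<le> l2 * real L * real k" using ls Lpos by (intro mult_left_mono) auto
      then show ?case using elim by linarith
    qed
    have "\<forall>\<^sub>F k in sequentially. ln c1 < (1 - s)\<^sup>2 * l1 * real k"
      using s ls by (intro eventually_linear_gt) auto
    then show "\<forall>\<^sub>F k in sequentially. ln c1 < (1 - s)\<^sup>2 * l1 * real (pos k)"
    proof eventually_elim
      case (elim k)
      have "real k \<le> real (pos k)" unfolding pos_def of_nat_le_iff by (simp add: L_def)
      then have "(1 - s)\<^sup>2 * l1 * real k \<le> (1 - s)\<^sup>2 * l1 * real (pos k)" using ls by (intro mult_left_mono) auto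
      then show ?case using elim by linarith
    qed
  qed
  obtain K where K: "K \<subseteq> {k. Suc (r + k * L) \<in> {n. \<Phi> n \<le> exp (l1 * real n)}}" "infinite K"
    "\<And>k. k \<in> K \<Longrightarrow> l1 * real (pos k) \<le> l2 * real L * real k \<and> ln c1 < (1 - s)\<^sup>2 * l1 * real (pos k)"
    "\<And>i k. i \<in> K \<Longrightarrow> k \<in> K \<Longrightarrow> i < k \<Longrightarrow> l1 * real (pos k) \<le> l2 * real L * (real k - real i - 1)"
    by (rule sparse_infinite_subset[where R = "\<lambda>i k. l1 * real (pos k) \<le> l2 * real L * (real k - real i - 1)", OF r(2) Rev Qev]) blast
  define A where "A k = nat \<lceil>exp (s * l1 * real (pos k))\<rceil>" for k
  define D where "D k = nat \<lceil>exp ((1 - s) * l1 * real (pos k))\<rceil>" for k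
  have ceil: "2 \<le> nat \<lceil>exp t\<rceil> \<and> exp t \<le> real (nat \<lceil>exp t\<rceil>) \<and> real (nat \<lceil>exp t\<rceil>) \<le> 2 * exp t" if "0 < t" for t :: real
  proof -
    have e1: "1 < exp t" using that by simp
    have a: "real (nat \<lceil>exp t\<rceil>) = of_int \<lceil>exp t\<rceil>" using e1 by (simp add: less_imp_le order_trans[OF _ le_of_int_ceiling])
    have "1 < \<lceil>exp t\<rceil>" using e1 by (simp add: less_ceiling_iff)
    then have "2 \<le> nat \<lceil>exp t\<rceil>" by linarith
    moreover have "exp t \<le> of_int \<lceil>exp t\<rceil>" "of_int \<lceil>exp t\<rceil> < exp t + 1" by linarith+
    ultimately show ?thesis using a e1 by linarith
  qed
  have pos0: "0 < real (pos k)" for k unfolding pos_def of_nat_0_less_iff by simp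
  have A_bounds: "2 \<le> A k" "exp (s * l1 * real (pos k)) \<le> real (A k)" "real (A k) \<le> 2 * exp (s * l1 * real (pos k))" for k
    using ceil[of "s * l1 * real (pos k)"] s ls pos0[of k] by (auto simp: A_def)
  have D_bounds: "2 \<le> D k" "exp ((1 - s) * l1 * real (pos k)) \<le> real (D k)" "real (D k) \<le> 2 * exp ((1 - s) * l1 * real (pos k))" for k
    using ceil[of "(1 - s) * l1 * real (pos k)"] s ls pos0[of k] by (auto simp: D_def)
  have AD: "exp (l1 * real (pos k)) \<le> real (A k) * real (D k)" "real (A k) * real (D k) \<le> 4 * exp (l1 * real (pos k))" for k
  proof -
    have e: "exp (s * l1 * real (pos k)) * exp ((1 - s) * l1 * real (pos k)) = exp (l1 * real (pos k))"
      by (simp add: exp_add[symmetric] algebra_simps)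
    show "exp (l1 * real (pos k)) \<le> real (A k) * real (D k)"
      unfolding e[symmetric] using A_bounds[of k] D_bounds[of k] by (intro mult_mono) auto
    have "real (A k) * real (D k) \<le> (2 * exp (s * l1 * real (pos k))) * (2 * exp ((1 - s) * l1 * real (pos k)))"
      using A_bounds[of k] D_bounds[of k] by (intro mult_mono) auto
    then show "real (A k) * real (D k) \<le> 4 * exp (l1 * real (pos k))" unfolding e[symmetric] by simp
  qed
  define pre where "pre = replicate r (1::nat)"
  interpret block_construction W p M pre K A D s Z
    by unfold_locales (use W neW Wlen p A_bounds(1) D_bounds(1) s in \<open>auto simp: pre_def Z_def\<close>)
  define K2 where "K2 = cf_den pre 0 powr (2 * s)"
  have K2: "0 < K2" using cf_den_pos[OF pre, of 0] by (simp add: K2_def)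
  define \<rho> where "\<rho> = exp (- (s\<^sup>2 * l2 * real L))"
  have \<rho>: "0 < \<rho>" "\<rho> \<le> 1" using ls Lpos by (auto simp: \<rho>_def)
  have \<rho>pow: "\<rho> ^ j = exp (- (s\<^sup>2 * (l2 * real L * real j)))" for j
    by (simp add: \<rho>_def exp_of_nat_mult[symmetric] mult_ac)
  \<comment> \<open>before each special level there are enough consecutive ordinary levels\<close>
  have jump: "\<exists>j\<le>k. (\<forall>i. k - j \<le> i \<and> i < k \<longrightarrow> i \<notin> K) \<and> l1 * real (pos k) \<le> l2 * real L * real j" if k: "k \<in> K" for k
  proof (cases "\<exists>i\<in>K. i < k")
    case False
    then show ?thesis using K(3)[OF k] by (intro exI[of _ k]) auto
  next
    case True
    define i where "i = Max {i \<in> K. i < k}"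
    have fin: "finite {i \<in> K. i < k}" by simp
    have "i \<in> {i \<in> K. i < k}" unfolding i_def using True by (intro Max_in fin) auto
    then have i: "i \<in> K" "i < k" by auto
    have max: "i' \<le> i" if "i' \<in> K" "i' < k" for i' unfolding i_def using that by (intro Max_ge fin) auto
    show ?thesis
    proof (intro exI[of _ "k - i - 1"] conjI allI impI notI)
      fix i' assume "k - (k - i - 1) \<le> i' \<and> i' < k" "i' \<in> K"
      then show False using max[of i'] i by auto
    next
      have "real (k - i - 1) = real k - real i - 1" using i by (simp add: of_nat_diff)
      then show "l1 * real (pos k) \<le> l2 * real L * real (k - i - 1)" using K(4)[OF i(1) k i(2)] by simp
    qed simp
  qed
  have decay: "mass_bound k \<le> K2 * \<rho> ^ j" if "j \<le> k" "\<forall>i. k - j \<le> i \<and> i < k \<longrightarrow> i \<notin> K" for k j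
    using that
  proof (induction k arbitrary: j)
    case 0 then show ?case by (simp add: K2_def)
  next
    case (Suc k)
    show ?case
    proof (cases "k \<in> K")
      case False
      have "mass_bound (Suc k) = mass_bound k * (64 powr s / Z)" using False by simp
      also have "\<dots> \<le> mass_bound k * \<rho>"
        unfolding \<rho>_def by (intro mult_left_mono Z64 mass_bound_nonneg)
      also have "\<dots> \<le> K2 * \<rho> ^ j"
      proof (cases j)
        case 0
        have "mass_bound k \<le> K2 * \<rho> ^ 0" by (rule Suc.IH) auto
        then have "mass_bound k * \<rho> \<le> K2 * 1" using \<rho> K2 by (intro mult_mono) auto
        then show ?thesis using 0 by simp
      next
        case j: (Suc j')
        have "mass_bound k \<le> K2 * \<rho> ^ j'" using Suc.prems j by (intro Suc.IH) auto
        then have "mass_bound k * \<rho> \<le> K2 * \<rho> ^ j' * \<rho>" using \<rho> by (intro mult_right_mono) auto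
        then show ?thesis using j by (simp add: mult_ac)
      qed
      finally show ?thesis .
    next
      case True
      have j0: "j = 0"
      proof (rule ccontr)
        assume "j \<noteq> 0"
        then have "Suc k - j \<le> k" by simp
        then show False using Suc.prems(2) True by blast
      qed
      obtain i where i: "i \<le> k" "\<forall>i'. k - i \<le> i' \<and> i' < k \<longrightarrow> i' \<notin> K" "l1 * real (pos k) \<le> l2 * real L * real i"
        using jump[OF True] by blast
      have "mass_bound k \<le> K2 * \<rho> ^ i" by (rule Suc.IH[OF i(1,2)])
      also have "\<rho> ^ i \<le> exp (- (s\<^sup>2 * (l1 * real (pos k))))"
        unfolding \<rho>pow using i(3) by (simp add: mult_left_mono)
      finally have h: "mass_bound k \<le> K2 * exp (- (s\<^sup>2 * (l1 * real (pos k))))" using K2 by simp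
      have x: "(real (A k) * real (D k)) powr (2 * s - 1) \<le> 4 * exp ((2 * s - 1) * (l1 * real (pos k)))"
        using powr_between[OF _ AD(1)[of k] AD(2)[of k], of "2 * s - 1"] s by (simp add: powr_def)
      have "mass_bound (Suc k) = mass_bound k * ((real (A k) * real (D k)) powr (2 * s - 1) * (2 ^ (p + 3)) powr (2 * s))"
        using True by simp
      also have "\<dots> \<le> (K2 * exp (- (s\<^sup>2 * (l1 * real (pos k))))) * ((4 * exp ((2 * s - 1) * (l1 * real (pos k)))) * (2 ^ (p + 3)) powr (2 * s))"
        using h x mass_bound_nonneg[of k] K2 by (intro mult_mono mult_nonneg_nonneg) auto
      also have "\<dots> = K2 * (c1 * (exp (- (s\<^sup>2 * (l1 * real (pos k)))) * exp ((2 * s - 1) * (l1 * real (pos k)))))"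
        by (simp add: c1_def mult_ac)
      also have "exp (- (s\<^sup>2 * (l1 * real (pos k)))) * exp ((2 * s - 1) * (l1 * real (pos k))) = exp (- ((1 - s)\<^sup>2 * l1 * real (pos k)))"
        by (simp add: exp_add[symmetric] power2_eq_square algebra_simps)
      also have "c1 * exp (- ((1 - s)\<^sup>2 * l1 * real (pos k))) \<le> 1"
      proof -
        have "exp (ln c1) \<le> exp ((1 - s)\<^sup>2 * l1 * real (pos k))" using K(3)[OF True, THEN conjunct2] by (simp only: exp_le_cancel_iff less_imp_le)
        then have "c1 \<le> exp ((1 - s)\<^sup>2 * l1 * real (pos k))" using c1 by simp
        then show ?thesis by (simp add: exp_minus field_simps)
      qed
      finally show ?thesis using K2 j0 by simp
    qed
  qed
  have mb: "mass_bound k \<le> K2" for k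
  proof -
    have "mass_bound k \<le> K2 * \<rho> ^ 0" by (rule decay) auto
    then show ?thesis by simp
  qed
  have mbK: "mass_bound k \<le> K2 * exp (- (s\<^sup>2 * (l1 * real (pos k))))" if k: "k \<in> K" for k
  proof -
    obtain i where i: "i \<le> k" "\<forall>i'. k - i \<le> i' \<and> i' < k \<longrightarrow> i' \<notin> K" "l1 * real (pos k) \<le> l2 * real L * real i"
      using jump[OF k] by blast
    have "mass_bound k \<le> K2 * \<rho> ^ i" by (rule decay[OF i(1,2)])
    also have "\<rho> ^ i \<le> exp (- (s\<^sup>2 * (l1 * real (pos k))))"
      unfolding \<rho>pow using i(3) by (simp add: mult_left_mono)
    finally show ?thesis using K2 by simp
  qed
  have "ennreal s \<le> hausdorff_dim (rep_point ` Pi UNIV blocks)"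
  proof (rule block_set_dim)
    show "0 < 4 * K2" using K2 by simp
    show "mass_bound k \<le> 4 * K2" for k using mb[of k] K2 by linarith
    fix k assume k: "k \<in> K"
    define t where "t = l1 * real (pos k)"
    note h = mbK[OF k, folded t_def]
    have As: "real (A k) powr s \<le> 2 * exp (s * (s * t))"
      using powr_between[OF _ A_bounds(2)[of k] A_bounds(3)[of k], of s] s by (simp add: powr_def t_def mult_ac)
    have A2s: "real (A k) powr (2 * s - 1) \<le> 2 * exp ((2 * s - 1) * (s * t))"
      using powr_between[OF _ A_bounds(2)[of k] A_bounds(3)[of k], of "2 * s - 1"] s by (simp add: powr_def t_def mult_ac)
    have Ds: "real (D k) powr s \<le> 2 * exp (s * ((1 - s) * t))"
      using powr_between[OF _ D_bounds(2)[of k] D_bounds(3)[of k], of s] s by (simp add: powr_def t_def mult_ac)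
    have "mass_bound k * real (A k) powr s \<le> (K2 * exp (- (s\<^sup>2 * t))) * (2 * exp (s * (s * t)))"
      using h As mass_bound_nonneg[of k] K2 by (intro mult_mono) auto
    also have "\<dots> = 2 * K2 * exp (- (s\<^sup>2 * t) + s * (s * t))" by (simp only: exp_add mult_ac)
    also have "\<dots> = 2 * K2" by (simp add: power2_eq_square)
    finally show "mass_bound k * real (A k) powr s \<le> 4 * K2" using K2 by linarith
    have "mass_bound k * (real (A k) powr (2 * s - 1) * real (D k) powr s)
       \<le> (K2 * exp (- (s\<^sup>2 * t))) * ((2 * exp ((2 * s - 1) * (s * t))) * (2 * exp (s * ((1 - s) * t))))"
      using h A2s Ds mass_bound_nonneg[of k] K2 by (intro mult_mono mult_nonneg_nonneg) auto
    also have "\<dots> = 4 * K2 * exp (- (s\<^sup>2 * t) + (2 * s - 1) * (s * t) + s * ((1 - s) * t))" unfolding exp_add by simp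
    also have "- (s\<^sup>2 * t) + (2 * s - 1) * (s * t) + s * ((1 - s) * t) = 0" by (simp add: power2_eq_square algebra_simps)
    finally show "mass_bound k * (real (A k) powr (2 * s - 1) * real (D k) powr s) \<le> 4 * K2" by simp
  qed
  also have "\<dots> \<le> hausdorff_dim (exceptional_set \<Phi>)"
  proof (rule hausdorff_dim_mono, clarify)
    fix \<omega> assume \<omega>: "\<omega> \<in> Pi UNIV blocks"
    define x where "x = rep_point \<omega>"
    note v = valid_Pi[OF \<omega>]
    have pq: "partial_quotient (Suc (r + k * L + i)) x = \<omega> k ! i" if "i < L" for k i
      using partial_quotient_block[OF v pre _ that, of k] block_props(1) \<omega> unfolding x_def rep_point_def
      by (auto simp: pre_def L_def Pi_iff)
    have "x \<in> {0..<1}"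
      using cf_append_less_1[OF pre] cf_limit_open_bounds[OF v] by (auto simp: x_def rep_point_def cf_append_nonneg)
    moreover have "\<exists>\<^sub>\<infinity>n. \<Phi> n \<le> real (partial_quotient (n + 1) x) * real (partial_quotient n x)"
      unfolding INFM_nat_le
    proof
      fix m
      obtain k where k: "k \<in> K" "m \<le> k" using K(2) unfolding infinite_nat_iff_unbounded_le by blast
      obtain a b where ab: "\<omega> k = a # b # replicate p 1" "A k \<le> a" "D k \<le> b"
        by (rule special_blockE[OF k(1), of "\<omega> k"]) (use \<omega> in auto)
      have a: "partial_quotient (pos k) x = a" using pq[of 0 k] ab by (simp add: pos_def L_def)
      have b: "partial_quotient (pos k + 1) x = b" using pq[of 1 k] ab by (simp add: pos_def L_def)
      have "\<Phi> (pos k) \<le> exp (l1 * real (pos k))" using K(1) k(1) by (auto simp: pos_def)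
      also have "\<dots> \<le> real (A k) * real (D k)" by (rule AD)
      also have "\<dots> \<le> real a * real b" using ab by (intro mult_mono) auto
      finally have "\<Phi> (pos k) \<le> real (partial_quotient (pos k + 1) x) * real (partial_quotient (pos k) x)"
        by (simp only: a b mult.commute)
      moreover have "k * 1 \<le> k * L" by (intro mult_le_mono2) (simp add: L_def)
      then have "m \<le> pos k" using k(2) unfolding pos_def by linarith
      ultimately show "\<exists>n\<ge>m. \<Phi> n \<le> real (partial_quotient (n + 1) x) * real (partial_quotient n x)" by blast
    qed
    moreover have "\<forall>\<^sub>F n in sequentially. real (partial_quotient (n + 1) x) < \<Phi> n"
    proof -
      have "\<forall>\<^sub>F n in sequentially. ln 4 + \<sigma> * l1 < (l' - \<sigma> * l1) * real n"
        using gap by (intro eventually_linear_gt) auto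
      moreover have "\<forall>\<^sub>F n in sequentially. real M < \<Phi> n" using lim by (simp add: filterlim_at_top_dense)
      ultimately show ?thesis using ev[OF ls(4)] eventually_ge_at_top[of r]
      proof eventually_elim
        case (elim n)
        define k i where "k = (n - r) div L" and "i = (n - r) mod L"
        have iL: "i < L" by (simp add: i_def L_def)
        have n: "n = r + k * L + i" using elim(4) by (simp add: k_def i_def)
        have q: "partial_quotient (n + 1) x = \<omega> k ! i" using pq[OF iL, of k] n by simp
        have large: "4 * exp (\<sigma> * l1 * (real n + 1)) < \<Phi> n"
        proof -
          have "ln 4 + \<sigma> * l1 * (real n + 1) < l' * real n" using elim(1) by (simp add: algebra_simps)
          then have "exp (ln 4 + \<sigma> * l1 * (real n + 1)) < exp (l' * real n)" by simp
          then show ?thesis using elim(3) by (simp add: exp_add)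
        qed
        have posn: "real (pos k) \<le> real n + 1" unfolding pos_def n by simp
        have M1': "1 \<le> real M" using M1 by simp
        show ?case
        proof (cases "k \<in> K")
          case False
          have "\<omega> k \<in> blocks k" using \<omega> by auto
          then have "\<omega> k \<in> (\<lambda>w. w @ [1, 1]) ` W" unfolding blocks_def if_not_P[OF False] .
          then obtain w where w: "\<omega> k = w @ [1, 1]" "w \<in> W" by blast
          have "\<omega> k ! i \<in> set (\<omega> k)" using iL w Wlen(1)[OF w(2)] by (intro nth_mem) (simp add: L_def)
          then have "\<omega> k ! i \<le> M" using w Wlen(2)[OF w(2)] M1 by auto
          then show ?thesis using q elim(2) by simp
        next
          case True
          obtain a b where ab: "\<omega> k = a # b # replicate p 1" "a < 2 * A k" "b < 2 * D k"
            by (rule special_blockE[OF True, of "\<omega> k"]) (use \<omega> in auto)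
          consider "i = 0" | "i = 1" | i' where "i = Suc (Suc i')" "i' < p" using iL unfolding L_def
            by (metis One_nat_def Suc_less_eq add_2_eq_Suc' less_Suc_eq_0_disj)
          then show ?thesis
          proof cases
            case 1
            have "real a \<le> 2 * real (A k)" using ab(2) by linarith
            also have "\<dots> \<le> 4 * exp (s * l1 * real (pos k))" using A_bounds(3)[of k] by simp
            also have "s * l1 * real (pos k) \<le> \<sigma> * l1 * (real n + 1)"
              using \<sigma> ls posn s by (intro mult_mono) auto
            finally show ?thesis using q 1 ab large by simp
          next
            case 2
            have "real b \<le> 2 * real (D k)" using ab(3) by linarith
            also have "\<dots> \<le> 4 * exp ((1 - s) * l1 * real (pos k))" using D_bounds(3)[of k] by simp
            also have "(1 - s) * l1 * real (pos k) \<le> \<sigma> * l1 * (real n + 1)"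
              using \<sigma> ls posn s by (intro mult_mono) auto
            finally show ?thesis using q 2 ab large by simp
          next
            case 3
            then show ?thesis using q ab elim(2) M1' by simp
          qed
        qed
      qed
    qed
    ultimately show "rep_point \<omega> \<in> exceptional_set \<Phi>"
      unfolding x_def[symmetric] exceptional_set_def cofinite_eq_sequentially by simp
  qed
  finally show ?thesis .
qed


section \<open>The dimension formula\<close>

text \<open>
Since \<open>cf_zeta 1 n \<le> 2\<close> for all \<open>n\<close>, the pressure at 1 is at most \<open>- l\<close>.
\<close>
lemma pressure_at_1:
  assumes "0 < l"
  shows "pressure (\<lambda>x. - (1\<^sup>2) * l - 1 * ln \<bar>deriv gauss_map x\<bar>) \<le> 0"
proof -
  have "cf_zeta 1 1 < \<infinity>" using cf_zeta_1_le[of 1] by (rule le_less_trans) simp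
  from pressure_finite[OF _ this, of l] obtain P where
    P: "pressure (\<lambda>x. - (1\<^sup>2) * l - 1 * ln \<bar>deriv gauss_map x\<bar>) = ereal P"
    and z: "\<And>n. ennreal (exp (real n * (P + 1\<^sup>2 * l) - 2 * 1 * ln 2)) \<le> cf_zeta 1 n"
    by (metis zero_le_one)
  have "P + l \<le> 0"
  proof (rule ccontr)
    assume "\<not> P + l \<le> 0"
    then have "\<forall>\<^sub>F n in sequentially. 3 * ln 2 < (P + l) * real n" by (intro eventually_linear_gt) auto
    then obtain n where n: "3 * ln 2 < (P + l) * real n" by (auto dest: eventually_happens)
    have "ennreal (exp (real n * (P + 1\<^sup>2 * l) - 2 * 1 * ln 2)) \<le> ennreal 2"
      using order_trans[OF z cf_zeta_1_le, of n] by simp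
    then have "exp (real n * (P + 1\<^sup>2 * l) - 2 * 1 * ln 2) \<le> 2"
      by (simp only: ennreal_le_iff zero_le_numeral)
    then have "exp (real n * (P + l) - 2 * ln 2) \<le> exp (ln 2)" by simp
    then have "real n * (P + l) - 2 * ln 2 \<le> ln 2" by (simp only: exp_le_cancel_iff)
    then show False using n by (simp add: mult.commute)
  qed
  then show ?thesis using P assms by simp
qed

lemma less_liminf_ratio:
  fixes f :: "nat \<Rightarrow> real"
  assumes "ereal y < liminf (\<lambda>n. ereal (f n / real n))"
  shows "\<forall>\<^sub>F n in sequentially. y * real n < f n"
  using less_LiminfD[OF assms] eventually_gt_at_top[of 0]
  by eventually_elim (simp add: less_divide_eq)

lemma liminf_ratio_less:
  fixes f :: "nat \<Rightarrow> real"
  assumes "liminf (\<lambda>n. ereal (f n / real n)) < ereal y"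
  shows "\<exists>\<^sub>\<infinity>n. f n < y * real n"
proof (rule ccontr)
  assume "\<not> (\<exists>\<^sub>\<infinity>n. f n < y * real n)"
  then have "\<forall>\<^sub>F n in sequentially. \<not> f n < y * real n"
    by (simp add: not_frequently cofinite_eq_sequentially)
  with eventually_gt_at_top[of 0] have "\<forall>\<^sub>F n in sequentially. ereal y \<le> ereal (f n / real n)"
    by eventually_elim (simp add: le_divide_eq)
  then have "ereal y \<le> liminf (\<lambda>n. ereal (f n / real n))" by (rule Liminf_bounded)
  with assms show False by simp
qed

text \<open>
The linear factor is absorbed by the strict inequality \<open>c < d\<close>.
\<close>
lemma geometric_dominates:
  fixes c d C K :: real
  assumes "0 < c" "c < d"
  shows "\<forall>\<^sub>F n in sequentially. c ^ n * (C + real n * K) < d ^ n"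
proof -
  define q where "q = c / d"
  have q: "0 < q" "q < 1" using assms by (auto simp: q_def)
  have "(\<lambda>n. C * q ^ n + K * (real n * q ^ n)) \<longlonglongrightarrow> C * 0 + K * 0"
    using q by (intro tendsto_add tendsto_mult tendsto_const LIMSEQ_power_zero powser_times_n_limit_0) auto
  then have "\<forall>\<^sub>F n in sequentially. C * q ^ n + K * (real n * q ^ n) < 1"
    by (intro order_tendstoD(2)) auto
  then show ?thesis
  proof eventually_elim
    case (elim n)
    have dn: "0 < d ^ n" using assms by simp
    have "c ^ n = q ^ n * d ^ n" using assms by (simp add: q_def power_divide)
    then have "c ^ n * (C + real n * K) = (C * q ^ n + K * (real n * q ^ n)) * d ^ n" by (simp add: algebra_simps)
    also have "\<dots> < 1 * d ^ n" using elim dn by (rule mult_strict_right_mono)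
    finally show ?case by simp
  qed
qed

text \<open>
Between the two sides of a hypothetical strict inequality lies some \<open>s < 1\<close> with positive pressure, and for such \<open>s\<close> the lower bound applies.
\<close>
theorem exceptional_dim_finite_B:
  fixes \<Phi> :: "nat \<Rightarrow> real"
  assumes \<Phi>: "\<forall>n\<ge>1. \<Phi> n > 1" and lim: "filterlim \<Phi> at_top sequentially" and B: "1 < B"
    and liminf: "liminf (\<lambda>n. ereal (ln (\<Phi> n) / real n)) = ereal (ln B)"
  shows "hausdorff_dim (exceptional_set \<Phi>) = dimensional_number B"
proof -
  define l where "l = ln B"
  have l: "0 < l" using B by (simp add: l_def)
  have ev: "\<forall>\<^sub>F n in sequentially. exp (l' * real n) \<le> \<Phi> n" if "l' < l" for l'
  proof -
    have "\<forall>\<^sub>F n in sequentially. l' * real n < ln (\<Phi> n)"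
      using that by (intro less_liminf_ratio) (simp add: liminf l_def)
    with eventually_ge_at_top[of 1] show ?thesis
    proof eventually_elim
      case (elim n)
      have "1 < \<Phi> n" using \<Phi> elim(1) by simp
      then show ?case using elim(2) by (simp add: ln_ge_iff[symmetric])
    qed
  qed
  have freq: "\<exists>\<^sub>\<infinity>n. \<Phi> n \<le> exp (l' * real n)" if "l < l'" for l'
  proof -
    have "\<exists>\<^sub>\<infinity>n. ln (\<Phi> n) < l' * real n"
      using that by (intro liminf_ratio_less) (simp add: liminf l_def)
    moreover have "\<forall>\<^sub>\<infinity>n::nat. 1 \<le> n" unfolding cofinite_eq_sequentially by (rule eventually_ge_at_top)
    ultimately have "\<exists>\<^sub>\<infinity>n. ln (\<Phi> n) < l' * real n \<and> 1 \<le> n" by (rule INFM_conjI)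
    then show ?thesis
    proof (rule INFM_mono)
      fix n assume n: "ln (\<Phi> n) < l' * real n \<and> 1 \<le> n"
      then have "0 < \<Phi> n" using \<Phi> by (meson less_trans zero_less_one)
      then have "\<Phi> n = exp (ln (\<Phi> n))" by simp
      also have "\<dots> \<le> exp (l' * real n)" using n by simp
      finally show "\<Phi> n \<le> exp (l' * real n)" .
    qed
  qed
  let ?P = "\<lambda>s. pressure (\<lambda>x. - (s\<^sup>2) * l - s * ln \<bar>deriv gauss_map x\<bar>)"
  have dn: "dimensional_number B = Inf {ennreal s | s. 0 \<le> s \<and> ?P s \<le> 0}"
    by (simp add: dimensional_number_def l_def)
  show ?thesis
  proof (rule antisym)
    show "hausdorff_dim (exceptional_set \<Phi>) \<le> dimensional_number B"
      unfolding dn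
    proof (rule Inf_greatest)
      fix y assume "y \<in> {ennreal s | s. 0 \<le> s \<and> ?P s \<le> 0}"
      then obtain s where "y = ennreal s" "0 \<le> s" "?P s \<le> 0" by blast
      then show "hausdorff_dim (exceptional_set \<Phi>) \<le> y"
        using exceptional_dim_le_pressure[OF \<Phi> l ev] by simp
    qed
    show "dimensional_number B \<le> hausdorff_dim (exceptional_set \<Phi>)"
    proof (rule ccontr)
      assume "\<not> dimensional_number B \<le> hausdorff_dim (exceptional_set \<Phi>)"
      then obtain y where y: "hausdorff_dim (exceptional_set \<Phi>) < y" "y < dimensional_number B"
        using dense by (auto simp: not_le)
      have "dimensional_number B \<le> ennreal 1"
        unfolding dn using pressure_at_1[OF l] by (intro Inf_lower CollectI exI[of _ 1]) auto
      with y(2) have "y < ennreal 1" by (rule less_le_trans)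
      then obtain s where s: "y = ennreal s" "0 \<le> s" "s < 1"
        by (cases y) (auto simp: ennreal_less_iff)
      have "0 < s" using y(1) s by (cases "s = 0") auto
      have "\<not> ?P s \<le> 0"
      proof
        assume "?P s \<le> 0"
        then have "dimensional_number B \<le> ennreal s" unfolding dn using s(2) by (intro Inf_lower) blast
        then show False using y(2) s(1) by simp
      qed
      then have "0 < ?P s" by simp
      from exceptional_dim_ge_pressure[OF lim l ev freq \<open>0 < s\<close> s(3) this]
      show False using y(1) s(1) by simp
    qed
  qed
qed

text \<open>
Since \<open>B\<close> is infinite, \<open>b \<ge> 1\<close>. The upper bound \<open>1 / (1 + c)\<close> holds for \<open>1 \<le> c < b\<close>, and for \<open>c = 1\<close> even if \<open>b = 1\<close>;
the lower bound holds for every \<open>\<beta> > b\<close>.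
\<close>
theorem exceptional_dim_infinite_B:
  fixes \<Phi> :: "nat \<Rightarrow> real" and b :: ennreal
  assumes \<Phi>: "\<forall>n\<ge>1. \<Phi> n > 1" and lim: "filterlim \<Phi> at_top sequentially"
    and B: "liminf (\<lambda>n. ereal (ln (\<Phi> n) / real n)) = \<infinity>"
    and b: "ln_ennreal b = liminf (\<lambda>n. ereal (ln (ln (\<Phi> n)) / real n))"
  shows "hausdorff_dim (exceptional_set \<Phi>) = 1 / (1 + b)"
proof -
  let ?D = "hausdorff_dim (exceptional_set \<Phi>)"
  have evB: "\<forall>\<^sub>F n in sequentially. y * real n < ln (\<Phi> n)" for y
    by (rule less_liminf_ratio) (simp add: B)
  have lnpos: "0 < ln (\<Phi> n)" if "1 \<le> n" for n
  proof -
    have "1 < \<Phi> n" using \<Phi> that by blast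
    then show ?thesis by simp
  qed
  have "0 \<le> ln_ennreal b" unfolding b
  proof (rule Liminf_bounded)
    show "\<forall>\<^sub>F n in sequentially. 0 \<le> ereal (ln (ln (\<Phi> n)) / real n)"
      using evB[of 1] eventually_ge_at_top[of 1]
    proof eventually_elim
      case (elim n)
      then have "1 \<le> ln (\<Phi> n)" by linarith
      then show ?case by simp
    qed
  qed
  then have b1: "b = \<infinity> \<or> (\<exists>\<beta>\<ge>1. b = ennreal \<beta> \<and> ln_ennreal b = ereal (ln \<beta>))"
  proof (cases b)
    case (real r)
    have "b \<noteq> 0" using \<open>0 \<le> ln_ennreal b\<close> by (auto simp: ln_ennreal_def)
    then have "0 < r" using real by (cases "r = 0") auto
    then have e: "ln_ennreal b = ereal (ln r)" using real by (simp add: ln_ennreal_def ennreal_eq_0_iff)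
    then have "1 \<le> r" using \<open>0 \<le> ln_ennreal b\<close> \<open>0 < r\<close> by simp
    then show ?thesis using e real by blast
  qed simp
  have up: "?D \<le> ennreal (1 / (1 + c))" if c: "1 \<le> c" "c = 1 \<or> ereal (ln c) < ln_ennreal b" for c
  proof (rule exceptional_dim_le_growth[OF \<Phi> c(1)])
    fix C K :: real
    show "\<forall>\<^sub>F n in sequentially. c ^ n * (C + real n * K) < ln (\<Phi> n)"
    proof (cases "c = 1")
      case True
      have "\<forall>\<^sub>F n in sequentially. C < 1 * real n" by (rule eventually_linear_gt) simp
      with evB[of "K + 1"] show ?thesis by eventually_elim (simp add: True algebra_simps)
    next
      case False
      then obtain y where y: "ereal (ln c) < y" "y < ln_ennreal b" using c dense by blast
      then obtain y' where y': "y = ereal y'" by (cases y) auto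
      have "ln c < y'" using y(1) by (simp add: y')
      then have cy: "c < exp y'" using c(1) by (metis exp_less_cancel_iff exp_ln less_le_trans zero_less_one)
      have "\<forall>\<^sub>F n in sequentially. y' * real n < ln (ln (\<Phi> n))"
        using y(2) unfolding y' b by (rule less_liminf_ratio)
      with eventually_ge_at_top[of 1] geometric_dominates[of c "exp y'" C K] c(1) cy
      have "\<forall>\<^sub>F n in sequentially. y' * real n < ln (ln (\<Phi> n)) \<and> 1 \<le> n \<and> c ^ n * (C + real n * K) < exp y' ^ n"
        by (intro eventually_conj) auto
      then show ?thesis
      proof eventually_elim
        case (elim n)
        have "exp y' ^ n = exp (y' * real n)" by (simp add: exp_of_nat_mult[symmetric] mult.commute)
        also have "\<dots> < exp (ln (ln (\<Phi> n)))" using elim by simp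
        also have "\<dots> = ln (\<Phi> n)" using lnpos elim by simp
        finally show ?case using elim by simp
      qed
    qed
  qed
  have "?D \<le> ennreal (1 / (1 + 1))" by (rule up) auto
  then have "?D < \<infinity>"
    by (rule le_less_trans) (simp only: infinity_ennreal_def ennreal_less_top)
  then obtain d where d: "?D = ennreal d" "0 \<le> d" by (cases ?D) auto
  have dup: "d * (1 + c) \<le> 1" if c: "1 \<le> c" "c = 1 \<or> ereal (ln c) < ln_ennreal b" for c
  proof -
    have "d \<le> 1 / (1 + c)" using up[OF c] d c(1) by simp
    then show ?thesis using c(1) by (simp add: field_simps)
  qed
  from b1 show ?thesis
  proof (elim disjE exE conjE)
    assume binf: "b = \<infinity>"
    have "d = 0"
    proof (rule ccontr)
      assume "d \<noteq> 0"
      then have "0 < d" using d by simp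
      have "d * (1 + max 1 (1 / d)) \<le> 1" by (rule dup) (auto simp: binf ln_ennreal_def)
      moreover have "d * (1 / d) \<le> d * max 1 (1 / d)" using \<open>0 < d\<close> by (intro mult_left_mono) auto
      ultimately show False using \<open>0 < d\<close> by (simp add: distrib_left)
    qed
    then show ?thesis using d binf by simp
  next
    fix \<beta> assume \<beta>: "1 \<le> \<beta>" "b = ennreal \<beta>" "ln_ennreal b = ereal (ln \<beta>)"
    have "d * (1 + \<beta>) \<le> 1"
    proof (cases "\<beta> = 1")
      case True then show ?thesis using dup[of 1] by simp
    next
      case False
      have "d * \<beta> \<le> 1 - d"
      \<comment> \<open>approach \<open>\<beta>\<close> from below by \<open>z \<beta>\<close>\<close>
      proof (rule field_le_mult_one_interval)
        fix z :: real assume z: "0 < z" "z < 1"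
        show "z * (d * \<beta>) \<le> 1 - d"
        proof (cases "1 \<le> z * \<beta>")
          case True
          have "z * \<beta> < \<beta>" using z \<beta>(1) by simp
          then have "ln (z * \<beta>) < ln \<beta>" using True by simp
          then have "d * (1 + z * \<beta>) \<le> 1" using True \<beta>(3) by (intro dup) auto
          then show ?thesis by (simp add: algebra_simps)
        next
          case False
          then have "d * (z * \<beta>) \<le> d * 1" using d by (intro mult_left_mono) auto
          moreover have "d * (1 + 1) \<le> 1" by (rule dup) auto
          ultimately show ?thesis by (simp add: algebra_simps)
        qed
      qed
      then show ?thesis by (simp add: algebra_simps)
    qed
    moreover have "1 / (1 + \<beta>) \<le> d"
    proof (rule dense_le_bounded[of 0])
      show "0 < 1 / (1 + \<beta>)" using \<beta>(1) by simp
      fix s assume s: "0 < s" "s < 1 / (1 + \<beta>)"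
      then have "s * (1 + \<beta>) < 1" using \<beta>(1) by (simp add: field_simps)
      then have bs: "\<beta> < 1 / s - 1" using s by (simp add: field_simps)
      define \<beta>1 where "\<beta>1 = (\<beta> + (1 / s - 1)) / 2"
      define \<beta>2 where "\<beta>2 = (\<beta> + \<beta>1) / 2"
      have bb: "\<beta> < \<beta>2" "\<beta>2 < \<beta>1" "\<beta>1 < 1 / s - 1" using bs by (auto simp: \<beta>1_def \<beta>2_def)
      have "ennreal s \<le> ?D"
      proof (rule exceptional_dim_ge_growth[OF \<Phi> lim])
        show "1 < \<beta>1" using bb \<beta>(1) by linarith
        show "0 < s" by (rule s)
        show "s * (1 + \<beta>1) < 1" using bb(3) s by (simp add: field_simps)
        fix c :: real assume c: "0 < c"
        have "\<exists>\<^sub>\<infinity>n. ln (ln (\<Phi> n)) < ln \<beta>2 * real n"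
        proof (rule liminf_ratio_less)
          show "liminf (\<lambda>n. ereal (ln (ln (\<Phi> n)) / real n)) < ereal (ln \<beta>2)"
            unfolding b[symmetric] \<beta>(3) using bb(1) \<beta>(1) by simp
        qed
        moreover have "\<forall>\<^sub>\<infinity>n. 1 \<le> n \<and> \<beta>2 ^ n * (1 / c + real n * 0) < \<beta>1 ^ n"
          unfolding cofinite_eq_sequentially using bb \<beta>(1)
          by (intro eventually_conj eventually_ge_at_top geometric_dominates) auto
        ultimately have "\<exists>\<^sub>\<infinity>n. ln (ln (\<Phi> n)) < ln \<beta>2 * real n \<and> 1 \<le> n \<and> \<beta>2 ^ n * (1 / c + real n * 0) < \<beta>1 ^ n"
          by (rule INFM_conjI)
        then show "\<exists>\<^sub>\<infinity>n. ln (\<Phi> n) < c * \<beta>1 ^ n"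
        proof (rule INFM_mono)
          fix n assume n: "ln (ln (\<Phi> n)) < ln \<beta>2 * real n \<and> 1 \<le> n \<and> \<beta>2 ^ n * (1 / c + real n * 0) < \<beta>1 ^ n"
          have "ln (\<Phi> n) = exp (ln (ln (\<Phi> n)))" using lnpos n by simp
          also have "\<dots> < exp (ln \<beta>2 * real n)" using n by simp
          also have "\<dots> = \<beta>2 ^ n" using bb(1) \<beta>(1) by (simp add: exp_of_nat_mult mult.commute)
          also have "\<dots> < c * \<beta>1 ^ n" using n c by (simp add: field_simps)
          finally show "ln (\<Phi> n) < c * \<beta>1 ^ n" .
        qed
      qed
      then show "s \<le> d" using d s by simp
    qed
    ultimately have "d = 1 / (1 + \<beta>)" using \<beta>(1) by (intro antisym) (auto simp: field_simps)
    then have "?D = ennreal 1 / ennreal (1 + \<beta>)" using d(1) \<beta>(1) by (subst divide_ennreal) auto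
    also have "ennreal (1 + \<beta>) = 1 + b" using \<beta> by simp
    finally show ?thesis by simp
  qed
qed

theorem theorem1p7:
  fixes \<Phi> :: "nat \<Rightarrow> real" and B b :: ennreal
  assumes "\<forall>n\<ge>1. \<Phi> n > 1"
    and "filterlim \<Phi> at_top sequentially"
    and "ln_ennreal B = liminf (\<lambda>n. ereal (ln (\<Phi> n) / real n))"
    and "ln_ennreal b = liminf (\<lambda>n. ereal (ln (ln (\<Phi> n)) / real n))"
  shows "(1 < B \<and> B < \<infinity> \<longrightarrow>
            hausdorff_dim (exceptional_set \<Phi>) = dimensional_number (enn2real B)) \<and>
         (B = \<infinity> \<longrightarrow> hausdorff_dim (exceptional_set \<Phi>) = 1 / (1 + b))"
proof (intro conjI impI)
  assume B: "1 < B \<and> B < \<infinity>"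
  then obtain r where r: "B = ennreal r" "0 \<le> r" by (cases B) auto
  then have r1: "1 < r" using B by (simp add: ennreal_less_iff flip: ennreal_1)
  have "ln_ennreal B = ereal (ln (enn2real B))" using r r1 by (simp add: ln_ennreal_def ennreal_eq_0_iff)
  then show "hausdorff_dim (exceptional_set \<Phi>) = dimensional_number (enn2real B)"
    using r r1 assms by (intro exceptional_dim_finite_B) auto
next
  assume "B = \<infinity>"
  then show "hausdorff_dim (exceptional_set \<Phi>) = 1 / (1 + b)"
    using assms by (intro exceptional_dim_infinite_B) (auto simp: ln_ennreal_def)
qed

end
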